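(* Let $\mathcal{H}_A$ be a finite-dimensional complex Hilbert space and let $\Phi:\mathcal{B}(\mathcal{H}_A)\to\mathcal{B}(\mathcal{H}_A)$ be a completely positive and unital map whose Hilbert–Schmidt dual $\Phi^*$ has a full-rank fixed point. Let $(d_1,\dots,d_k)$ be the block dimensions of the fixed point algebra $\mathrm{Fix}(\Phi)\cong\bigoplus_{i=1}^kM_{d_i}(\mathbb{C})$. Then every classical-quantum state $\rho_{AZ}\in\mathcal{S}(\mathcal{H}_A\otimes\mathcal{H}_Z)$ with classical $Z$-system satisfying $(\Phi^*\otimes\mathrm{id}_Z)(\rho_{AZ})=\rho_{AZ}$ obeys $$I(A:Z)_{\rho_{AZ}}\le\log\Big(\sum_{i=1}^k d_i\Big),$$ and the bound is attained (by some such state, for a suitable classical register $Z$).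
   Context: $\log$ is base 2. The Hilbert–Schmidt dual of $\Phi$ is defined by $\mathrm{tr}[\Phi^*(\rho)a]=\mathrm{tr}[\rho\,\Phi(a)]$. $\mathrm{Fix}(\Phi)=\{X:\Phi(X)=X\}$ is, under the full-rank hypothesis, a unital $*$-subalgebra of $\mathcal{B}(\mathcal{H}_A)$; there is a decomposition $\mathcal{H}_A\cong\bigoplus_{i=1}^k\mathcal{H}_{i,1}\otimes\mathcal{H}_{i,2}$ with $\mathrm{Fix}(\Phi)\cong\bigoplus_i\mathcal{B}(\mathcal{H}_{i,1})\otimes1$ and $d_i=\dim\mathcal{H}_{i,1}$. A classical-quantum state with classical $Z$ (finite alphabet $\mathcal{Z}$) has the form $\rho_{AZ}=\sum_{z\in\mathcal{Z}}p(z)\rho_{A|z}\otimes|z\rangle\langle z|$ for a fixed orthonormal basis $\{|z\rangle\}$ of $\mathcal{H}_Z=\mathbb{C}^{|\mathcal{Z}|}$. The mutual information is $I(A:Z)_\rho=H(A)_\rho+H(Z)_\rho-H(AZ)_\rho$ with $H$ the von Neumann entropy. *)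

theory Defs
  imports
    "Jordan_Normal_Form.Schur_Decomposition"
    "Jordan_Normal_Form.DL_Rank"
begin

text \<open>The Hilbert space of dimension \<open>n\<close> is $\mathbb{C}^n$ with its standard inner product, and
  its operators are the complex matrices in \<open>carrier_mat n n\<close>. In $\mathbb{C}^n \otimes
  \mathbb{C}^m$ the product basis vector $e_i \otimes e_k$ has index \<open>i * m + k\<close>.\<close>

definition mat_trace :: "complex mat \<Rightarrow> complex" where
  "mat_trace A = (\<Sum>i<dim_row A. A $$ (i, i))"

definition kron :: "complex mat \<Rightarrow> complex mat \<Rightarrow> complex mat" where
  "kron A B = mat (dim_row A * dim_row B) (dim_col A * dim_col B)
     (\<lambda>(i, j). A $$ (i div dim_row B, j div dim_col B) * B $$ (i mod dim_row B, j mod dim_col B))"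

text \<open>The order on \<^typ>\<open>complex\<close> is that of \<open>Complex_Order\<close>: \<open>0 \<le> c\<close> says that \<open>c\<close> is real
  and nonnegative. So positivity implies that the matrix is Hermitian.\<close>

definition psd :: "nat \<Rightarrow> complex mat \<Rightarrow> bool" where
  "psd n A \<longleftrightarrow> A \<in> carrier_mat n n \<and> (\<forall>v \<in> carrier_vec n. 0 \<le> (A *\<^sub>v v) \<bullet>c v)"

definition unitary_mat :: "nat \<Rightarrow> complex mat \<Rightarrow> bool" where
  "unitary_mat n U \<longleftrightarrow>
     U \<in> carrier_mat n n \<and> mat_adjoint U * U = 1\<^sub>m n \<and> U * mat_adjoint U = 1\<^sub>m n"

definition density :: "nat \<Rightarrow> complex mat \<Rightarrow> bool" where
  "density n \<rho> \<longleftrightarrow> psd n \<rho> \<and> mat_trace \<rho> = 1"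

definition linear_map :: "nat \<Rightarrow> (complex mat \<Rightarrow> complex mat) \<Rightarrow> bool" where
  "linear_map n \<Phi> \<longleftrightarrow>
     (\<forall>X \<in> carrier_mat n n. \<Phi> X \<in> carrier_mat n n) \<and>
     (\<forall>X \<in> carrier_mat n n. \<forall>Y \<in> carrier_mat n n. \<Phi> (X + Y) = \<Phi> X + \<Phi> Y) \<and>
     (\<forall>c. \<forall>X \<in> carrier_mat n n. \<Phi> (c \<cdot>\<^sub>m X) = c \<cdot>\<^sub>m \<Phi> X)"

text \<open>For $X = \sum_{k,l} X_{kl} \otimes |k\rangle\langle l|$ on $\mathbb{C}^n \otimes
  \mathbb{C}^m$, \<open>mat_slice n m X k l\<close> is the operator $X_{kl}$ on $\mathbb{C}^n$, and
  $(\Phi \otimes \mathrm{id}_m)(X) = \sum_{k,l} \Phi(X_{kl}) \otimes |k\rangle\langle l|$.\<close>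

definition mat_slice :: "nat \<Rightarrow> nat \<Rightarrow> complex mat \<Rightarrow> nat \<Rightarrow> nat \<Rightarrow> complex mat" where
  "mat_slice n m X k l = mat n n (\<lambda>(i, j). X $$ (i * m + k, j * m + l))"

definition tensor_id ::
  "nat \<Rightarrow> nat \<Rightarrow> (complex mat \<Rightarrow> complex mat) \<Rightarrow> complex mat \<Rightarrow> complex mat" where
  "tensor_id n m \<Phi> X = mat (n * m) (n * m)
     (\<lambda>(r, s). \<Phi> (mat_slice n m X (r mod m) (s mod m)) $$ (r div m, s div m))"

definition completely_positive :: "nat \<Rightarrow> (complex mat \<Rightarrow> complex mat) \<Rightarrow> bool" where
  "completely_positive n \<Phi> \<longleftrightarrow>
     linear_map n \<Phi> \<and> (\<forall>m X. psd (n * m) X \<longrightarrow> psd (n * m) (tensor_id n m \<Phi> X))"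

definition unital :: "nat \<Rightarrow> (complex mat \<Rightarrow> complex mat) \<Rightarrow> bool" where
  "unital n \<Phi> \<longleftrightarrow> \<Phi> (1\<^sub>m n) = 1\<^sub>m n"

text \<open>On \<open>carrier_mat n n\<close> the dual \<open>\<Psi>\<close> of a linear \<open>\<Phi>\<close> exists and is unique, by
  nondegeneracy of the trace form.\<close>

definition hs_dual ::
  "nat \<Rightarrow> (complex mat \<Rightarrow> complex mat) \<Rightarrow> (complex mat \<Rightarrow> complex mat) \<Rightarrow> bool" where
  "hs_dual n \<Phi> \<Psi> \<longleftrightarrow> (\<forall>\<rho> \<in> carrier_mat n n. \<Psi> \<rho> \<in> carrier_mat n n \<and>
     (\<forall>a \<in> carrier_mat n n. mat_trace (\<Psi> \<rho> * a) = mat_trace (\<rho> * \<Phi> a)))"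

definition Fix :: "nat \<Rightarrow> (complex mat \<Rightarrow> complex mat) \<Rightarrow> complex mat set" where
  "Fix n \<Phi> = {X \<in> carrier_mat n n. \<Phi> X = X}"

text \<open>\<open>block_dims n F ds\<close>: there is a unitary identification of $\mathbb{C}^n$ with
  $\bigoplus_i \mathbb{C}^{d_i} \otimes \mathbb{C}^{m_i}$ under which \<open>F\<close> becomes
  $\bigoplus_i \mathcal{B}(\mathbb{C}^{d_i}) \otimes 1$. All $d_i$ and $m_i$ are nonzero;
  the list \<open>ds\<close> is determined by \<open>F\<close> up to order.\<close>

definition block_dims :: "nat \<Rightarrow> complex mat set \<Rightarrow> nat list \<Rightarrow> bool" where
  "block_dims n F ds \<longleftrightarrow> (\<exists>ms U.
     length ms = length ds \<and> (\<forall>d \<in> set ds. 0 < d) \<and> (\<forall>m \<in> set ms. 0 < m) \<and>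
     (\<Sum>i<length ds. ds ! i * ms ! i) = n \<and> unitary_mat n U \<and>
     F = {U * diag_block_mat (map2 (\<lambda>X m. kron X (1\<^sub>m m)) Xs ms) * mat_adjoint U | Xs.
            list_all2 (\<lambda>X d. X \<in> carrier_mat d d) Xs ds})"

definition proj_basis :: "nat \<Rightarrow> nat \<Rightarrow> complex mat" where
  "proj_basis m z = mat m m (\<lambda>(k, l). if k = z \<and> l = z then 1 else 0)"

text \<open>States $\sum_z p(z)\, \rho_{A|z} \otimes |z\rangle\langle z|$, with the alphabet of the
  classical register being \<open>{..<m}\<close> and $|z\rangle$ the standard basis. The sum of matrices is
  written out entrywise.\<close>

definition cq_state :: "nat \<Rightarrow> nat \<Rightarrow> complex mat \<Rightarrow> bool" where
  "cq_state n m \<rho> \<longleftrightarrow> (\<exists>(p :: nat \<Rightarrow> real) R.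
     (\<forall>z<m. 0 \<le> p z) \<and> (\<Sum>z<m. p z) = 1 \<and> (\<forall>z<m. density n (R z)) \<and>
     \<rho> = mat (n * m) (n * m)
           (\<lambda>rs. \<Sum>z<m. (complex_of_real (p z) \<cdot>\<^sub>m kron (R z) (proj_basis m z)) $$ rs))"

definition ptrace_snd :: "nat \<Rightarrow> nat \<Rightarrow> complex mat \<Rightarrow> complex mat" where
  "ptrace_snd n m X = mat n n (\<lambda>(i, j). \<Sum>k<m. X $$ (i * m + k, j * m + k))"

definition ptrace_fst :: "nat \<Rightarrow> nat \<Rightarrow> complex mat \<Rightarrow> complex mat" where
  "ptrace_fst n m X = mat m m (\<lambda>(k, l). \<Sum>i<n. X $$ (i * m + k, i * m + l))"

text \<open>$H(\rho) = -\mathrm{tr}(\rho \log \rho) = -\sum_\lambda \lambda \log \lambda$, where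
  $\lambda$ runs over the eigenvalues with multiplicity, i.e. over the roots of the characteristic
  polynomial. The eigenvalues of a density matrix are real, and $0 \log 0 = 0$ holds because the
  product is zero.\<close>

definition vn_entropy :: "complex mat \<Rightarrow> real" where
  "vn_entropy \<rho> = - (\<Sum>x \<in># proots (char_poly \<rho>). Re x * log 2 (Re x))"

definition mutual_information :: "nat \<Rightarrow> nat \<Rightarrow> complex mat \<Rightarrow> real" where
  "mutual_information n m \<rho> =
     vn_entropy (ptrace_snd n m \<rho>) + vn_entropy (ptrace_fst n m \<rho>) - vn_entropy \<rho>"

end

theory Submission
  imports Defs
begin

text \<open>Applying complete positivity to the Gram matrix of \<open>(1, a, x)\<close> shows that \<open>\<Phi>\<close> is a bimodule map
  over its fixed point algebra, and so is the projection \<open>E\<close> onto that algebra obtained as a limit of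
  Cesaro averages. The bimodule property determines \<open>E\<close> on matrix units up to scalars, and these scalars
  are the entries of densities \<open>w\<^sub>i\<close> such that the fixed points of the dual map are exactly the operators
  \<open>\<Oplus>\<^sub>i X\<^sub>i \<otimes> w\<^sub>i\<close>. For a fixed classical-quantum state with blocks \<open>X\<^sub>z\<^sub>i\<close> the entropies of the \<open>w\<^sub>i\<close> cancel
  in \<open>H(A) + H(Z) - H(AZ)\<close>. What remains is at most the entropy of \<open>\<Oplus>\<^sub>i \<Sum>\<^sub>z X\<^sub>z\<^sub>i\<close>, a state of dimension
  \<open>\<Sum>\<^sub>i d\<^sub>i\<close>, because \<open>H(Z)\<close> does not exceed the total entropy of the blocks; the uniform ensemble of the
  states \<open>|a\<rangle>\<langle>a| \<otimes> w\<^sub>i\<close> gives equality.\<close>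

subsection \<open>Positive forms and completely positive maps\<close>

text \<open>The bimodule argument sees the fixed point algebra only through its matrix units
  \<open>block_unit i a b\<close>: each of them, its adjoint and their product are fixed, which is
  exactly what the Gram matrix argument asks of \<open>a\<close>. The dual map is reached through
  traces alone. A coefficient of \<rho> is its trace against one rank-one operator, and \<rho> being
  fixed by the dual turns into tr(\<rho> E X) = tr(\<rho> X), so the values of \<open>E\<close> on
  rank-one operators decide which \<rho> are fixed. On the entropy side the obstacle is that entropy
  is defined by the roots of the characteristic polynomial of a flat matrix, while the structure
  lives on triples (i, a, \<alpha>). Operators are therefore handled as coefficient functions over a
  finite label set, and the spectrum is reached by similarity. Triangular forms of
  \<open>X i\<close> and \<open>w i\<close> are enough, because a lexicographic enumeration keeps
  their tensor product triangular with products of eigenvalues on the diagonal. One computation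
  serves both the marginal on A and the state on AZ, with blocks labelled by i and by pairs (z,
  i).\<close>

definition sesq :: "nat \<Rightarrow> complex mat \<Rightarrow> (nat \<Rightarrow> complex) \<Rightarrow> (nat \<Rightarrow> complex) \<Rightarrow> complex" where
  "sesq n A f g = (\<Sum>i<n. \<Sum>j<n. cnj (f i) * A $$ (i, j) * g j)"

definition dag :: "complex mat \<Rightarrow> complex mat" where
  "dag A = mat (dim_col A) (dim_row A) (\<lambda>(i, j). cnj (A $$ (j, i)))"

lemma dag_carrier [simp]: "A \<in> carrier_mat n m \<Longrightarrow> dag A \<in> carrier_mat m n"
  by (auto simp: dag_def)

lemma dag_index [simp]: "i < dim_col A \<Longrightarrow> j < dim_row A \<Longrightarrow> dag A $$ (i, j) = cnj (A $$ (j, i))"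
  by (simp add: dag_def)

lemma mat_adjoint_eq_dag: "mat_adjoint A = dag A"
  by (rule eq_matI) (auto simp: mat_adjoint_def dag_def mat_of_rows_def)

lemma mult_index:
  assumes "A \<in> carrier_mat n m" "B \<in> carrier_mat m k" "i < n" "j < k"
  shows "(A * B) $$ (i, j) = (\<Sum>l<m. A $$ (i, l) * B $$ (l, j))"
  using assms by (auto simp: scalar_prod_def atLeast0LessThan intro!: sum.cong)

lemma psd_iff_sesq: "psd n A \<longleftrightarrow> A \<in> carrier_mat n n \<and> (\<forall>f. 0 \<le> sesq n A f f)"
proof (cases "A \<in> carrier_mat n n")
  case True
  have eq: "(A *\<^sub>v v) \<bullet>c v = sesq n A (\<lambda>i. v $ i) (\<lambda>i. v $ i)" if "v \<in> carrier_vec n" for v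
    using True that
    by (auto simp: sesq_def scalar_prod_def atLeast0LessThan sum_distrib_left sum_distrib_right
        mult_ac intro!: sum.cong)
  have eq': "sesq n A f f = (A *\<^sub>v vec n f) \<bullet>c vec n f" for f
    by (subst eq) (auto simp: sesq_def)
  show ?thesis
  proof
    assume "psd n A"
    then show "A \<in> carrier_mat n n \<and> (\<forall>f. 0 \<le> sesq n A f f)"
      unfolding psd_def eq' by auto
  next
    assume "A \<in> carrier_mat n n \<and> (\<forall>f. 0 \<le> sesq n A f f)"
    then show "psd n A"
      unfolding psd_def by (auto simp: eq)
  qed
qed (auto simp: psd_def)

lemma sum_mult_split:
  fixes g :: "nat \<Rightarrow> 'a::comm_monoid_add"
  shows "(\<Sum>r<n * m. g r) = (\<Sum>i<n. \<Sum>k<m. g (i * m + k))"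
proof -
  have "(\<Sum>r<n * m. g r) = (\<Sum>i<n. sum g {i * m..<i * m + m})"
    by (rule sum.nat_group [symmetric])
  also have "\<dots> = (\<Sum>i<n. \<Sum>k<m. g (i * m + k))"
  proof (rule sum.cong [OF refl])
    fix i
    show "sum g {i * m..<i * m + m} = (\<Sum>k<m. g (i * m + k))"
      by (subst sum.atLeastLessThan_shift_0) (simp add: atLeast0LessThan)
  qed
  finally show ?thesis .
qed

lemma mult_add_less:
  fixes i k n m :: nat
  shows "i < n \<Longrightarrow> k < m \<Longrightarrow> i * m + k < n * m"
proof -
  assume "i < n" "k < m"
  then have "i * m + k < Suc i * m" by simp
  also have "\<dots> \<le> n * m" using \<open>i < n\<close> by (intro mult_right_mono) auto
  finally show ?thesis .
qed

lemma mat_slice_simps [simp]: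
  "dim_row (mat_slice n m X k l) = n" "dim_col (mat_slice n m X k l) = n"
  "i < n \<Longrightarrow> j < n \<Longrightarrow> mat_slice n m X k l $$ (i, j) = X $$ (i * m + k, j * m + l)"
  by (auto simp: mat_slice_def)

lemma mat_slice_tensor_id:
  assumes "k < m" "l < m" "\<Phi> (mat_slice n m X k l) \<in> carrier_mat n n"
  shows "mat_slice n m (tensor_id n m \<Phi> X) k l = \<Phi> (mat_slice n m X k l)"
  using assms by (intro eq_matI) (auto simp: tensor_id_def mult_add_less)

lemma sesq_tensor:
  "sesq (n * m) A f g = (\<Sum>k<m. \<Sum>l<m. sesq n (mat_slice n m A k l)
      (\<lambda>i. f (i * m + k)) (\<lambda>j. g (j * m + l)))"
proof -
  have "sesq (n * m) A f g = (\<Sum>i<n. \<Sum>k<m. \<Sum>j<n. \<Sum>l<m.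
      cnj (f (i * m + k)) * A $$ (i * m + k, j * m + l) * g (j * m + l))"
    by (simp add: sesq_def sum_mult_split)
  also have "\<dots> = (\<Sum>i<n. \<Sum>k<m. \<Sum>l<m. \<Sum>j<n.
      cnj (f (i * m + k)) * A $$ (i * m + k, j * m + l) * g (j * m + l))"
    by (intro sum.cong refl sum.swap)
  also have "\<dots> = (\<Sum>k<m. \<Sum>i<n. \<Sum>l<m. \<Sum>j<n.
      cnj (f (i * m + k)) * A $$ (i * m + k, j * m + l) * g (j * m + l))"
    by (rule sum.swap)
  also have "\<dots> = (\<Sum>k<m. \<Sum>l<m. \<Sum>i<n. \<Sum>j<n.
      cnj (f (i * m + k)) * A $$ (i * m + k, j * m + l) * g (j * m + l))"
    by (intro sum.cong refl sum.swap)
  also have "\<dots> = (\<Sum>k<m. \<Sum>l<m. sesq n (mat_slice n m A k l)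
      (\<lambda>i. f (i * m + k)) (\<lambda>j. g (j * m + l)))"
    by (intro sum.cong refl) (auto simp: sesq_def mat_slice_def intro!: sum.cong)
  finally show ?thesis .
qed

text \<open>Complete positivity for operator matrices: the family \<open>x\<close> is packed into
  one operator on the tensor product whose slices are the \<open>x k l\<close>. It is used with m =
  1 for positivity, m = 2 for contractions and m = 3 for the multiplicative domain.\<close>

lemma cp_family:
  fixes m n :: nat
  assumes cp: "completely_positive n \<Phi>"
    and x: "\<And>k l. k < m \<Longrightarrow> l < m \<Longrightarrow> x k l \<in> carrier_mat n n"
    and pos: "\<And>w. 0 \<le> (\<Sum>k<m. \<Sum>l<m. sesq n (x k l) (w k) (w l))"
  shows "0 \<le> (\<Sum>k<m. \<Sum>l<m. sesq n (\<Phi> (x k l)) (w k) (w l))"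
proof -
  define X where "X = mat (n * m) (n * m) (\<lambda>(r, s). x (r mod m) (s mod m) $$ (r div m, s div m))"
  have slice: "mat_slice n m X k l = x k l" if "k < m" "l < m" for k l
    using that x[OF that]
    by (intro eq_matI) (auto simp: mat_slice_def X_def mult_add_less)
  have "psd (n * m) X"
    unfolding psd_iff_sesq sesq_tensor
  proof (intro conjI allI)
    fix f
    have "(\<Sum>k<m. \<Sum>l<m. sesq n (mat_slice n m X k l) (\<lambda>i. f (i * m + k)) (\<lambda>j. f (j * m + l)))
        = (\<Sum>k<m. \<Sum>l<m. sesq n (x k l) (\<lambda>i. f (i * m + k)) (\<lambda>j. f (j * m + l)))"
      by (intro sum.cong refl) (simp add: slice)
    then show "0 \<le> (\<Sum>k<m. \<Sum>l<m. sesq n (mat_slice n m X k l) (\<lambda>i. f (i * m + k)) (\<lambda>j. f (j * m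
        + l)))"
      using pos[of "\<lambda>k i. f (i * m + k)"] by simp
  qed (simp add: X_def)
  with cp have *: "psd (n * m) (tensor_id n m \<Phi> X)"
    by (simp add: completely_positive_def)
  have slice': "mat_slice n m (tensor_id n m \<Phi> X) k l = \<Phi> (x k l)" if "k < m" "l < m" for k l
  proof -
    have "\<Phi> (x k l) \<in> carrier_mat n n"
      using cp x[OF that] by (auto simp: completely_positive_def linear_map_def)
    then show ?thesis
      using mat_slice_tensor_id[of k m l \<Phi> n X] that by (simp add: slice)
  qed
  define f where "f = (\<lambda>r. w (r mod m) (r div m))"
  have "0 \<le> sesq (n * m) (tensor_id n m \<Phi> X) f f"
    using * by (simp add: psd_iff_sesq)
  also have "\<dots> = (\<Sum>k<m. \<Sum>l<m. sesq n (\<Phi> (x k l)) (w k) (w l))"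
    unfolding sesq_tensor
    by (intro sum.cong refl) (auto simp: slice' f_def sesq_def intro!: sum.cong)
  finally show ?thesis .
qed

lemma sesq_smult_left: "sesq n A (\<lambda>i. c * f i) h = cnj c * sesq n A f h"
  by (simp add: sesq_def algebra_simps sum_distrib_left)

lemma sesq_smult_right: "sesq n A h (\<lambda>i. c * f i) = c * sesq n A h f"
  by (simp add: sesq_def algebra_simps sum_distrib_left)

lemma sesq_uminus_left: "sesq n A (\<lambda>i. - f i) h = - sesq n A f h"
  by (simp add: sesq_def sum_negf)

lemma sesq_uminus_right: "sesq n A h (\<lambda>i. - f i) = - sesq n A h f"
  by (simp add: sesq_def sum_negf)

lemma sesq_unit:
  assumes "p < n" "q < n"
  shows "sesq n A (\<lambda>i. if i = p then 1 else 0) (\<lambda>i. if i = q then 1 else 0) = A $$ (p, q)"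
proof -
  have "sesq n A (\<lambda>i. if i = p then 1 else 0) (\<lambda>i. if i = q then 1 else 0)
     = (\<Sum>i<n. \<Sum>j<n. if j = q then (if i = p then A $$ (i, j) else 0) else 0)"
    unfolding sesq_def by (intro sum.cong refl) auto
  also have "\<dots> = A $$ (p, q)"
    using assms by simp
  finally show ?thesis .
qed

lemma mat_eq_sesqI:
  assumes "A \<in> carrier_mat n n" "B \<in> carrier_mat n n" "\<And>f g. sesq n A f g = sesq n B f g"
  shows "A = B"
proof (rule eq_matI)
  fix i j assume "i < dim_row B" "j < dim_col B"
  then have "i < n" "j < n" using assms by auto
  then show "A $$ (i, j) = B $$ (i, j)"
    using sesq_unit[of i n j A] sesq_unit[of i n j B] assms(3) by simp
qed (use assms in auto)

definition apply_mat :: "nat \<Rightarrow> complex mat \<Rightarrow> (nat \<Rightarrow> complex) \<Rightarrow> nat \<Rightarrow> complex" where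
  "apply_mat n A f i = (\<Sum>j<n. A $$ (i, j) * f j)"

lemma sesq_mult_right:
  assumes "A \<in> carrier_mat n n" "B \<in> carrier_mat n n"
  shows "sesq n (A * B) f g = sesq n A f (apply_mat n B g)"
proof -
  have "sesq n (A * B) f g = (\<Sum>i<n. \<Sum>j<n. \<Sum>l<n. cnj (f i) * A $$ (i, l) * B $$ (l, j) * g j)"
    unfolding sesq_def using assms
    by (intro sum.cong refl, subst mult_index[where n = n and m = n and k = n])
       (auto simp: sum_distrib_left sum_distrib_right mult_ac)
  also have "\<dots> = (\<Sum>i<n. \<Sum>l<n. \<Sum>j<n. cnj (f i) * A $$ (i, l) * B $$ (l, j) * g j)"
    by (intro sum.cong refl sum.swap)
  also have "\<dots> = sesq n A f (apply_mat n B g)"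
    by (simp add: sesq_def apply_mat_def sum_distrib_left mult_ac)
  finally show ?thesis .
qed

lemma sesq_mult_left:
  assumes "A \<in> carrier_mat n n" "B \<in> carrier_mat n n"
  shows "sesq n (dag A * B) f g = sesq n B (apply_mat n A f) g"
proof -
  have "sesq n (dag A * B) f g = (\<Sum>i<n. \<Sum>j<n. \<Sum>l<n. cnj (f i) * cnj (A $$ (l, i)) * B $$ (l, j) *
      g j)"
    unfolding sesq_def using assms
    by (intro sum.cong refl, subst mult_index[where n = n and m = n and k = n])
       (auto simp: sum_distrib_left sum_distrib_right mult_ac)
  also have "\<dots> = (\<Sum>i<n. \<Sum>l<n. \<Sum>j<n. cnj (f i) * cnj (A $$ (l, i)) * B $$ (l, j) * g j)"
    by (intro sum.cong refl sum.swap)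
  also have "\<dots> = (\<Sum>l<n. \<Sum>i<n. \<Sum>j<n. cnj (f i) * cnj (A $$ (l, i)) * B $$ (l, j) * g j)"
    by (rule sum.swap)
  also have "\<dots> = (\<Sum>l<n. \<Sum>j<n. \<Sum>i<n. cnj (f i) * cnj (A $$ (l, i)) * B $$ (l, j) * g j)"
    by (intro sum.cong refl sum.swap)
  also have "\<dots> = sesq n B (apply_mat n A f) g"
    by (simp add: sesq_def apply_mat_def sum_distrib_left sum_distrib_right mult_ac)
  finally show ?thesis .
qed

lemma sesq_one: "sesq n (1\<^sub>m n) f g = (\<Sum>i<n. cnj (f i) * g i)"
proof -
  have "sesq n (1\<^sub>m n) f g = (\<Sum>i<n. \<Sum>j<n. if j = i then cnj (f i) * g j else 0)"
    unfolding sesq_def by (intro sum.cong refl) auto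
  then show ?thesis by simp
qed

lemma dag_mult_one [simp]: "A \<in> carrier_mat n n \<Longrightarrow> dag A * 1\<^sub>m n = dag A"
  by (rule right_mult_one_mat [OF dag_carrier])

lemma sesq_one_apply: 
  "A \<in> carrier_mat n n \<Longrightarrow> sesq n (1\<^sub>m n) f (apply_mat n A g) = sesq n A f g"
  by (subst sesq_mult_right[symmetric]) auto

lemma dag_dag: "dag (dag A) = A"
  by (rule eq_matI) (auto simp: dag_def)

section \<open>Gram matrices and the multiplicative domain\<close>

lemma cnj_mult_self_nonneg: "0 \<le> cnj z * z"
  by (simp add: less_eq_complex_def)

text \<open>The double sum is the squared norm of one vector, the sum over k of \<open>v k\<close>
  applied to \<open>w k\<close>.\<close>

lemma gram_family_nonneg:
  assumes v: "\<And>k. k < m \<Longrightarrow> v k \<in> carrier_mat n n"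
  shows "0 \<le> (\<Sum>k<m. \<Sum>l<m. sesq n (dag (v k) * v l) (w k) (w l))"
proof -
  have "(\<Sum>k<m. \<Sum>l<m. sesq n (dag (v k) * v l) (w k) (w l))
      = (\<Sum>k<m. \<Sum>l<m. sesq n (1\<^sub>m n) (apply_mat n (v k) (w k)) (apply_mat n (v l) (w l)))"
    by (intro sum.cong refl) (simp add: v sesq_mult_left sesq_one_apply)
  also have "\<dots> = (\<Sum>k<m. \<Sum>l<m. \<Sum>i<n. cnj (apply_mat n (v k) (w k) i) * apply_mat n (v l) (w l) i)"
    by (simp add: sesq_one)
  also have "\<dots> = (\<Sum>k<m. \<Sum>i<n. \<Sum>l<m. cnj (apply_mat n (v k) (w k) i) * apply_mat n (v l) (w l) i)"
    by (intro sum.cong refl sum.swap)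
  also have "\<dots> = (\<Sum>i<n. \<Sum>k<m. \<Sum>l<m. cnj (apply_mat n (v k) (w k) i) * apply_mat n (v l) (w l) i)"
    by (rule sum.swap)
  also have "\<dots> = (\<Sum>i<n. cnj (\<Sum>k<m. apply_mat n (v k) (w k) i) * (\<Sum>l<m. apply_mat n (v l) (w l) i))"
    by (simp add: sum_product)
  also have "0 \<le> \<dots>"
    by (intro sum_nonneg cnj_mult_self_nonneg)
  finally show ?thesis .
qed

text \<open>Near 0 a term linear in t dominates |t|^2 and changes sign with t, so it must vanish.
  Real t gives c + d = 0 and imaginary t gives c - d = 0.\<close>

lemma quadratic_nonneg_imp_zero:
  fixes c d q :: complex
  assumes "\<And>t. 0 \<le> t * c + cnj t * d + cnj t * t * q"
  shows "c = 0" "d = 0"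
proof -
  have aux: "s = 0" if h: "\<And>r::real. 0 \<le> of_real r * s + of_real (r\<^sup>2) * q" for s
  proof -
    have im: "Im s = 0"
    proof -
      have "Im s + Im q = 0" "- Im s + Im q = 0"
        using h[of 1] h[of "-1"] by (auto simp: less_eq_complex_def)
      then show ?thesis by linarith
    qed
    have re: "0 \<le> r * Re s + r\<^sup>2 * Re q" for r
      using h[of r] by (auto simp: less_eq_complex_def)
    have "Re s = 0"
    proof (rule ccontr)
      assume nz: "Re s \<noteq> 0"
      \<comment> \<open>\<open>M\<close> is positive and exceeds \<open>Re q\<close>, so at r = - Re
        s / M the quadratic term cannot compensate the linear one.\<close>
      define M where "M = \<bar>Re q\<bar> + 1"
      have M: "M > 0" "Re q < M" by (auto simp: M_def)
      have "0 \<le> (- Re s / M) * Re s + (- Re s / M)\<^sup>2 * Re q"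
        by (rule re)
      also have "\<dots> = (Re s)\<^sup>2 / M * (Re q / M - 1)"
        using M by (simp add: power2_eq_square field_simps)
      also have "\<dots> < 0"
        using M nz by (intro mult_pos_neg) (auto simp: field_simps)
      finally show False by simp
    qed
    with im show ?thesis by (simp add: complex_eq_iff)
  qed
  have 1: "c + d = 0"
    by (rule aux) (use assms[of "of_real _"] in \<open>simp add: algebra_simps power2_eq_square\<close>)
  have 2: "\<i> * (c - d) = 0"
    by (rule aux) (use assms[of "\<i> * of_real _"] in \<open>simp add: algebra_simps power2_eq_square\<close>)
  from 1 2 show "c = 0" "d = 0" by auto
qed

text \<open>Apply the map to the Gram matrix of \<open>(1, a, x)\<close>. The vector
  \<open>(-a u, u, 0)\<close> is isotropic for the resulting positive form, hence in its kernel.\<close>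

lemma multiplicative_domain:
  assumes cp: "completely_positive n \<Phi>" and un: "unital n \<Phi>"
    and a: "a \<in> carrier_mat n n" "\<Phi> a = a" "\<Phi> (dag a) = dag a" "\<Phi> (dag a * a) = dag a * a"
    and x: "x \<in> carrier_mat n n"
  shows "\<Phi> (dag a * x) = dag a * \<Phi> x" and "\<Phi> (dag x * a) = \<Phi> (dag x) * a"
proof -
  have closed: "\<Phi> y \<in> carrier_mat n n" if "y \<in> carrier_mat n n" for y
    using cp that by (auto simp: completely_positive_def linear_map_def)
  define v where "v = (\<lambda>k::nat. if k = 0 then 1\<^sub>m n else if k = 1 then a else x)"
  have v: "v k \<in> carrier_mat n n" for k
    using a x by (auto simp: v_def)
  have dag1: "dag (1\<^sub>m n) = 1\<^sub>m n"
    by (rule eq_matI) (auto simp: dag_def)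
  have both: "sesq n (\<Phi> (dag a * x)) u w - sesq n (\<Phi> x) (apply_mat n a u) w = 0 \<and>
        sesq n (\<Phi> (dag x * a)) w u - sesq n (\<Phi> (dag x)) w (apply_mat n a u) = 0" for u w
  proof -
    have "0 \<le> t * (sesq n (\<Phi> (dag a * x)) u w - sesq n (\<Phi> x) (apply_mat n a u) w)
       + cnj t * (sesq n (\<Phi> (dag x * a)) w u - sesq n (\<Phi> (dag x)) w (apply_mat n a u))
       + cnj t * t * sesq n (\<Phi> (dag x * x)) w w" for t
    proof -
      \<comment> \<open>The isotropic vector is perturbed by t w in the third slot. Its own
        contribution cancels, so the form consists of cross terms linear in t and
        \<open>cnj t\<close> and one term in |t|^2.\<close>
      define f where "f = (\<lambda>k::nat. if k = 0 then (\<lambda>i. - apply_mat n a u i)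
          else if k = 1 then u else (\<lambda>i. t * w i))"
      have "0 \<le> (\<Sum>k<3. \<Sum>l<3. sesq n (\<Phi> (dag (v k) * v l)) (f k) (f l))"
        by (rule cp_family[OF cp]) (use v in \<open>auto intro!: gram_family_nonneg
            mult_carrier_mat[where n = n]\<close>)
      also have "\<dots> = sesq n (\<Phi> (1\<^sub>m n)) (apply_mat n a u) (apply_mat n a u) - sesq n (\<Phi> a)
          (apply_mat n a u) u 
          - t * sesq n (\<Phi> x) (apply_mat n a u) w
          - sesq n (\<Phi> (dag a)) u (apply_mat n a u) + sesq n (\<Phi> (dag a * a)) u u
              + t * sesq n (\<Phi> (dag a * x)) u w
          - cnj t * sesq n (\<Phi> (dag x)) w (apply_mat n a u) + cnj t * sesq n (\<Phi> (dag x * a)) w u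
          + cnj t * t * sesq n (\<Phi> (dag x * x)) w w"
        using a x
        by (simp add: numeral_3_eq_3 v_def f_def dag1 sesq_smult_left sesq_smult_right
            sesq_uminus_left sesq_uminus_right)
      also have "sesq n (\<Phi> (1\<^sub>m n)) (apply_mat n a u) (apply_mat n a u)
          = sesq n a (apply_mat n a u) u"
        using un a by (simp add: unital_def sesq_one_apply)
      also have "sesq n (\<Phi> (dag a)) u (apply_mat n a u) = sesq n a (apply_mat n a u) u"
        using a by (simp add: sesq_mult_right[symmetric] sesq_mult_left)
      also have "sesq n (\<Phi> (dag a * a)) u u = sesq n a (apply_mat n a u) u"
        using a by (simp add: sesq_mult_left)
      finally show ?thesis
        using a by (simp add: algebra_simps)
    qed
    from quadratic_nonneg_imp_zero[OF this] show ?thesis by blast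
  qed
  show "\<Phi> (dag a * x) = dag a * \<Phi> x"
    by (rule mat_eq_sesqI[of _ n])
       (use both a x closed in \<open>auto simp: sesq_mult_left intro!: closed mult_carrier_mat\<close>)
  show "\<Phi> (dag x * a) = \<Phi> (dag x) * a"
    by (rule mat_eq_sesqI[of _ n])
       (use both a x closed in \<open>auto simp: sesq_mult_right intro!: closed mult_carrier_mat\<close>)
qed

subsection \<open>The ergodic projection\<close>

definition munit :: "nat \<Rightarrow> nat \<times> nat \<Rightarrow> complex mat" where
  "munit n pq = mat n n (\<lambda>rs. if rs = pq then 1 else 0)"

lemma munit_carrier [simp]: "munit n pq \<in> carrier_mat n n"
  by (simp add: munit_def)

lemma linear_mapD:
  assumes "linear_map n \<Phi>"
  shows "X \<in> carrier_mat n n \<Longrightarrow> \<Phi> X \<in> carrier_mat n n"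
    and "X \<in> carrier_mat n n \<Longrightarrow> Y \<in> carrier_mat n n \<Longrightarrow> \<Phi> (X + Y) = \<Phi> X + \<Phi> Y"
    and "X \<in> carrier_mat n n \<Longrightarrow> \<Phi> (c \<cdot>\<^sub>m X) = c \<cdot>\<^sub>m \<Phi> X"
  using assms by (auto simp: linear_map_def)

lemma linear_map_zero:
  assumes "linear_map n \<Phi>"
  shows "\<Phi> (0\<^sub>m n n) = 0\<^sub>m n n"
proof -
  have "\<Phi> (0 \<cdot>\<^sub>m 0\<^sub>m n n) = 0 \<cdot>\<^sub>m \<Phi> (0\<^sub>m n n)"
    by (rule linear_mapD(3)[OF assms]) simp
  moreover have "0 \<cdot>\<^sub>m 0\<^sub>m n n = (0\<^sub>m n n :: complex mat)"
    by (intro eq_matI) auto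
  moreover have "0 \<cdot>\<^sub>m \<Phi> (0\<^sub>m n n) = 0\<^sub>m n n"
    using linear_mapD(1)[OF assms, of "0\<^sub>m n n"] by (intro eq_matI) auto
  ultimately show ?thesis by simp
qed

lemma linear_map_sum:
  assumes lin: "linear_map n \<Phi>" and "finite S" and B: "\<And>s. s \<in> S \<Longrightarrow> B s \<in> carrier_mat n n"
  shows "\<Phi> (mat n n (\<lambda>rs. \<Sum>s\<in>S. c s * B s $$ rs)) = mat n n (\<lambda>rs. \<Sum>s\<in>S. c s * \<Phi> (B s) $$ rs)"
  using \<open>finite S\<close> B
proof (induction S rule: finite_induct)
  case empty
  have "mat n n (\<lambda>rs. \<Sum>s\<in>{}. c s * B s $$ rs) = 0\<^sub>m n n" for B :: "'a \<Rightarrow> complex mat"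
    by (intro eq_matI) auto
  then show ?case using linear_map_zero[OF lin] by simp
next
  case (insert x S)
  have *: "D x \<in> carrier_mat n n \<Longrightarrow> mat n n (\<lambda>rs. \<Sum>s\<in>insert x S. c s * D s $$ rs) =
      c x \<cdot>\<^sub>m D x + mat n n (\<lambda>rs. \<Sum>s\<in>S. c s * D s $$ rs)"
    for D :: "'a \<Rightarrow> complex mat"
    using insert.hyps by (intro eq_matI) auto
  have Bx: "B x \<in> carrier_mat n n" using insert.prems by simp
  have "\<Phi> (mat n n (\<lambda>rs. \<Sum>s\<in>insert x S. c s * B s $$ rs))
      = c x \<cdot>\<^sub>m \<Phi> (B x) + mat n n (\<lambda>rs. \<Sum>s\<in>S. c s * \<Phi> (B s) $$ rs)"
    unfolding *[of B, OF Bx] using Bx insert by (simp add: linear_mapD[OF lin])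
  also have "\<dots> = mat n n (\<lambda>rs. \<Sum>s\<in>insert x S. c s * \<Phi> (B s) $$ rs)"
    by (rule *[symmetric, of "\<lambda>s. \<Phi> (B s)"]) (rule linear_mapD(1)[OF lin Bx])
  finally show ?case .
qed

text \<open>Each entry of \<Phi> X is a fixed finite linear combination of the entries of X. This is
  the continuity of \<Phi> that lets it pass through entrywise limits, and it reduces boundedness to
  matrix units.\<close>

lemma linear_map_expand:
  assumes lin: "linear_map n \<Phi>" and X: "X \<in> carrier_mat n n" and rs: "r < n" "s < n"
  shows "\<Phi> X $$ (r, s) = (\<Sum>pq\<in>{..<n} \<times> {..<n}. X $$ pq * \<Phi> (munit n pq) $$ (r, s))"
proof -
  have "X = mat n n (\<lambda>rs. \<Sum>pq\<in>{..<n} \<times> {..<n}. X $$ pq * munit n pq $$ rs)"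
  proof (rule eq_matI, goal_cases)
    case (1 i j)
    then have "(\<Sum>pq\<in>{..<n} \<times> {..<n}. X $$ pq * munit n pq $$ (i, j)) =
       (\<Sum>pq\<in>{..<n} \<times> {..<n}. if pq = (i, j) then X $$ pq else 0)"
      by (intro sum.cong) (auto simp: munit_def)
    also have "\<dots> = X $$ (i, j)"
      using 1 by (subst sum.delta) auto
    finally show ?case using 1 by simp
  qed (use X in auto)
  then have "\<Phi> X = \<Phi> (mat n n (\<lambda>rs. \<Sum>pq\<in>{..<n} \<times> {..<n}. X $$ pq * munit n pq $$ rs))"
    by simp
  also have "\<dots> = mat n n (\<lambda>rs. \<Sum>pq\<in>{..<n} \<times> {..<n}. X $$ pq * \<Phi> (munit n pq) $$ rs)"
    by (rule linear_map_sum[OF lin]) auto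
  finally show ?thesis using rs by simp
qed

section \<open>Uniform bounds for the powers of the map\<close>

lemma linear_map_funpow:
  assumes "linear_map n \<Phi>"
  shows "linear_map n (\<Phi> ^^ k)"
proof (induction k)
  case (Suc k)
  then show ?case using assms by (auto simp: linear_map_def)
qed (auto simp: linear_map_def)

text \<open>Positivity of the operator matrix with rows (1, x) and (y, 1), which amounts to y being
  the adjoint of x and x having operator norm at most 1. In this form the property is visibly
  preserved by unital completely positive maps.\<close>

definition contractive :: "nat \<Rightarrow> complex mat \<Rightarrow> complex mat \<Rightarrow> bool" where
  "contractive n x y \<longleftrightarrow> x \<in> carrier_mat n n \<and> y \<in> carrier_mat n n \<and>
     (\<forall>u v. 0 \<le> sesq n (1\<^sub>m n) u u + sesq n x u v + sesq n y v u + sesq n (1\<^sub>m n) v v)"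

lemma contractive_cp:
  assumes cp: "completely_positive n \<Phi>" and un: "unital n \<Phi>" and c: "contractive n x y"
  shows "contractive n (\<Phi> x) (\<Phi> y)"
proof -
  define M where "M = (\<lambda>k l :: nat. if k = l then 1\<^sub>m n else if k = 0 then x else y)"
  have M: "M k l \<in> carrier_mat n n" for k l
    using c by (auto simp: M_def contractive_def)
  have "0 \<le> sesq n (1\<^sub>m n) u u + sesq n (\<Phi> x) u v + sesq n (\<Phi> y) v u + sesq n (1\<^sub>m n) v v" for u v
  proof -
    define f where "f = (\<lambda>k::nat. if k = 0 then u else v)"
    have "0 \<le> (\<Sum>k<2. \<Sum>l<2. sesq n (\<Phi> (M k l)) (f k) (f l))"
    proof (rule cp_family[OF cp])
      fix w :: "nat \<Rightarrow> nat \<Rightarrow> complex"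
      show "0 \<le> (\<Sum>k<2. \<Sum>l<2. sesq n (M k l) (w k) (w l))"
        using c by (simp add: numeral_2_eq_2 M_def contractive_def add_ac)
    qed (use M in auto)
    then show ?thesis
      using un by (simp add: numeral_2_eq_2 M_def f_def unital_def add_ac)
  qed
  then show ?thesis
    using cp c by (auto simp: contractive_def completely_positive_def linear_map_def)
qed

text \<open>The form is evaluated at t times the i-th unit vector and at the j-th one. The values t
  = 1, -1 bound a + b, and t = \<i>, -\<i> bound a - b. The constant 2 is crude, but any bound
  common to all powers of the map serves.\<close>

lemma contractive_entry_bound:
  assumes c: "contractive n x y" and "i < n" "j < n"
  shows "cmod (x $$ (i, j)) \<le> 2"
proof -
  define a where "a = x $$ (i, j)"
  define b where "b = y $$ (j, i)"
  have *: "0 \<le> cnj t * t + cnj t * a + t * b + 1" for t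
  proof -
    have "0 \<le> sesq n (1\<^sub>m n) (\<lambda>k. t * (if k = i then 1 else 0)) (\<lambda>k. t * (if k = i then 1 else 0))
       + sesq n x (\<lambda>k. t * (if k = i then 1 else 0)) (\<lambda>k. if k = j then 1 else 0)
       + sesq n y (\<lambda>k. if k = j then 1 else 0) (\<lambda>k. t * (if k = i then 1 else 0))
       + sesq n (1\<^sub>m n) (\<lambda>k. if k = j then 1 else 0) (\<lambda>k. if k = j then 1 else 0)"
      using c unfolding contractive_def by blast
    then show ?thesis
      unfolding sesq_smult_left sesq_smult_right using assms(2,3)
      by (simp add: sesq_unit a_def b_def mult_ac)
  qed
  have 1: "cmod (a + b) \<le> 2"
  proof -
    have "0 \<le> 2 + (a + b)" "0 \<le> 2 - (a + b)"
      using *[of 1] *[of "-1"] by (simp_all add: algebra_simps)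
    then have "Im (a + b) = 0" "\<bar>Re (a + b)\<bar> \<le> 2"
      by (auto simp: less_eq_complex_def)
    then show ?thesis
      using cmod_le[of "a + b"] by simp
  qed
  have 2: "cmod (a - b) \<le> 2"
  proof -
    have "0 \<le> 2 + \<i> * (a - b)" "0 \<le> 2 - \<i> * (a - b)"
      using *[of "- \<i>"] *[of "\<i>"] by (simp_all add: algebra_simps)
    then have "Re (a - b) = 0" "\<bar>Im (a - b)\<bar> \<le> 2"
      by (auto simp: less_eq_complex_def)
    then show ?thesis
      using cmod_le[of "a - b"] by simp
  qed
  have "2 * cmod a = cmod ((a + b) + (a - b))"
    by (simp flip: norm_mult)
  also have "\<dots> \<le> 4"
    using norm_triangle_ineq[of "a + b" "a - b"] 1 2 by linarith
  finally show ?thesis by (simp add: a_def)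
qed

lemma sesq_munit:
  assumes "p < n" "q < n"
  shows "sesq n (munit n (p, q)) u v = cnj (u p) * v q"
proof -
  have "sesq n (munit n (p, q)) u v =
     (\<Sum>i<n. \<Sum>j<n. if j = q then (if i = p then cnj (u i) * v j else 0) else 0)"
    unfolding sesq_def by (intro sum.cong refl) (auto simp: munit_def)
  then show ?thesis using assms by simp
qed

text \<open>The form dominates the square |u p + v q|^2, since the full norms of u and v dominate
  single coordinates.\<close>

lemma contractive_munit:
  assumes "p < n" "q < n"
  shows "contractive n (munit n (p, q)) (munit n (q, p))"
  unfolding contractive_def
proof (intro conjI allI)
  fix u v :: "nat \<Rightarrow> complex"
  have le: "cnj (w r) * w r \<le> sesq n (1\<^sub>m n) w w" if "r < n" for w r
    unfolding sesq_one using that by (intro member_le_sum) (auto intro: cnj_mult_self_nonneg)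
  have "0 \<le> cnj (u p + v q) * (u p + v q)"
    by (rule cnj_mult_self_nonneg)
  also have "\<dots> = cnj (u p) * u p + cnj (u p) * v q + cnj (v q) * u p + cnj (v q) * v q"
    by (simp add: algebra_simps)
  also have "\<dots> \<le> sesq n (1\<^sub>m n) u u + cnj (u p) * v q + cnj (v q) * u p + sesq n (1\<^sub>m n) v v"
    using le[of p u] le[of q v] assms by (intro add_mono) auto
  finally show "0 \<le> sesq n (1\<^sub>m n) u u + sesq n (munit n (p, q)) u v + sesq n (munit n (q, p)) v u
      + sesq n (1\<^sub>m n) v v"
    using assms by (simp add: sesq_munit)
qed auto

text \<open>The pair of a matrix unit and its adjoint stays contractive under every power, so its
  entries are bounded by 2 uniformly in k; linearity carries the bound to \<open>X\<close>.\<close>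

lemma funpow_bounded:
  assumes cp: "completely_positive n \<Phi>" and un: "unital n \<Phi>" and X: "X \<in> carrier_mat n n"
  shows "\<exists>B. \<forall>k. \<forall>r<n. \<forall>s<n. cmod ((\<Phi> ^^ k) X $$ (r, s)) \<le> B"
proof (intro exI allI impI)
  fix k r s assume rs: "r < n" "s < n"
  have lin: "linear_map n \<Phi>" using cp by (simp add: completely_positive_def)
  have b: "cmod ((\<Phi> ^^ k) (munit n pq) $$ (r, s)) \<le> 2" if pq': "pq \<in> {..<n} \<times> {..<n}" for pq
  proof -
    obtain p q where pq: "pq = (p, q)" "p < n" "q < n" using pq' by (cases pq) auto
    have "contractive n ((\<Phi> ^^ k) (munit n (p, q))) ((\<Phi> ^^ k) (munit n (q, p)))"
      by (induction k) (simp_all add: contractive_munit contractive_cp[OF cp un] pq)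
    from contractive_entry_bound[OF this rs] show ?thesis by (simp add: pq)
  qed
  have "cmod ((\<Phi> ^^ k) X $$ (r, s)) \<le>
      (\<Sum>pq\<in>{..<n} \<times> {..<n}. cmod (X $$ pq * (\<Phi> ^^ k) (munit n pq) $$ (r, s)))"
    unfolding linear_map_expand[OF linear_map_funpow[OF lin] X rs] by (rule norm_sum)
  also have "\<dots> \<le> (\<Sum>pq\<in>{..<n} \<times> {..<n}. cmod (X $$ pq) * 2)"
    unfolding norm_mult by (intro sum_mono mult_left_mono b) auto
  finally show "cmod ((\<Phi> ^^ k) X $$ (r, s)) \<le> (\<Sum>pq\<in>{..<n} \<times> {..<n}. cmod (X $$ pq) * 2)" .
qed

section \<open>Convergent subsequences of bounded families\<close>

lemma bounded_complex_seq_convergent_subseq: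
  fixes f :: "nat \<Rightarrow> complex"
  assumes "\<And>N. cmod (f N) \<le> B"
  shows "\<exists>r. strict_mono (r :: nat \<Rightarrow> nat) \<and> convergent (\<lambda>N. f (r N))"
proof -
  obtain r1 where r1: "strict_mono (r1 :: nat \<Rightarrow> nat)" "monoseq (\<lambda>N. Re (f (r1 N)))"
    using seq_monosub[of "\<lambda>N. Re (f N)"] by (auto simp: o_def)
  obtain r2 where r2: "strict_mono (r2 :: nat \<Rightarrow> nat)" "monoseq (\<lambda>N. Im (f (r1 (r2 N))))"
    using seq_monosub[of "\<lambda>N. Im (f (r1 N))"] by (auto simp: o_def)
  have "Bseq (\<lambda>N. Re (f (r1 N)))" "Bseq (\<lambda>N. Im (f (r1 (r2 N))))"
    using order_trans[OF abs_Re_le_cmod assms] order_trans[OF abs_Im_le_cmod assms]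
    by (auto intro!: BseqI'[of _ B])
  with r1 r2 have c: "convergent (\<lambda>N. Re (f (r1 N)))" "convergent (\<lambda>N. Im (f (r1 (r2 N))))"
    by (auto intro: Bseq_monoseq_convergent)
  from c(1) have "convergent (\<lambda>N. Re (f (r1 (r2 N))))"
    using convergent_subseq_convergent[OF c(1) r2(1)] by (simp add: o_def)
  with c(2) obtain a b where "(\<lambda>N. Re (f (r1 (r2 N)))) \<longlonglongrightarrow> a" "(\<lambda>N. Im (f (r1 (r2 N)))) \<longlonglongrightarrow> b"
    by (auto simp: convergent_def)
  then have "(\<lambda>N. f (r1 (r2 N))) \<longlonglongrightarrow> Complex a b"
    using tendsto_Complex by fastforce
  moreover have "strict_mono (r1 \<circ> r2)" using r1 r2 by (simp add: strict_mono_o)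
  ultimately show ?thesis
    by (intro exI[of _ "r1 \<circ> r2"]) (auto simp: convergent_def)
qed

text \<open>A subsequence that works for \<open>I\<close> is refined once more for each new index;
  refining preserves the convergence already achieved.\<close>

lemma common_convergent_subseq:
  fixes f :: "'i \<Rightarrow> nat \<Rightarrow> complex"
  assumes "finite I" "\<And>i N. i \<in> I \<Longrightarrow> cmod (f i N) \<le> B"
  shows "\<exists>r. strict_mono (r :: nat \<Rightarrow> nat) \<and> (\<forall>i\<in>I. convergent (\<lambda>N. f i (r N)))"
  using assms
proof (induction I rule: finite_induct)
  case empty
  show ?case by (intro exI[of _ id]) (auto simp: strict_mono_def)
next
  case (insert x I)
  then obtain r where r: "strict_mono (r :: nat \<Rightarrow> nat)" "\<forall>i\<in>I. convergent (\<lambda>N. f i (r N))"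
    by auto
  obtain r' where r': "strict_mono (r' :: nat \<Rightarrow> nat)" "convergent (\<lambda>N. f x (r (r' N)))"
    using bounded_complex_seq_convergent_subseq[of "\<lambda>N. f x (r N)" B] insert.prems by auto
  have "convergent (\<lambda>N. f i (r (r' N)))" if "i \<in> I" for i
    using convergent_subseq_convergent[of "\<lambda>N. f i (r N)" r'] r r' that by (simp add: o_def)
  moreover have "strict_mono (r \<circ> r')" using r r' by (simp add: strict_mono_o)
  ultimately show ?case using r'
    by (intro exI[of _ "r \<circ> r'"]) (auto simp: o_def)
qed

section \<open>Limits of Cesaro averages\<close>

lemma mat_trace_mult:
  assumes "A \<in> carrier_mat n n" "B \<in> carrier_mat n n"
  shows "mat_trace (A * B) = (\<Sum>i<n. \<Sum>j<n. A $$ (i, j) * B $$ (j, i))"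
proof -
  have "mat_trace (A * B) = (\<Sum>i<n. (A * B) $$ (i, i))"
    using assms by (simp add: mat_trace_def)
  also have "\<dots> = (\<Sum>i<n. \<Sum>j<n. A $$ (i, j) * B $$ (j, i))"
    by (intro sum.cong refl mult_index[OF assms]) auto
  finally show ?thesis .
qed

lemma sesq_tendsto:
  assumes "\<And>r s. r < n \<Longrightarrow> s < n \<Longrightarrow> (\<lambda>N. A N $$ (r, s)) \<longlonglongrightarrow> B $$ (r, s)"
  shows "(\<lambda>N. sesq n (A N) f g) \<longlonglongrightarrow> sesq n B f g"
  unfolding sesq_def by (intro tendsto_intros assms) auto

lemma complex_limit_nonneg:
  fixes f :: "nat \<Rightarrow> complex"
  assumes "f \<longlonglongrightarrow> a" "\<And>N. 0 \<le> f N"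
  shows "0 \<le> a"
proof -
  have "(\<lambda>N. Re (f N)) \<longlonglongrightarrow> Re a" "(\<lambda>N. Im (f N)) \<longlonglongrightarrow> Im a"
    by (intro tendsto_intros assms)+
  moreover have "Re (f N) \<ge> 0" "Im (f N) = 0" for N
    using assms(2)[of N] by (auto simp: less_eq_complex_def)
  ultimately have "Re a \<ge> 0" "Im a = 0"
    by (auto intro: LIMSEQ_le_const simp: LIMSEQ_const_iff)
  then show ?thesis by (simp add: less_eq_complex_def)
qed

text \<open>Averaging \<open>Suc N\<close> powers keeps the denominator nonzero for every
  \<open>N\<close>.\<close>

definition cesaro :: "nat \<Rightarrow> (complex mat \<Rightarrow> complex mat) \<Rightarrow> nat \<Rightarrow> complex mat \<Rightarrow> complex mat" where
  "cesaro n \<Phi> N X = mat n n (\<lambda>rs. (\<Sum>k<Suc N. (\<Phi> ^^ k) X $$ rs) / of_nat (Suc N))"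

text \<open>A linear functional that is constant along the orbit of \<open>X\<close> has the same
  value on every average. In this way fixed points and invariant traces survive the
  averaging.\<close>

lemma cesaro_linear_functional:
  assumes "finite S" "\<And>r s. (r, s) \<in> S \<Longrightarrow> r < n \<and> s < n"
    and "\<And>k. (\<Sum>rs\<in>S. c rs * (\<Phi> ^^ k) X $$ rs) = v"
  shows "(\<Sum>rs\<in>S. c rs * cesaro n \<Phi> N X $$ rs) = v"
proof -
  have "(\<Sum>rs\<in>S. c rs * cesaro n \<Phi> N X $$ rs) =
     (\<Sum>rs\<in>S. \<Sum>k<Suc N. c rs * (\<Phi> ^^ k) X $$ rs / of_nat (Suc N))"
    using assms(2)
    by (intro sum.cong refl) (auto simp: cesaro_def sum_distrib_left sum_divide_distrib simp del:
        sum.lessThan_Suc)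
  also have "\<dots> = (\<Sum>k<Suc N. \<Sum>rs\<in>S. c rs * (\<Phi> ^^ k) X $$ rs / of_nat (Suc N))"
    by (rule sum.swap)
  also have "\<dots> = (\<Sum>k<Suc N. v / of_nat (Suc N))"
    by (simp only: sum_divide_distrib[symmetric] assms(3))
  also have "\<dots> = v"
    by (simp del: of_nat_Suc)
  finally show ?thesis .
qed

text \<open>The projection onto the fixed points is a subsequential limit of Cesaro averages; every
  property that holds for all powers of the map and is closed passes to the limit.\<close>

lemma ergodic_projection_exists:
  assumes cp: "completely_positive n \<Phi>" and un: "unital n \<Phi>"
  obtains E where "linear_map n E"
    and "\<And>X. X \<in> carrier_mat n n \<Longrightarrow> \<Phi> (E X) = E X"
    and "\<And>X. X \<in> carrier_mat n n \<Longrightarrow> E (\<Phi> X) = E X"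
    and "\<And>X. X \<in> carrier_mat n n \<Longrightarrow> \<Phi> X = X \<Longrightarrow> E X = X"
    and "\<And>X. psd n X \<Longrightarrow> psd n (E X)"
    and "\<And>\<rho> X. \<rho> \<in> carrier_mat n n \<Longrightarrow> X \<in> carrier_mat n n \<Longrightarrow>
      (\<And>Y. Y \<in> carrier_mat n n \<Longrightarrow> mat_trace (\<rho> * \<Phi> Y) = mat_trace (\<rho> * Y)) \<Longrightarrow>
      mat_trace (\<rho> * E X) = mat_trace (\<rho> * X)"
    and "\<And>a X. a \<in> carrier_mat n n \<Longrightarrow> X \<in> carrier_mat n n \<Longrightarrow>
      (\<And>Y. Y \<in> carrier_mat n n \<Longrightarrow> \<Phi> (a * Y) = a * \<Phi> Y) \<Longrightarrow> E (a * X) = a * E X"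
    and "\<And>a X. a \<in> carrier_mat n n \<Longrightarrow> X \<in> carrier_mat n n \<Longrightarrow>
      (\<And>Y. Y \<in> carrier_mat n n \<Longrightarrow> \<Phi> (Y * a) = \<Phi> Y * a) \<Longrightarrow> E (X * a) = E X * a"
proof -
  let ?C = "carrier_mat n n" and ?S = "{..<n} \<times> {..<n}"
  have lin: "linear_map n \<Phi>" using cp by (simp add: completely_positive_def)
  have pow: "(\<Phi> ^^ k) X \<in> ?C" if "X \<in> ?C" for k X
    using linear_mapD(1)[OF linear_map_funpow[OF lin] that] .
  have C_carrier [simp]: "cesaro n \<Phi> N X \<in> ?C" for N X by (simp add: cesaro_def)
  have C_bound: "\<exists>B. \<forall>N r s. r < n \<longrightarrow> s < n \<longrightarrow> cmod (cesaro n \<Phi> N X $$ (r, s)) \<le> B" if X: "X \<in> ?C"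
      for X
  proof -
    obtain B where B: "\<And>k r s. r < n \<Longrightarrow> s < n \<Longrightarrow> cmod ((\<Phi> ^^ k) X $$ (r, s)) \<le> B"
      using funpow_bounded[OF cp un X] by blast
    have "cmod (cesaro n \<Phi> N X $$ (r, s)) \<le> B" if rs: "r < n" "s < n" for N r s
    proof -
      have "cmod (\<Sum>k<Suc N. (\<Phi> ^^ k) X $$ (r, s)) \<le> (\<Sum>k<Suc N. B)"
        using rs by (intro sum_norm_le B)
      then show ?thesis
        using rs by (simp add: cesaro_def norm_divide divide_le_eq mult.commute
            del: of_nat_Suc sum.lessThan_Suc)
    qed
    then show ?thesis by blast
  qed
  obtain Bd where Bd: "\<And>pq N r s. pq \<in> ?S \<Longrightarrow> r < n \<Longrightarrow> s < n \<Longrightarrow> cmod (cesaro n \<Phi> N (munit n pq) $$ (r,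
      s)) \<le> Bd pq"
  proof -
    have "\<forall>pq. \<exists>B. \<forall>N r s. r < n \<longrightarrow> s < n \<longrightarrow> cmod (cesaro n \<Phi> N (munit n pq) $$ (r, s)) \<le> B"
      using C_bound by simp
    then show ?thesis using that by metis
  qed
  \<comment> \<open>\<open>common_convergent_subseq\<close> wants one bound for all sequences, so
    the bounds of the finitely many matrix units are added up.\<close>
  have "cmod (cesaro n \<Phi> N (munit n (fst i)) $$ (snd i)) \<le> (\<Sum>pq\<in>?S. Bd pq)" if i: "i \<in> ?S \<times> ?S"
      for i N
  proof -
    have nn: "Bd pq \<ge> 0" if "pq \<in> ?S" for pq
      using order_trans[OF norm_ge_zero Bd[OF that, of "fst pq" "snd pq"]] that by auto
    have "cmod (cesaro n \<Phi> N (munit n (fst i)) $$ (snd i)) \<le> Bd (fst i)"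
      using Bd[of "fst i" "fst (snd i)" "snd (snd i)" N] i by (auto simp: mem_Times_iff)
    also have "\<dots> \<le> (\<Sum>pq\<in>?S. Bd pq)"
      using i nn by (intro member_le_sum) auto
    finally show ?thesis .
  qed
  from common_convergent_subseq[of "?S \<times> ?S" "\<lambda>i N. cesaro n \<Phi> N (munit n (fst i)) $$ (snd i)", OF
      _ this]
  obtain R where R: "strict_mono (R :: nat \<Rightarrow> nat)"
    "\<And>i. i \<in> ?S \<times> ?S \<Longrightarrow> convergent (\<lambda>N. cesaro n \<Phi> (R N) (munit n (fst i)) $$ (snd i))"
    by auto
  define L where "L pq rs = lim (\<lambda>N. cesaro n \<Phi> (R N) (munit n pq) $$ rs)" for pq rs
  have L: "(\<lambda>N. cesaro n \<Phi> (R N) (munit n pq) $$ rs) \<longlonglongrightarrow> L pq rs" if "pq \<in> ?S" "rs \<in> ?S" for pq rs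
    using R(2)[of "(pq, rs)"] that by (simp add: L_def convergent_LIMSEQ_iff)
  \<comment> \<open>One common subsequence is chosen for the matrix units, and \<open>E\<close> is
    extended linearly from their limits. The averages of every other X then converge to
    \<open>E X\<close> along the same subsequence.\<close>
  define E where "E X = mat n n (\<lambda>rs. \<Sum>pq\<in>?S. X $$ pq * L pq rs)" for X :: "complex mat"
  have E_carrier [simp]: "E X \<in> ?C" for X by (simp add: E_def)
  have lim: "(\<lambda>N. cesaro n \<Phi> (R N) X $$ (r, s)) \<longlonglongrightarrow> E X $$ (r, s)"
      if X: "X \<in> ?C" and rs: "r < n" "s < n" for X r s
  proof -
    have "cesaro n \<Phi> N X $$ (r, s) = (\<Sum>pq\<in>?S. X $$ pq * cesaro n \<Phi> N (munit n pq) $$ (r, s))" for N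
    proof -
      have "cesaro n \<Phi> N X $$ (r, s) =
         (\<Sum>k<Suc N. \<Sum>pq\<in>?S. X $$ pq * (\<Phi> ^^ k) (munit n pq) $$ (r, s)) / of_nat (Suc N)"
        using rs by (simp only: cesaro_def index_mat linear_map_expand[OF linear_map_funpow[OF
            lin] X rs])
      also have "\<dots> = (\<Sum>pq\<in>?S. \<Sum>k<Suc N. X $$ pq * (\<Phi> ^^ k) (munit n pq) $$ (r, s)) / of_nat (Suc N)"
        by (subst sum.swap) (rule refl)
      also have "\<dots> = (\<Sum>pq\<in>?S. X $$ pq * cesaro n \<Phi> N (munit n pq) $$ (r, s))"
        unfolding sum_divide_distrib using rs
        by (intro sum.cong refl) (simp add: cesaro_def sum_distrib_left sum_divide_distrib del:
            sum.lessThan_Suc of_nat_Suc)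
      finally show ?thesis .
    qed
    then show ?thesis
      using X rs unfolding E_def by (auto intro!: tendsto_intros L)
  qed
  have eqI: "A = B" if "A \<in> ?C" "B \<in> ?C" "\<And>r s. r < n \<Longrightarrow> s < n \<Longrightarrow> A $$ (r, s) = B $$ (r, s)"
      for A B :: "complex mat"
    using that by (intro eq_matI) auto
  have E_lin: "linear_map n E"
    unfolding linear_map_def
  proof (intro conjI ballI allI)
    fix X Y :: "complex mat" assume "X \<in> ?C" "Y \<in> ?C"
    then show "E (X + Y) = E X + E Y"
    proof (intro eqI, goal_cases)
      case (3 r s)
      have "E (X + Y) $$ (r, s) = (\<Sum>pq\<in>?S. (X + Y) $$ pq * L pq (r, s))"
        using 3 by (simp add: E_def)
      also have "\<dots> = (\<Sum>pq\<in>?S. X $$ pq * L pq (r, s) + Y $$ pq * L pq (r, s))"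
        using 3 by (intro sum.cong refl) (auto simp: distrib_right)
      finally have "E (X + Y) $$ (r, s) = \<dots>" .
      then show ?case using 3 by (simp add: E_def sum.distrib)
    qed auto
  next
    fix c and X :: "complex mat" assume "X \<in> ?C"
    then show "E (c \<cdot>\<^sub>m X) = c \<cdot>\<^sub>m E X"
    proof (intro eqI, goal_cases)
      case (3 r s)
      have "E (c \<cdot>\<^sub>m X) $$ (r, s) = (\<Sum>pq\<in>?S. (c \<cdot>\<^sub>m X) $$ pq * L pq (r, s))"
        using 3 by (simp add: E_def)
      also have "\<dots> = (\<Sum>pq\<in>?S. c * (X $$ pq * L pq (r, s)))"
        using 3 by (intro sum.cong refl) auto
      finally have "E (c \<cdot>\<^sub>m X) $$ (r, s) = \<dots>" .
      then show ?case using 3 by (simp add: E_def sum_distrib_left)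
    qed auto
  qed simp
  \<comment> \<open>The averages at \<Phi> X and at X differ by a telescoping sum, that is by two
    bounded terms divided by \<open>Suc N\<close>.\<close>
  have shift: "E (\<Phi> X) = E X" if X: "X \<in> ?C" for X
  proof (rule eqI)
    fix r s assume rs: "r < n" "s < n"
    obtain B where B: "\<And>k. cmod ((\<Phi> ^^ k) X $$ (r, s)) \<le> B"
      using funpow_bounded[OF cp un X] rs by blast
    have diff: "cesaro n \<Phi> N (\<Phi> X) $$ (r, s) - cesaro n \<Phi> N X $$ (r, s) =
        ((\<Phi> ^^ Suc N) X $$ (r, s) - X $$ (r, s)) / of_nat (Suc N)" for N
    proof -
      have "(\<Phi> ^^ k) (\<Phi> X) = (\<Phi> ^^ Suc k) X" for k by (simp only: funpow_Suc_right o_def)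
      moreover have "(\<Sum>k<Suc N. (\<Phi> ^^ Suc k) X $$ (r, s)) - (\<Sum>k<Suc N. (\<Phi> ^^ k) X $$ (r, s))
         = (\<Phi> ^^ Suc N) X $$ (r, s) - X $$ (r, s)"
        using sum_lessThan_telescope[of "\<lambda>k. (\<Phi> ^^ k) X $$ (r, s)" "Suc N"]
        by (simp only: sum_subtractf funpow_0)
      ultimately show ?thesis
        using rs by (simp only: cesaro_def index_mat diff_divide_distrib[symmetric])
    qed
    have "(\<lambda>N. (\<Phi> ^^ Suc N) X $$ (r, s) * (1 / of_nat (Suc N)) - X $$ (r, s) * (1 / of_nat (Suc
        N))) \<longlonglongrightarrow> 0 - X $$ (r, s) * 0"
    proof (intro tendsto_intros)
      show inv: "(\<lambda>N. 1 / of_nat (Suc N)) \<longlonglongrightarrow> (0::complex)"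
        using LIMSEQ_inverse_real_of_nat[THEN tendsto_of_real, where 'a = complex]
        by (simp add: field_simps)
      show "(\<lambda>N. (\<Phi> ^^ Suc N) X $$ (r, s) * (1 / of_nat (Suc N))) \<longlonglongrightarrow> 0"
      proof (rule tendsto_0_le[OF inv, of _ B], intro always_eventually allI)
        fix N
        show "norm ((\<Phi> ^^ Suc N) X $$ (r, s) * (1 / of_nat (Suc N))) \<le> norm (1 / complex_of_nat
            (Suc N)) * B"
          unfolding norm_mult by (subst mult.commute) (intro mult_left_mono B norm_ge_zero)
      qed
    qed
    then have "(\<lambda>N. cesaro n \<Phi> N (\<Phi> X) $$ (r, s) - cesaro n \<Phi> N X $$ (r, s)) \<longlonglongrightarrow> 0"
      unfolding diff by (simp add: diff_divide_distrib)
    from LIMSEQ_subseq_LIMSEQ[OF this R(1)]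
    have "(\<lambda>N. cesaro n \<Phi> (R N) (\<Phi> X) $$ (r, s) - cesaro n \<Phi> (R N) X $$ (r, s)) \<longlonglongrightarrow> 0"
      by (simp add: o_def)
    moreover have "(\<lambda>N. cesaro n \<Phi> (R N) (\<Phi> X) $$ (r, s) - cesaro n \<Phi> (R N) X $$ (r, s))
       \<longlonglongrightarrow> E (\<Phi> X) $$ (r, s) - E X $$ (r, s)"
      using rs X linear_mapD(1)[OF lin X] by (intro tendsto_intros lim)
    ultimately show "E (\<Phi> X) $$ (r, s) = E X $$ (r, s)"
      using LIMSEQ_unique by fastforce
  qed auto
  \<comment> \<open>\<Phi> commutes with each average and passes to the limit by
    \<open>linear_map_expand\<close>. Combined with \<open>shift\<close> this gives \<Phi> (E X) = E
    X.\<close>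
  have comm: "\<Phi> (E X) = E (\<Phi> X)" if X: "X \<in> ?C" for X
  proof (rule eqI)
    fix r s assume rs: "r < n" "s < n"
    have "(\<lambda>N. \<Sum>pq\<in>?S. cesaro n \<Phi> (R N) X $$ pq * \<Phi> (munit n pq) $$ (r, s)) \<longlonglongrightarrow> 
       (\<Sum>pq\<in>?S. E X $$ pq * \<Phi> (munit n pq) $$ (r, s))"
      using X by (auto intro!: tendsto_intros lim)
    moreover have "(\<Sum>pq\<in>?S. cesaro n \<Phi> N X $$ pq * \<Phi> (munit n pq) $$ (r, s))
        = cesaro n \<Phi> N (\<Phi> X) $$ (r, s)" for N
    proof -
      have "(\<Sum>pq\<in>?S. cesaro n \<Phi> N X $$ pq * \<Phi> (munit n pq) $$ (r, s)) =
         (\<Sum>pq\<in>?S. \<Sum>k<Suc N. (\<Phi> ^^ k) X $$ pq * \<Phi> (munit n pq) $$ (r, s) / of_nat (Suc N))"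
        by (intro sum.cong refl)
           (auto simp: cesaro_def sum_distrib_right sum_divide_distrib simp del: sum.lessThan_Suc
               of_nat_Suc)
      also have "\<dots> = (\<Sum>k<Suc N. \<Sum>pq\<in>?S. (\<Phi> ^^ k) X $$ pq * \<Phi> (munit n pq) $$ (r, s) / of_nat (Suc
          N))"
        by (rule sum.swap)
      also have "\<dots> = (\<Sum>k<Suc N. \<Phi> ((\<Phi> ^^ k) X) $$ (r, s) / of_nat (Suc N))"
        by (simp only: sum_divide_distrib[symmetric] linear_map_expand[OF lin pow[OF X] rs])
      also have "\<dots> = cesaro n \<Phi> N (\<Phi> X) $$ (r, s)"
        using rs by (simp add: cesaro_def sum_divide_distrib funpow_swap1 del: sum.lessThan_Suc
            of_nat_Suc)
      finally show ?thesis .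
    qed
    ultimately have "(\<lambda>N. cesaro n \<Phi> (R N) (\<Phi> X) $$ (r, s)) \<longlonglongrightarrow> \<Phi> (E X) $$ (r, s)"
      by (simp add: linear_map_expand[OF lin E_carrier rs])
    then show "\<Phi> (E X) $$ (r, s) = E (\<Phi> X) $$ (r, s)"
      using lim[OF linear_mapD(1)[OF lin X] rs] LIMSEQ_unique by blast
  qed (auto intro: linear_mapD(1)[OF lin])
  have functional: "(\<Sum>rs\<in>S. c rs * E X $$ rs) = v"
    if X: "X \<in> ?C" and S: "finite S" "S \<subseteq> ?S" and v: "\<And>k. (\<Sum>rs\<in>S. c rs * (\<Phi> ^^ k) X $$ rs) = v"
    for X S c v
  proof -
    have "(\<lambda>N. \<Sum>rs\<in>S. c rs * cesaro n \<Phi> (R N) X $$ rs) \<longlonglongrightarrow> (\<Sum>rs\<in>S. c rs * E X $$ rs)"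
      using X S by (auto intro!: tendsto_intros lim)
    moreover have "(\<Sum>rs\<in>S. c rs * cesaro n \<Phi> N X $$ rs) = v" for N
      using S by (intro cesaro_linear_functional v) auto
    ultimately show ?thesis by (simp add: LIMSEQ_const_iff)
  qed
  show ?thesis
  proof (rule that[OF E_lin])
    fix X :: "complex mat" assume X: "X \<in> ?C"
    show "\<Phi> (E X) = E X" using comm[OF X] shift[OF X] by simp
    show "E (\<Phi> X) = E X" by (rule shift[OF X])
  next
    fix X :: "complex mat" assume X: "X \<in> ?C" "\<Phi> X = X"
    then have k: "(\<Phi> ^^ k) X = X" for k by (induction k) auto
    show "E X = X"
    proof (rule eqI)
      fix r s assume "r < n" "s < n"
      then show "E X $$ (r, s) = X $$ (r, s)"
        using functional[OF X(1), of "{(r, s)}" "\<lambda>_. 1" "X $$ (r, s)"] by (simp add: k)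
    qed (use X in auto)
  next
    fix X :: "complex mat" assume p: "psd n X"
    then have X: "X \<in> ?C" by (simp add: psd_def)
    have pk: "psd n ((\<Phi> ^^ k) X)" for k
    proof (induction k)
      case (Suc k)
      \<comment> \<open>Positivity of \<Phi> itself is the one by one case of
        \<open>cp_family\<close>.\<close>
      have "(\<Sum>i<1::nat. \<Sum>j<1::nat. sesq n (\<Phi> ((\<Phi> ^^ k) X)) (w i) (w j)) \<ge> 0" for w
        using Suc by (intro cp_family[OF cp]) (auto simp: psd_iff_sesq)
      from this[of "\<lambda>_. f" for f] show ?case
        using X linear_mapD(1)[OF lin pow[OF X]] by (simp add: psd_iff_sesq)
    qed (simp add: p)
    have "0 \<le> sesq n (cesaro n \<Phi> N X) f f" for N f
    proof -
      have "sesq n (cesaro n \<Phi> N X) f f = (\<Sum>i<n. \<Sum>j<n. \<Sum>k<Suc N. cnj (f i) * (\<Phi> ^^ k) X $$ (i, j)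
          * f j / of_nat (Suc N))"
        unfolding sesq_def
        by (intro sum.cong refl)
           (auto simp: cesaro_def sum_distrib_left sum_distrib_right sum_divide_distrib simp del:
               sum.lessThan_Suc of_nat_Suc)
      also have "\<dots> = (\<Sum>i<n. \<Sum>k<Suc N. \<Sum>j<n. cnj (f i) * (\<Phi> ^^ k) X $$ (i, j) * f j / of_nat (Suc
          N))"
        by (intro sum.cong refl sum.swap)
      also have "\<dots> = (\<Sum>k<Suc N. \<Sum>i<n. \<Sum>j<n. cnj (f i) * (\<Phi> ^^ k) X $$ (i, j) * f j / of_nat (Suc
          N))"
        by (rule sum.swap)
      also have "\<dots> = (\<Sum>k<Suc N. sesq n ((\<Phi> ^^ k) X) f f * complex_of_real (1 / real (Suc N)))"
        by (simp add: sesq_def sum_divide_distrib del: sum.lessThan_Suc of_nat_Suc)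
      also have "0 \<le> \<dots>"
        using pk by (intro sum_nonneg mult_nonneg_nonneg) (auto simp: psd_iff_sesq
            less_eq_complex_def)
      finally show ?thesis .
    qed
    moreover have "(\<lambda>N. sesq n (cesaro n \<Phi> (R N) X) f f) \<longlonglongrightarrow> sesq n (E X) f f" for f
      by (rule sesq_tendsto) (rule lim[OF X])
    ultimately have "0 \<le> sesq n (E X) f f" for f
      using complex_limit_nonneg[of "\<lambda>N. sesq n (cesaro n \<Phi> (R N) X) f f"] by blast
    then show "psd n (E X)" by (simp add: psd_iff_sesq)
  next
    fix \<rho> X :: "complex mat" assume \<rho>: "\<rho> \<in> ?C" and X: "X \<in> ?C"
      and inv: "\<And>Y. Y \<in> ?C \<Longrightarrow> mat_trace (\<rho> * \<Phi> Y) = mat_trace (\<rho> * Y)"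
    have tr: "mat_trace (\<rho> * Y) = (\<Sum>rs\<in>?S. \<rho> $$ (snd rs, fst rs) * Y $$ rs)" if "Y \<in> ?C" for Y
      unfolding mat_trace_mult[OF \<rho> that]
      by (subst sum.swap) (simp add: sum.cartesian_product case_prod_unfold)
    have k: "mat_trace (\<rho> * (\<Phi> ^^ k) X) = mat_trace (\<rho> * X)" for k
      by (induction k) (auto simp: inv pow X)
    show "mat_trace (\<rho> * E X) = mat_trace (\<rho> * X)"
      unfolding tr[OF E_carrier]
      by (rule functional[OF X]) (auto simp: tr[symmetric] pow X k)
  next
    fix a X :: "complex mat" assume a: "a \<in> ?C" and X: "X \<in> ?C"
      and comm: "\<And>Y. Y \<in> ?C \<Longrightarrow> \<Phi> (a * Y) = a * \<Phi> Y"
    have k: "(\<Phi> ^^ k) (a * X) = a * (\<Phi> ^^ k) X" for k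
      by (induction k) (auto simp: comm pow X)
    have aX: "a * X \<in> ?C" using a X by simp
    show "E (a * X) = a * E X"
    proof (rule eqI)
      fix r s assume rs: "r < n" "s < n"
      have *: "cesaro n \<Phi> N (a * X) $$ (r, s) = (\<Sum>l<n. a $$ (r, l) * cesaro n \<Phi> N X $$ (l, s))"
          for N
      proof -
        have "cesaro n \<Phi> N (a * X) $$ (r, s) =
           (\<Sum>k<Suc N. \<Sum>l<n. a $$ (r, l) * (\<Phi> ^^ k) X $$ (l, s)) / of_nat (Suc N)"
          using rs by (simp only: cesaro_def index_mat k mult_index[OF a pow[OF X] rs])
        also have "\<dots> = (\<Sum>l<n. \<Sum>k<Suc N. a $$ (r, l) * (\<Phi> ^^ k) X $$ (l, s)) / of_nat (Suc N)"
          by (subst sum.swap) (rule refl)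
        also have "\<dots> = (\<Sum>l<n. a $$ (r, l) * cesaro n \<Phi> N X $$ (l, s))"
          unfolding sum_divide_distrib using rs
          by (intro sum.cong refl) (simp add: cesaro_def sum_distrib_left sum_divide_distrib del:
              sum.lessThan_Suc of_nat_Suc)
        finally show ?thesis .
      qed
      have "(\<lambda>N. cesaro n \<Phi> (R N) (a * X) $$ (r, s)) \<longlonglongrightarrow> (\<Sum>l<n. a $$ (r, l) * E X $$ (l, s))"
        unfolding * using X rs by (auto intro!: tendsto_intros lim)
      from LIMSEQ_unique[OF lim[OF aX rs] this]
      show "E (a * X) $$ (r, s) = (a * E X) $$ (r, s)"
        by (simp add: mult_index[OF a E_carrier rs] del: index_mult_mat)
    qed (use a in auto)
  next
    fix a X :: "complex mat" assume a: "a \<in> ?C" and X: "X \<in> ?C"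
      and comm: "\<And>Y. Y \<in> ?C \<Longrightarrow> \<Phi> (Y * a) = \<Phi> Y * a"
    have k: "(\<Phi> ^^ k) (X * a) = (\<Phi> ^^ k) X * a" for k
      by (induction k) (auto simp: comm pow X)
    have aX: "X * a \<in> ?C" using a X by simp
    show "E (X * a) = E X * a"
    proof (rule eqI)
      fix r s assume rs: "r < n" "s < n"
      have *: "cesaro n \<Phi> N (X * a) $$ (r, s) = (\<Sum>l<n. cesaro n \<Phi> N X $$ (r, l) * a $$ (l, s))"
          for N
      proof -
        have "cesaro n \<Phi> N (X * a) $$ (r, s) =
           (\<Sum>k<Suc N. \<Sum>l<n. (\<Phi> ^^ k) X $$ (r, l) * a $$ (l, s)) / of_nat (Suc N)"
          using rs by (simp only: cesaro_def index_mat k mult_index[OF pow[OF X] a rs])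
        also have "\<dots> = (\<Sum>l<n. \<Sum>k<Suc N. (\<Phi> ^^ k) X $$ (r, l) * a $$ (l, s)) / of_nat (Suc N)"
          by (subst sum.swap) (rule refl)
        also have "\<dots> = (\<Sum>l<n. cesaro n \<Phi> N X $$ (r, l) * a $$ (l, s))"
          unfolding sum_divide_distrib using rs
          by (intro sum.cong refl)
             (simp add: cesaro_def sum_distrib_right sum_divide_distrib del: sum.lessThan_Suc
                 of_nat_Suc)
        finally show ?thesis .
      qed
      have "(\<lambda>N. cesaro n \<Phi> (R N) (X * a) $$ (r, s)) \<longlonglongrightarrow> (\<Sum>l<n. E X $$ (r, l) * a $$ (l, s))"
        unfolding * using X rs by (auto intro!: tendsto_intros lim)
      from LIMSEQ_unique[OF lim[OF aX rs] this]
      show "E (X * a) $$ (r, s) = (E X * a) $$ (r, s)"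
        by (simp add: mult_index[OF E_carrier a rs] del: index_mult_mat)
    qed (use a in \<open>auto intro!: mult_carrier_mat[of _ n n]\<close>)
  qed
qed

subsection \<open>Operators in an orthonormal frame\<close>

text \<open>In a product of five factors the order of summation is exchanged, so that the two pairs
  of basis matrices on the outside can be contracted first.\<close>

lemma sum_sandwich:
  fixes A :: "'r \<Rightarrow> 's \<Rightarrow> 'a::comm_ring_1"
  shows "(\<Sum>c\<in>I. \<Sum>d\<in>J. a c * (\<Sum>r\<in>R. \<Sum>s\<in>S. b c r * A r s * b' s d) * a' d) =
    (\<Sum>r\<in>R. \<Sum>s\<in>S. (\<Sum>c\<in>I. a c * b c r) * A r s * (\<Sum>d\<in>J. b' s d * a' d))"
proof -
  let ?t = "\<lambda>c d r s. a c * b c r * A r s * b' s d * a' d"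
  have "(\<Sum>c\<in>I. \<Sum>d\<in>J. a c * (\<Sum>r\<in>R. \<Sum>s\<in>S. b c r * A r s * b' s d) * a' d) =
     (\<Sum>c\<in>I. \<Sum>d\<in>J. \<Sum>r\<in>R. \<Sum>s\<in>S. ?t c d r s)"
    by (simp add: sum_distrib_left sum_distrib_right mult_ac)
  also have "\<dots> = (\<Sum>c\<in>I. \<Sum>r\<in>R. \<Sum>d\<in>J. \<Sum>s\<in>S. ?t c d r s)"
    by (intro sum.cong refl sum.swap)
  also have "\<dots> = (\<Sum>c\<in>I. \<Sum>r\<in>R. \<Sum>s\<in>S. \<Sum>d\<in>J. ?t c d r s)"
    by (intro sum.cong refl sum.swap)
  also have "\<dots> = (\<Sum>r\<in>R. \<Sum>c\<in>I. \<Sum>s\<in>S. \<Sum>d\<in>J. ?t c d r s)"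
    by (rule sum.swap)
  also have "\<dots> = (\<Sum>r\<in>R. \<Sum>s\<in>S. \<Sum>c\<in>I. \<Sum>d\<in>J. ?t c d r s)"
    by (intro sum.cong refl sum.swap)
  also have "\<dots> = (\<Sum>r\<in>R. \<Sum>s\<in>S. (\<Sum>c\<in>I. a c * b c r) * A r s * (\<Sum>d\<in>J. b' s d * a' d))"
    by (simp add: sum_distrib_left sum_distrib_right mult_ac)
  finally show ?thesis .
qed

lemma sum_delta2:
  fixes A :: "'r \<Rightarrow> 's \<Rightarrow> 'a::comm_ring_1"
  assumes "finite R" "finite S" "p \<in> R" "q \<in> S"
  shows "(\<Sum>r\<in>R. \<Sum>s\<in>S. (if p = r then 1 else 0) * A r s * (if s = q then 1 else 0)) = A p q"
proof -
  have "(\<Sum>r\<in>R. \<Sum>s\<in>S. (if p = r then 1 else 0) * A r s * (if s = q then 1 else 0)) =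
    (\<Sum>r\<in>R. \<Sum>s\<in>S. if s = q then (if p = r then A r s else 0) else 0)"
    by (intro sum.cong refl) auto
  then show ?thesis using assms by simp
qed

text \<open>An orthonormal basis of C^n, with \<open>u p c\<close> the p-th coordinate of the vector
  labelled \<open>c\<close>. Labels come from an arbitrary finite set, so that triples can label the
  basis and operators become functions of two labels without index arithmetic.\<close>

locale frame =
  fixes n :: nat and I :: "'i set" and u :: "nat \<Rightarrow> 'i \<Rightarrow> complex"
  assumes finite_I: "finite I"
    and orthonormal: "c \<in> I \<Longrightarrow> d \<in> I \<Longrightarrow> (\<Sum>p<n. cnj (u p c) * u p d) = (if c = d then 1 else 0)"
    and complete: "p < n \<Longrightarrow> q < n \<Longrightarrow> (\<Sum>c\<in>I. u p c * cnj (u q c)) = (if p = q then 1 else 0)"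
begin

definition opr :: "('i \<Rightarrow> 'i \<Rightarrow> complex) \<Rightarrow> complex mat" where
  "opr F = mat n n (\<lambda>(p, q). \<Sum>c\<in>I. \<Sum>d\<in>I. u p c * F c d * cnj (u q d))"

definition coef :: "complex mat \<Rightarrow> 'i \<Rightarrow> 'i \<Rightarrow> complex" where
  "coef A c d = (\<Sum>p<n. \<Sum>q<n. cnj (u p c) * A $$ (p, q) * u q d)"

lemma opr_carrier [simp]: "opr F \<in> carrier_mat n n"
  by (simp add: opr_def)

lemma opr_cong: "(\<And>c d. c \<in> I \<Longrightarrow> d \<in> I \<Longrightarrow> F c d = G c d) \<Longrightarrow> opr F = opr G"
  by (simp add: opr_def)

lemma opr_coef:
  assumes "A \<in> carrier_mat n n"
  shows "opr (coef A) = A"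
proof (rule eq_matI)
  fix p q assume "p < dim_row A" "q < dim_col A"
  then have pq: "p < n" "q < n" using assms by auto
  have "opr (coef A) $$ (p, q) = (\<Sum>c\<in>I. \<Sum>d\<in>I. u p c * coef A c d * cnj (u q d))"
    using pq by (simp add: opr_def)
  also have "\<dots> = (\<Sum>r<n. \<Sum>s<n. (\<Sum>c\<in>I. u p c * cnj (u r c)) * A $$ (r, s) *
      (\<Sum>d\<in>I. u s d * cnj (u q d)))"
    unfolding coef_def by (rule sum_sandwich)
  also have "\<dots> = (\<Sum>r<n. \<Sum>s<n. (if p = r then 1 else 0) * A $$ (r, s) * (if s = q then 1 else 0))"
    using pq by (intro sum.cong refl) (auto simp: complete)
  also have "\<dots> = A $$ (p, q)"
    using pq by (intro sum_delta2) auto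
  finally show "opr (coef A) $$ (p, q) = A $$ (p, q)" .
qed (use assms in \<open>auto simp: opr_def\<close>)

lemma coef_opr:
  assumes "c \<in> I" "d \<in> I"
  shows "coef (opr F) c d = F c d"
proof -
  have "coef (opr F) c d = (\<Sum>p<n. \<Sum>q<n. cnj (u p c) * (\<Sum>e\<in>I. \<Sum>f\<in>I. u p e * F e f * cnj (u q f)) *
      u q d)"
    by (simp add: coef_def opr_def)
  also have "\<dots> = (\<Sum>e\<in>I. \<Sum>f\<in>I. (\<Sum>p<n. cnj (u p c) * u p e) * F e f * (\<Sum>q<n. cnj (u q f) * u q d))"
    by (rule sum_sandwich)
  also have "\<dots> = (\<Sum>e\<in>I. \<Sum>f\<in>I. (if c = e then 1 else 0) * F e f * (if f = d then 1 else 0))"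
    using assms by (intro sum.cong refl) (simp add: orthonormal)
  also have "\<dots> = F c d"
    using assms finite_I by (intro sum_delta2) auto
  finally show ?thesis .
qed

lemma eq_oprI:
  assumes "A \<in> carrier_mat n n" "\<And>c d. c \<in> I \<Longrightarrow> d \<in> I \<Longrightarrow> coef A c d = F c d"
  shows "A = opr F"
  using opr_coef[OF assms(1)] opr_cong[of "coef A" F] assms(2) by simp

lemma opr_mult: "opr F * opr G = opr (\<lambda>c d. \<Sum>e\<in>I. F c e * G e d)"
proof (rule eq_matI)
  fix p q assume "p < dim_row (opr (\<lambda>c d. \<Sum>e\<in>I. F c e * G e d))" "q < dim_col (opr (\<lambda>c d. \<Sum>e\<in>I. F
      c e * G e d))"
  then have pq: "p < n" "q < n" by (auto simp: opr_def)
  have "(opr F * opr G) $$ (p, q) = (\<Sum>r<n. opr F $$ (p, r) * opr G $$ (r, q))"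
    by (rule mult_index[OF opr_carrier opr_carrier pq])
  also have "\<dots> = (\<Sum>r<n. (\<Sum>c\<in>I. \<Sum>e\<in>I. u p c * F c e * cnj (u r e)) *
      (\<Sum>f\<in>I. \<Sum>d\<in>I. u r f * G f d * cnj (u q d)))"
    using pq by (simp add: opr_def)
  also have "\<dots> = (\<Sum>r<n. (\<Sum>e\<in>I. (\<Sum>c\<in>I. u p c * F c e) * cnj (u r e)) * (\<Sum>f\<in>I. u r f *
      (\<Sum>d\<in>I. G f d * cnj (u q d))))"
    by (subst sum.swap) (simp add: sum_distrib_left sum_distrib_right mult_ac)
  also have "\<dots> = (\<Sum>r<n. \<Sum>e\<in>I. \<Sum>f\<in>I. (\<Sum>c\<in>I. u p c * F c e) * (cnj (u r e) * u r f) *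
      (\<Sum>d\<in>I. G f d * cnj (u q d)))"
    unfolding sum_product by (simp only: mult_ac)
  also have "\<dots> = (\<Sum>e\<in>I. \<Sum>r<n. \<Sum>f\<in>I. (\<Sum>c\<in>I. u p c * F c e) * (cnj (u r e) * u r f) *
      (\<Sum>d\<in>I. G f d * cnj (u q d)))"
    by (rule sum.swap)
  also have "\<dots> = (\<Sum>e\<in>I. \<Sum>f\<in>I. \<Sum>r<n. (\<Sum>c\<in>I. u p c * F c e) * (cnj (u r e) * u r f) *
      (\<Sum>d\<in>I. G f d * cnj (u q d)))"
    by (intro sum.cong refl sum.swap)
  also have "\<dots> = (\<Sum>e\<in>I. \<Sum>f\<in>I. if f = e then (\<Sum>c\<in>I. u p c * F c e) *
      (\<Sum>d\<in>I. G f d * cnj (u q d)) else 0)"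
    by (intro sum.cong refl) (auto simp: sum_distrib_left[symmetric] sum_distrib_right[symmetric]
        orthonormal)
  also have "\<dots> = (\<Sum>e\<in>I. (\<Sum>c\<in>I. u p c * F c e) * (\<Sum>d\<in>I. G e d * cnj (u q d)))"
    using finite_I by simp
  also have "\<dots> = (\<Sum>e\<in>I. \<Sum>c\<in>I. \<Sum>d\<in>I. u p c * (F c e * G e d) * cnj (u q d))"
    by (simp add: sum_product mult_ac)
  also have "\<dots> = (\<Sum>c\<in>I. \<Sum>e\<in>I. \<Sum>d\<in>I. u p c * (F c e * G e d) * cnj (u q d))"
    by (rule sum.swap)
  also have "\<dots> = (\<Sum>c\<in>I. \<Sum>d\<in>I. \<Sum>e\<in>I. u p c * (F c e * G e d) * cnj (u q d))"
    by (intro sum.cong refl sum.swap)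
  also have "\<dots> = opr (\<lambda>c d. \<Sum>e\<in>I. F c e * G e d) $$ (p, q)"
    using pq by (simp add: opr_def sum_distrib_left sum_distrib_right)
  finally show "(opr F * opr G) $$ (p, q) = opr (\<lambda>c d. \<Sum>e\<in>I. F c e * G e d) $$ (p, q)" .
qed (auto simp: opr_def)

lemma trace_opr: "mat_trace (opr F) = (\<Sum>c\<in>I. F c c)"
proof -
  have "mat_trace (opr F) = (\<Sum>p<n. \<Sum>c\<in>I. \<Sum>d\<in>I. F c d * (cnj (u p d) * u p c))"
    by (simp add: mat_trace_def opr_def mult_ac)
  also have "\<dots> = (\<Sum>c\<in>I. \<Sum>p<n. \<Sum>d\<in>I. F c d * (cnj (u p d) * u p c))"
    by (rule sum.swap)
  also have "\<dots> = (\<Sum>c\<in>I. \<Sum>d\<in>I. \<Sum>p<n. F c d * (cnj (u p d) * u p c))"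
    by (intro sum.cong refl sum.swap)
  also have "\<dots> = (\<Sum>c\<in>I. \<Sum>d\<in>I. if d = c then F c d else 0)"
    by (intro sum.cong refl) (auto simp: sum_distrib_left[symmetric] orthonormal)
  also have "\<dots> = (\<Sum>c\<in>I. F c c)"
    using finite_I by simp
  finally show ?thesis .
qed

lemma dag_opr: "dag (opr F) = opr (\<lambda>c d. cnj (F d c))"
proof (rule eq_matI)
  fix p q assume "p < dim_row (opr (\<lambda>c d. cnj (F d c)))" "q < dim_col (opr (\<lambda>c d. cnj (F d c)))"
  then have pq: "p < n" "q < n" by (auto simp: opr_def)
  have "dag (opr F) $$ (p, q) = (\<Sum>c\<in>I. \<Sum>d\<in>I. cnj (u q c) * cnj (F c d) * u p d)"
    using pq by (simp add: opr_def)
  also have "\<dots> = (\<Sum>d\<in>I. \<Sum>c\<in>I. cnj (u q c) * cnj (F c d) * u p d)"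
    by (rule sum.swap)
  also have "\<dots> = opr (\<lambda>c d. cnj (F d c)) $$ (p, q)"
    using pq by (simp add: opr_def mult_ac)
  finally show "dag (opr F) $$ (p, q) = opr (\<lambda>c d. cnj (F d c)) $$ (p, q)" .
qed (auto simp: opr_def dag_def)

lemma sesq_opr: 
  "sesq n (opr F) f g = (\<Sum>c\<in>I. \<Sum>d\<in>I. cnj (\<Sum>p<n. cnj (u p c) * f p) * F c d *
      (\<Sum>p<n. cnj (u p d) * g p))"
proof -
  have "sesq n (opr F) f g = (\<Sum>p<n. \<Sum>q<n. cnj (f p) * (\<Sum>c\<in>I. \<Sum>d\<in>I. u p c * F c d * cnj (u q d)) *
      g q)"
    by (simp add: sesq_def opr_def)
  also have "\<dots> = (\<Sum>c\<in>I. \<Sum>d\<in>I. (\<Sum>p<n. cnj (f p) * u p c) * F c d * (\<Sum>q<n. cnj (u q d) * g q))"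
    by (rule sum_sandwich)
  finally show ?thesis by (simp add: mult.commute)
qed

lemma psd_oprI:
  assumes "\<And>g. 0 \<le> (\<Sum>c\<in>I. \<Sum>d\<in>I. cnj (g c) * F c d * g d)"
  shows "psd n (opr F)"
  unfolding psd_iff_sesq sesq_opr by (intro conjI allI assms opr_carrier)

lemma coef_psd:
  assumes "psd n A"
  shows "0 \<le> (\<Sum>c\<in>I. \<Sum>d\<in>I. cnj (g c) * coef A c d * g d)"
proof -
  have "(\<Sum>c\<in>I. \<Sum>d\<in>I. cnj (g c) * coef A c d * g d) =
     (\<Sum>p<n. \<Sum>q<n. (\<Sum>c\<in>I. cnj (g c) * cnj (u p c)) * A $$ (p, q) * (\<Sum>d\<in>I. u q d * g d))"
    unfolding coef_def by (rule sum_sandwich)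
  also have "\<dots> = sesq n A (\<lambda>p. \<Sum>c\<in>I. u p c * g c) (\<lambda>p. \<Sum>c\<in>I. u p c * g c)"
    by (simp add: sesq_def mult.commute)
  finally show ?thesis using assms by (simp add: psd_iff_sesq)
qed

definition ketbra :: "'i \<Rightarrow> 'i \<Rightarrow> complex mat" where
  "ketbra c d = opr (\<lambda>c' d'. if c' = c \<and> d' = d then 1 else 0)"

lemma ketbra_carrier [simp]: "ketbra c d \<in> carrier_mat n n"
  by (simp add: ketbra_def)

text \<open>Traces against rank-one operators read off coefficients. This is how the dual map, which
  is given through traces, is computed.\<close>

lemma trace_mult_ketbra:
  assumes "A \<in> carrier_mat n n" "c \<in> I" "d \<in> I"
  shows "mat_trace (A * ketbra c d) = coef A d c"
proof -
  have "mat_trace (A * ketbra c d) = mat_trace (opr (coef A) * ketbra c d)"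
    by (simp add: opr_coef assms)
  also have "\<dots> = (\<Sum>e\<in>I. \<Sum>f\<in>I. if f = c then (if e = d then coef A e f else 0) else 0)"
    unfolding ketbra_def opr_mult trace_opr by (intro sum.cong refl) auto
  also have "\<dots> = coef A d c"
    using assms finite_I by simp
  finally show ?thesis .
qed

lemma ketbra_expand:
  assumes "A \<in> carrier_mat n n"
  shows "A = mat n n (\<lambda>rs. \<Sum>cd\<in>I \<times> I. coef A (fst cd) (snd cd) * ketbra (fst cd) (snd cd) $$ rs)"
proof (rule eq_matI)
  let ?R = "mat n n (\<lambda>rs. \<Sum>cd\<in>I \<times> I. coef A (fst cd) (snd cd) * ketbra (fst cd) (snd cd) $$ rs)"
  fix p q assume "p < dim_row ?R" "q < dim_col ?R"
  then have pq: "p < n" "q < n" by auto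
  have k: "ketbra c d $$ (p, q) = u p c * cnj (u q d)" if "c \<in> I" "d \<in> I" for c d
  proof -
    have "ketbra c d $$ (p, q) = (\<Sum>c'\<in>I. \<Sum>d'\<in>I. if d' = d then (if c'
        = c then u p c' * cnj (u q d') else 0) else 0)"
      unfolding ketbra_def opr_def using pq by (auto intro!: sum.cong)
    then show ?thesis using that finite_I by simp
  qed
  have "A $$ (p, q) = opr (coef A) $$ (p, q)" by (simp add: opr_coef assms)
  also have "\<dots> = (\<Sum>c\<in>I. \<Sum>d\<in>I. coef A c d * ketbra c d $$ (p, q))"
    using pq unfolding opr_def by (auto simp: k mult_ac intro!: sum.cong)
  also have "\<dots> = ?R $$ (p, q)"
    using pq by (simp add: sum.cartesian_product case_prod_unfold)
  finally show "A $$ (p, q) = ?R $$ (p, q)" .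
qed (use assms in auto)

end

subsection \<open>Block matrix units\<close>

definition block_index :: "nat \<Rightarrow> (nat \<Rightarrow> nat) \<Rightarrow> (nat \<Rightarrow> nat) \<Rightarrow> (nat \<times> nat \<times> nat) set" where
  "block_index k d m = (SIGMA i:{..<k}. {..<d i} \<times> {..<m i})"

lemma block_index_iff [simp]: "(i, a, \<alpha>) \<in> block_index k d m \<longleftrightarrow> i < k \<and> a < d i \<and> \<alpha> < m i"
  by (simp add: block_index_def)

lemma finite_block_index [simp]: "finite (block_index k d m)"
  by (simp add: block_index_def)

lemma sum_block_index:
  "(\<Sum>c\<in>block_index k d m. f c) = (\<Sum>i<k. \<Sum>a<d i. \<Sum>\<alpha><m i. f (i, a, \<alpha>))"
  unfolding block_index_def
  by (subst sum.cartesian_product) (simp add: sum.Sigma case_prod_unfold)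

text \<open>In a label (i, a, \<alpha>) the block is i, the index \<open>a\<close> belongs to the
  factor on which the algebra acts, and \<alpha> to the multiplicity factor.\<close>

locale block_frame = frame n "block_index k d m" u
  for n k :: nat and d m :: "nat \<Rightarrow> nat" and u :: "nat \<Rightarrow> nat \<times> nat \<times> nat \<Rightarrow> complex" +
  assumes d_pos: "i < k \<Longrightarrow> 0 < d i" and m_pos: "i < k \<Longrightarrow> 0 < m i"
begin

abbreviation J where "J \<equiv> block_index k d m"

text \<open>The direct sum of the \<open>X i\<close> \<otimes> 1, the general element of the
  algebra. In \<open>dens\<close> the identity is replaced by \<open>w i\<close>, and in
  \<open>block_unit\<close> a single matrix unit of one block is taken for \<open>X\<close>.\<close>

definition blk :: "(nat \<Rightarrow> nat \<Rightarrow> nat \<Rightarrow> complex) \<Rightarrow> complex mat" where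
  "blk X = opr (\<lambda>c c'. if fst c = fst c' \<and> snd (snd c) = snd (snd c')
     then X (fst c) (fst (snd c)) (fst (snd c')) else 0)"

definition dens :: "(nat \<Rightarrow> nat \<Rightarrow> nat \<Rightarrow> complex) \<Rightarrow> (nat \<Rightarrow> nat \<Rightarrow> nat \<Rightarrow> complex) \<Rightarrow> complex mat" where
  "dens X w = opr (\<lambda>c c'. if fst c = fst c'
     then X (fst c) (fst (snd c)) (fst (snd c')) * w (fst c) (snd (snd c)) (snd (snd c')) else 0)"

definition block_unit :: "nat \<Rightarrow> nat \<Rightarrow> nat \<Rightarrow> complex mat" where
  "block_unit i a b = blk (\<lambda>i' a' b'. if i' = i \<and> a' = a \<and> b' = b then 1 else 0)"

lemma carriers [simp]:
  "blk X \<in> carrier_mat n n" "dens X w \<in> carrier_mat n n" "block_unit i a b \<in> carrier_mat n n"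
  by (simp_all add: blk_def dens_def block_unit_def)

lemma dag_block_unit: "dag (block_unit i a b) = block_unit i b a"
proof -
  have aux: "cnj (if P then if Q then 1 else 0 else 0) = (if P' then if Q' then 1 else 0 else 0)"
    if "P \<and> Q \<longleftrightarrow> P' \<and> Q'" for P Q P' Q'
    using that by auto
  show ?thesis
    unfolding block_unit_def blk_def dag_opr by (rule opr_cong, rule aux) metis
qed

lemma block_unit_mult_opr:
  assumes "i < k" "a' < d i"
  shows "block_unit i a a' * opr F =
    opr (\<lambda>c c'. if fst c = i \<and> fst (snd c) = a then F (i, a', snd (snd c)) c' else 0)"
  unfolding block_unit_def blk_def opr_mult
proof (rule opr_cong)
  fix c c' :: "nat \<times> nat \<times> nat"
  assume J: "c \<in> J"
  let ?f = "\<lambda>e. if fst c = i \<and> fst (snd c) = a then F e c' else 0"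
  have "(\<Sum>e\<in>J. (if fst c = fst e \<and> snd (snd c) = snd (snd e) then
          if fst c = i \<and> fst (snd c) = a \<and> fst (snd e) = a' then 1 else 0 else 0) * F e c')
    = (\<Sum>e\<in>J. if e = (i, a', snd (snd c)) then ?f e else 0)"
    by (intro sum.cong refl) auto
  also have "\<dots> = (if fst c = i \<and> fst (snd c) = a then F (i, a', snd (snd c)) c' else 0)"
    using J assms by (cases c, cases c', subst sum.delta) auto
  finally show "(\<Sum>e\<in>J. (if fst c = fst e \<and> snd (snd c) = snd (snd e) then
          if fst c = i \<and> fst (snd c) = a \<and> fst (snd e) = a' then 1 else 0 else 0) * F e c')
     = (if fst c = i \<and> fst (snd c) = a then F (i, a', snd (snd c)) c' else 0)" .
qed

lemma opr_mult_block_unit: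
  assumes "j < k" "b' < d j"
  shows "opr F * block_unit j b' b =
    opr (\<lambda>c c'. if fst c' = j \<and> fst (snd c') = b then F c (j, b', snd (snd c')) else 0)"
  unfolding block_unit_def blk_def opr_mult
proof (rule opr_cong)
  fix c c' :: "nat \<times> nat \<times> nat"
  assume J: "c' \<in> J"
  let ?f = "\<lambda>e. if fst c' = j \<and> fst (snd c') = b then F c e else 0"
  have "(\<Sum>e\<in>J. F c e * (if fst e = fst c' \<and> snd (snd e) = snd (snd c') then
          if fst e = j \<and> fst (snd e) = b' \<and> fst (snd c') = b then 1 else 0 else 0))
    = (\<Sum>e\<in>J. if e = (j, b', snd (snd c')) then ?f e else 0)"
    by (intro sum.cong refl) auto
  also have "\<dots> = (if fst c' = j \<and> fst (snd c') = b then F c (j, b', snd (snd c')) else 0)"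
    using J assms by (cases c, cases c', subst sum.delta) auto
  finally show "(\<Sum>e\<in>J. F c e * (if fst e = fst c' \<and> snd (snd e) = snd (snd c') then
          if fst e = j \<and> fst (snd e) = b' \<and> fst (snd c') = b then 1 else 0 else 0))
     = (if fst c' = j \<and> fst (snd c') = b then F c (j, b', snd (snd c')) else 0)" .
qed

lemma smult_opr: "t \<cdot>\<^sub>m opr F = opr (\<lambda>c c'. t * F c c')"
  by (rule eq_matI) (auto simp: opr_def sum_distrib_left mult_ac)

lemma zero_opr: "0\<^sub>m n n = opr (\<lambda>c c'. 0)"
  by (rule eq_matI) (auto simp: opr_def)

text \<open>Compression between two matrix units isolates one entry of X. Applied to the value of a
  bimodule map on a rank-one operator, it leaves a single scalar.\<close>

lemma block_unit_blk_block_unit: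
  assumes "i < k" "j < k" "a' < d i" "b' < d j"
  shows "block_unit i a a' * blk X * block_unit j b' b = (if i
      = j then X i a' b' \<cdot>\<^sub>m block_unit i a b else 0\<^sub>m n n)"
proof -
  have *: "block_unit i a a' * blk X * block_unit j b' b =
    opr (\<lambda>c c'. if fst c' = j \<and> fst (snd c') = b then if fst c = i \<and> fst (snd c) = a
      then if i = j \<and> snd (snd c) = snd (snd c') then X i a' b' else 0 else 0 else 0)"
    by (simp only: blk_def [of X] block_unit_mult_opr[OF assms(1,3)] opr_mult_block_unit[OF
        assms(2,4)] fst_conv snd_conv)
  show ?thesis
  proof (cases "i = j")
    case True
    show ?thesis
      unfolding * if_P[OF True]
      unfolding block_unit_def blk_def smult_opr
    proof (rule opr_cong, goal_cases)
      case (1 c c')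
      then show ?case using True by (cases c, cases c') simp
    qed
  next
    case False
    show ?thesis
      unfolding * zero_opr if_not_P[OF False]
      by (rule opr_cong) (simp add: False)
  qed
qed

text \<open>The sandwich moves the labels a', b' to a, b and keeps \<alpha>, \<beta>. Hence a
  bimodule map is known on all rank-one operators once it is known on those with a' = b' =
  0.\<close>

lemma block_unit_ketbra_block_unit:
  assumes "i < k" "j < k" "a' < d i" "b' < d j"
  shows "block_unit i a a' * ketbra (i, a', \<alpha>) (j, b', \<beta>) * block_unit j b' b
      = ketbra (i, a, \<alpha>) (j, b, \<beta>)"
  unfolding ketbra_def block_unit_mult_opr[OF assms(1,3)] opr_mult_block_unit[OF assms(2,4)]
proof (rule opr_cong, goal_cases)
  case (1 c c')
  then show ?case by (cases c, cases c') simp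
qed

lemma block_unit_mult_block_unit:
  assumes "i < k" "b < d i"
  shows "block_unit i a b * block_unit i b c = block_unit i a c"
proof -
  show ?thesis
    unfolding block_unit_def [of i b c] blk_def block_unit_mult_opr[OF assms]
    unfolding block_unit_def blk_def
  proof (rule opr_cong, goal_cases)
    case (1 c c')
    then show ?case by (cases c, cases c') simp
  qed
qed

lemma opr_sum:
  "mat n n (\<lambda>rs. \<Sum>s\<in>S. t s * opr (F s) $$ rs) = opr (\<lambda>c c'. \<Sum>s\<in>S. t s * F s c c')"
proof (rule eq_matI)
  fix p q assume "p < dim_row (opr (\<lambda>c c'. \<Sum>s\<in>S. t s * F s c c'))"
    "q < dim_col (opr (\<lambda>c c'. \<Sum>s\<in>S. t s * F s c c'))"
  then have pq: "p < n" "q < n" by (simp_all add: opr_def)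
  let ?g = "\<lambda>s c c'. u p c * (t s * F s c c') * cnj (u q c')"
  have "mat n n (\<lambda>rs. \<Sum>s\<in>S. t s * opr (F s) $$ rs) $$ (p, q) = (\<Sum>s\<in>S. \<Sum>c\<in>J. \<Sum>c'\<in>J. ?g s c c')"
    using pq by (simp add: opr_def sum_distrib_left mult_ac)
  also have "\<dots> = (\<Sum>c\<in>J. \<Sum>s\<in>S. \<Sum>c'\<in>J. ?g s c c')"
    by (rule sum.swap)
  also have "\<dots> = (\<Sum>c\<in>J. \<Sum>c'\<in>J. \<Sum>s\<in>S. ?g s c c')"
    by (intro sum.cong refl sum.swap)
  also have "\<dots> = opr (\<lambda>c c'. \<Sum>s\<in>S. t s * F s c c') $$ (p, q)"
    using pq by (simp add: opr_def sum_distrib_left sum_distrib_right)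
  finally show "mat n n (\<lambda>rs. \<Sum>s\<in>S. t s * opr (F s) $$ rs) $$ (p, q) =
    opr (\<lambda>c c'. \<Sum>s\<in>S. t s * F s c c') $$ (p, q)" .
qed (simp_all add: opr_def)

text \<open>The factors 1 give the sum the shape that \<open>linear_map_sum\<close> expects.\<close>

lemma block_unit_eq_sum_ketbra:
  "block_unit i a b = mat n n (\<lambda>rs. \<Sum>\<gamma><m i. 1 * ketbra (i, a, \<gamma>) (i, b, \<gamma>) $$ rs)"
  unfolding ketbra_def opr_sum block_unit_def blk_def
proof (rule opr_cong)
  fix c c' :: "nat \<times> nat \<times> nat" assume "c \<in> J"
  then obtain j a' \<alpha> where c: "c = (j, a', \<alpha>)" "\<alpha> < m j" by (cases c) auto
  obtain j' b' \<beta> where c': "c' = (j', b', \<beta>)" by (cases c') auto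
  have "(\<Sum>\<gamma><m i. 1 * (if c = (i, a, \<gamma>) \<and> c' = (i, b, \<gamma>) then 1 else (0::complex))) =
      (\<Sum>\<gamma><m i. if \<gamma> = \<alpha> then if j = i \<and> a' = a \<and> c' = (i, b, \<alpha>) then 1 else 0 else 0)"
    unfolding c by (intro sum.cong refl) auto
  also have "\<dots> = (if fst c = fst c' \<and> snd (snd c) = snd (snd c')
      then if fst c = i \<and> fst (snd c) = a \<and> fst (snd c') = b then 1 else 0 else 0)"
    using c c' by auto
  finally show "(if fst c = fst c' \<and> snd (snd c) = snd (snd c')
      then if fst c = i \<and> fst (snd c) = a \<and> fst (snd c') = b then 1 else 0 else 0) =
     (\<Sum>\<gamma><m i. 1 * (if c = (i, a, \<gamma>) \<and> c' = (i, b, \<gamma>) then 1 else (0::complex)))" by (rule sym)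
qed

text \<open>The right side is the entry (b, a) of the partial trace of block i of A over its
  multiplicity factor.\<close>

lemma trace_mult_block_unit:
  assumes A: "A \<in> carrier_mat n n" and "i < k" "a < d i" "b < d i"
  shows "mat_trace (A * block_unit i a b) = (\<Sum>\<gamma><m i. coef A (i, b, \<gamma>) (i, a, \<gamma>))"
proof -
  have "mat_trace (A * block_unit i a b) = mat_trace (opr (coef A) * block_unit i a b)"
    by (simp only: opr_coef [OF A])
  also have "\<dots> = (\<Sum>c\<in>J. if fst c = i \<and> fst (snd c) = b then coef A c (i, a, snd (snd c)) else 0)"
    by (simp only: opr_mult_block_unit [OF assms(2,3)] trace_opr)
  also have "\<dots> = (\<Sum>\<gamma><m i. coef A (i, b, \<gamma>) (i, a, \<gamma>))"
  proof -
    have inner: "(\<Sum>\<alpha><m j. if j = i \<and> c = b then coef A (j, c, \<alpha>) (i, a, \<alpha>) else 0) =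
        (if j = i then if c = b then \<Sum>\<gamma><m i. coef A (i, b, \<gamma>) (i, a, \<gamma>) else 0 else 0)" for j c
      by auto
    have "(\<Sum>c\<in>J. if fst c = i \<and> fst (snd c) = b then coef A c (i, a, snd (snd c)) else 0) =
      (\<Sum>j<k. \<Sum>c<d j. if j = i then if c = b then \<Sum>\<gamma><m i. coef A (i, b, \<gamma>) (i, a, \<gamma>) else 0 else 0)"
      unfolding sum_block_index fst_conv snd_conv inner by (rule refl)
    also have "\<dots> = (\<Sum>j<k. if j = i then \<Sum>c<d i. if c = b then \<Sum>\<gamma><m i. coef A (i, b, \<gamma>) (i, a, \<gamma>)
        else 0 else 0)"
      by (intro sum.cong refl) auto
    finally show ?thesis using assms by simp
  qed
  finally show ?thesis .
qed

end

subsection \<open>Fixed points of the dual map\<close>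

lemma mat_trace_smult:
  assumes "A \<in> carrier_mat n n"
  shows "mat_trace (t \<cdot>\<^sub>m A) = t * mat_trace A"
  using assms by (simp add: mat_trace_def sum_distrib_left)

context block_frame
begin

lemma coef_blk:
  assumes "(i, a, \<alpha>) \<in> J" "(j, b, \<beta>) \<in> J"
  shows "coef (blk X) (i, a, \<alpha>) (j, b, \<beta>) = (if i = j \<and> \<alpha> = \<beta> then X i a b else 0)"
  unfolding blk_def using assms by (simp add: coef_opr)

lemma coef_dens:
  assumes "(i, a, \<alpha>) \<in> J" "(j, b, \<beta>) \<in> J"
  shows "coef (dens X w) (i, a, \<alpha>) (j, b, \<beta>) = (if i = j then X i a b * w i \<alpha> \<beta> else 0)"
  unfolding dens_def using assms by (simp add: coef_opr)

lemma coef_smult: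
  assumes "A \<in> carrier_mat n n"
  shows "coef (t \<cdot>\<^sub>m A) c c' = t * coef A c c'"
  using assms by (simp add: coef_def sum_distrib_left mult_ac)

text \<open>Both directions rest on the ergodic projection \<open>E\<close>. It is a bimodule map over the fixed
  points, so it sends the rank-one operator from \<open>(j, b, \<beta>)\<close> to \<open>(i, a, \<alpha>)\<close> to a multiple of
  \<open>block_unit i a b\<close> which vanishes for \<open>i \<noteq> j\<close> and otherwise depends on \<open>i, \<alpha>, \<beta>\<close> only.
  These multiples are the entries of the densities \<open>w\<close>.\<close>

lemma dual_fixed_points:
  assumes cp: "completely_positive n \<Phi>" and un: "unital n \<Phi>" and dual: "hs_dual n \<Phi> \<Phi>'"
    and fixed: "Fix n \<Phi> = range blk"
  obtains w where
    "\<And>i. i < k \<Longrightarrow> psd (m i) (mat (m i) (m i) (\<lambda>(\<alpha>, \<beta>). w i \<alpha> \<beta>))"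
    "\<And>i. i < k \<Longrightarrow> (\<Sum>\<alpha><m i. w i \<alpha> \<alpha>) = 1"
    "\<And>\<rho>. \<rho> \<in> carrier_mat n n \<Longrightarrow> \<Phi>' \<rho> = \<rho> \<Longrightarrow>
       \<rho> = dens (\<lambda>i a b. \<Sum>\<gamma><m i. coef \<rho> (i, a, \<gamma>) (i, b, \<gamma>)) w"
    "\<And>X. \<Phi>' (dens X w) = dens X w"
proof -
  let ?C = "carrier_mat n n"
  obtain E where E: "linear_map n E"
    and Efix: "\<And>X. X \<in> ?C \<Longrightarrow> \<Phi> (E X) = E X"
    and Eshift: "\<And>X. X \<in> ?C \<Longrightarrow> E (\<Phi> X) = E X"
    and Eid: "\<And>X. X \<in> ?C \<Longrightarrow> \<Phi> X = X \<Longrightarrow> E X = X"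
    and Epsd: "\<And>X. psd n X \<Longrightarrow> psd n (E X)"
    and Etr: "\<And>\<rho> X. \<rho> \<in> ?C \<Longrightarrow> X \<in> ?C \<Longrightarrow>
      (\<And>Y. Y \<in> ?C \<Longrightarrow> mat_trace (\<rho> * \<Phi> Y) = mat_trace (\<rho> * Y)) \<Longrightarrow>
      mat_trace (\<rho> * E X) = mat_trace (\<rho> * X)"
    and Eleft: "\<And>a X. a \<in> ?C \<Longrightarrow> X \<in> ?C \<Longrightarrow>
      (\<And>Y. Y \<in> ?C \<Longrightarrow> \<Phi> (a * Y) = a * \<Phi> Y) \<Longrightarrow> E (a * X) = a * E X"
    and Eright: "\<And>a X. a \<in> ?C \<Longrightarrow> X \<in> ?C \<Longrightarrow>
      (\<And>Y. Y \<in> ?C \<Longrightarrow> \<Phi> (Y * a) = \<Phi> Y * a) \<Longrightarrow> E (X * a) = E X * a"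
  proof (rule ergodic_projection_exists[OF cp un], goal_cases)
    case (1 E)
    from 1(2-) show ?case by (rule 1(1))
  qed
  have EC: "E X \<in> ?C" if "X \<in> ?C" for X
    using linear_mapD(1)[OF E that] .
  have lin: "linear_map n \<Phi>" using cp by (simp add: completely_positive_def)
  have block_unit_fix: "\<Phi> (block_unit i a b) = block_unit i a b" for i a b
  proof -
    have "block_unit i a b \<in> Fix n \<Phi>" unfolding fixed block_unit_def by blast
    then show ?thesis by (simp add: Fix_def)
  qed
  \<comment> \<open>Block units satisfy the hypotheses of \<open>multiplicative_domain\<close>: the
    adjoint of \<open>block_unit i b a\<close> is \<open>block_unit i a b\<close>, and their product
    is \<open>block_unit i a a\<close>, all three fixed by \<Phi>.\<close>
  have module: "\<Phi> (block_unit i a b * Y) = block_unit i a b * \<Phi> Y" "\<Phi> (Y * block_unit i a b)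
      = \<Phi> Y * block_unit i a b"
    if "i < k" "a < d i" "b < d i" "Y \<in> ?C" for i a b Y
  proof -
    have "\<Phi> (dag (block_unit i b a) * Y) = dag (block_unit i b a) * \<Phi> Y"
      using that by (intro multiplicative_domain(1)[OF cp un])
          (simp_all add: dag_block_unit block_unit_fix block_unit_mult_block_unit)
    then show "\<Phi> (block_unit i a b * Y) = block_unit i a b * \<Phi> Y" by (simp add: dag_block_unit)
    have "\<Phi> (dag (dag Y) * block_unit i a b) = \<Phi> (dag (dag Y)) * block_unit i a b"
      using that by (intro multiplicative_domain(2)[OF cp un])
          (simp_all add: dag_block_unit block_unit_fix block_unit_mult_block_unit)
    then show "\<Phi> (Y * block_unit i a b) = \<Phi> Y * block_unit i a b" by (simp add: dag_dag)
  qed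
  have Emod: "E (block_unit i a a' * Y * block_unit j b' b) = block_unit i a a' * E Y * block_unit
      j b' b"
    if "i < k" "j < k" "a < d i" "a' < d i" "b' < d j" "b < d j" "Y \<in> ?C" for i j a a' b b' Y
  proof -
    have "E (block_unit i a a' * Y * block_unit j b' b) = E (block_unit i a a' * Y) * block_unit j
        b' b"
      using that by (intro Eright module(2)) (auto intro!: mult_carrier_mat[of _ n n])
    also have "E (block_unit i a a' * Y) = block_unit i a a' * E Y"
      using that by (intro Eleft module(1)) auto
    finally show ?thesis .
  qed
  have Eblk: "\<exists>X. E Y = blk X" if "Y \<in> ?C" for Y
  proof -
    have "E Y \<in> Fix n \<Phi>" using Efix[OF that] EC[OF that] by (simp add: Fix_def)
    then show ?thesis unfolding fixed by blast
  qed
  \<comment> \<open>The labels are swapped because the coefficient of a state at (c, c') is its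
    trace against \<open>ketbra c' c\<close>. With this order the fixed points become
    \<open>dens X w\<close> rather than its version with transposed \<open>w\<close>.\<close>
  define w where "w i \<beta> \<alpha> = coef (E (ketbra (i, 0, \<alpha>) (i, 0, \<beta>))) (i, 0, 0) (i, 0, 0)" for i \<alpha> \<beta>
  have Eket: "E (ketbra (i, a, \<alpha>) (j, b, \<beta>)) = (if i = j then w i \<beta> \<alpha> \<cdot>\<^sub>m block_unit i a b else
      0\<^sub>m n n)"
    if "i < k" "j < k" "a < d i" "b < d j" for i j a b \<alpha> \<beta>
  proof -
    obtain X where X: "E (ketbra (i, 0, \<alpha>) (j, 0, \<beta>)) = blk X"
      using Eblk[OF ketbra_carrier] by blast
    have "E (ketbra (i, a, \<alpha>) (j, b, \<beta>)) = E (block_unit i a 0 * ketbra (i, 0, \<alpha>) (j, 0, \<beta>) *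
        block_unit j 0 b)"
      using that by (simp add: block_unit_ketbra_block_unit d_pos)
    also have "\<dots> = block_unit i a 0 * blk X * block_unit j 0 b"
      unfolding X[symmetric] using that by (intro Emod) (auto simp: d_pos)
    also have "\<dots> = (if i = j then X i 0 0 \<cdot>\<^sub>m block_unit i a b else 0\<^sub>m n n)"
      using that by (simp add: block_unit_blk_block_unit d_pos)
    also have "X i 0 0 = w i \<beta> \<alpha>" if "i = j"
      using X \<open>i < k\<close> that by (simp add: w_def coef_blk d_pos m_pos)
    ultimately show ?thesis by (auto split: if_splits)
  qed
  have coef_block_unit: "coef (block_unit i 0 0) (i, 0, 0) (i, 0, 0) = 1" if "i < k" for i
    using that by (simp add: block_unit_def coef_blk d_pos m_pos)
  \<comment> \<open>\<open>?B\<close> is the rank-one operator of the vector h that carries f on the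
    labels (i, 0, \<alpha>). Its image under \<open>E\<close> is positive and equals the form of
    \<open>w i\<close> at f times \<open>block_unit i 0 0\<close>.\<close>
  have w_psd: "psd (m i) (mat (m i) (m i) (\<lambda>(\<alpha>, \<beta>). w i \<alpha> \<beta>))" if i: "i < k" for i
    unfolding psd_iff_sesq
  proof (intro conjI allI)
    fix f :: "nat \<Rightarrow> complex"
    let ?S = "{..<m i} \<times> {..<m i}"
    let ?K = "\<lambda>s. ketbra (i, 0, fst s) (i, 0, snd s)"
    let ?t = "\<lambda>s. f (fst s) * cnj (f (snd s))"
    let ?B = "mat n n (\<lambda>rs. \<Sum>s\<in>?S. ?t s * ?K s $$ rs)"
    let ?h = "\<lambda>c. if fst c = i \<and> fst (snd c) = 0 then f (snd (snd c)) else 0"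
    have "?B = opr (\<lambda>c c'. ?h c * cnj (?h c'))"
      unfolding ketbra_def opr_sum
    proof (rule opr_cong)
      fix c c' assume "c \<in> J" "c' \<in> J"
      then obtain i1 a1 \<alpha> i2 a2 \<beta> where c: "c = (i1, a1, \<alpha>)" "\<alpha> < m i1" "c'
          = (i2, a2, \<beta>)" "\<beta> < m i2"
        by (cases c, cases c') auto
      have "(\<Sum>s\<in>?S. ?t s * (if c = (i, 0, fst s) \<and> c' = (i, 0, snd s) then 1 else 0)) =
        (\<Sum>s\<in>?S. if s = (\<alpha>, \<beta>) then if i1 = i \<and> a1 = 0 \<and> i2 = i \<and> a2 = 0 then ?t s else 0 else 0)"
        unfolding c by (intro sum.cong refl) auto
      also have "\<dots> = ?h c * cnj (?h c')"
        using c by (subst sum.delta) auto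
      finally show "(\<Sum>s\<in>?S. ?t s * (if c = (i, 0, fst s) \<and> c' = (i, 0, snd s) then 1 else 0))
          = ?h c * cnj (?h c')" .
    qed
    moreover have "psd n (opr (\<lambda>c c'. ?h c * cnj (?h c')))"
    proof (rule psd_oprI)
      fix g :: "nat \<times> nat \<times> nat \<Rightarrow> complex"
      have "(\<Sum>c\<in>J. \<Sum>c'\<in>J. cnj (g c) * (?h c * cnj (?h c')) * g c') =
        cnj (\<Sum>c\<in>J. cnj (?h c) * g c) * (\<Sum>c\<in>J. cnj (?h c) * g c)"
        unfolding cnj_sum sum_product by (intro sum.cong refl)
            (simp only: complex_cnj_mult complex_cnj_cnj mult_ac)
      then show "0 \<le> (\<Sum>c\<in>J. \<Sum>c'\<in>J. cnj (g c) * (?h c * cnj (?h c')) * g c')"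
        by (simp only: cnj_mult_self_nonneg)
    qed
    ultimately have B: "psd n (E ?B)" using Epsd by simp
    have "E ?B = mat n n (\<lambda>rs. \<Sum>s\<in>?S. ?t s * E (?K s) $$ rs)"
      by (rule linear_map_sum[OF E]) auto
    also have "\<dots> = mat n n (\<lambda>rs. \<Sum>s\<in>?S. (?t s * w i (snd s) (fst s)) * block_unit i 0 0 $$ rs)"
    proof (rule cong_mat)
      fix r s assume "r < n" "s < n"
      then show "(\<Sum>s'\<in>?S. ?t s' * E (?K s') $$ (r, s)) = (\<Sum>s'\<in>?S. (?t s' * w i (snd s') (fst s'))
          * block_unit i 0 0 $$ (r, s))"
        using i carrier_matD[OF carriers(3)[of i 0 0]] by (simp add: Eket d_pos mult.assoc)
    qed auto
    also have "\<dots> = (\<Sum>s\<in>?S. ?t s * w i (snd s) (fst s)) \<cdot>\<^sub>m block_unit i 0 0"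
      using carrier_matD[OF carriers(3)[of i 0 0]]
      by (intro eq_matI) (simp_all add: sum_distrib_right)
    finally have EB: "E ?B = (\<Sum>s\<in>?S. ?t s * w i (snd s) (fst s)) \<cdot>\<^sub>m block_unit i 0 0" .
    have i00: "(i, 0, 0) \<in> J" using i by (simp add: d_pos m_pos)
    let ?g = "\<lambda>c. if c = (i, 0, 0) then 1 else 0"
    have "0 \<le> (\<Sum>c\<in>J. \<Sum>c'\<in>J. cnj (?g c) * coef (E ?B) c c' * ?g c')"
      by (rule coef_psd[OF B])
    also have "\<dots> = (\<Sum>c\<in>J. \<Sum>c'\<in>J. if c' = (i, 0, 0) then if c
        = (i, 0, 0) then coef (E ?B) c c' else 0 else 0)"
      by (intro sum.cong refl) auto
    also have "\<dots> = coef (E ?B) (i, 0, 0) (i, 0, 0)"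
      using i00 by simp
    also have "\<dots> = (\<Sum>s\<in>?S. ?t s * w i (snd s) (fst s))"
      unfolding EB by (simp add: coef_smult coef_block_unit i)
    also have "\<dots> = (\<Sum>\<alpha><m i. \<Sum>\<beta><m i. cnj (f \<beta>) * w i \<beta> \<alpha> * f \<alpha>)"
      by (simp add: sum.cartesian_product case_prod_unfold mult_ac)
    also have "\<dots> = (\<Sum>\<beta><m i. \<Sum>\<alpha><m i. cnj (f \<beta>) * w i \<beta> \<alpha> * f \<alpha>)"
      by (rule sum.swap)
    also have "\<dots> = sesq (m i) (mat (m i) (m i) (\<lambda>(\<alpha>, \<beta>). w i \<alpha> \<beta>)) f f"
      by (simp add: sesq_def)
    finally show "0 \<le> sesq (m i) (mat (m i) (m i) (\<lambda>(\<alpha>, \<beta>). w i \<alpha> \<beta>)) f f" .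
  qed simp
  \<comment> \<open>\<open>block_unit i 0 0\<close> is fixed by \<open>E\<close> and is the sum of
    the diagonal rank-one operators, whose images carry the factors
    \<open>w i \<gamma> \<gamma>\<close>.\<close>
  have w_tr: "(\<Sum>\<alpha><m i. w i \<alpha> \<alpha>) = 1" if i: "i < k" for i
  proof -
    have "block_unit i 0 0 = E (block_unit i 0 0)"
      using block_unit_fix by (simp add: Eid)
    also have "\<dots> = E (mat n n (\<lambda>rs. \<Sum>\<gamma><m i. 1 * ketbra (i, 0, \<gamma>) (i, 0, \<gamma>) $$ rs))"
      by (simp only: block_unit_eq_sum_ketbra)
    also have "\<dots> = mat n n (\<lambda>rs. \<Sum>\<gamma><m i. 1 * E (ketbra (i, 0, \<gamma>) (i, 0, \<gamma>)) $$ rs)"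
      by (rule linear_map_sum[OF E]) auto
    also have "\<dots> = (\<Sum>\<gamma><m i. w i \<gamma> \<gamma>) \<cdot>\<^sub>m block_unit i 0 0"
      using carrier_matD[OF carriers(3)[of i 0 0]] i
      by (intro eq_matI) (simp_all add: sum_distrib_right Eket d_pos)
    finally have "coef (block_unit i 0 0) (i, 0, 0) (i, 0, 0)
        = coef ((\<Sum>\<gamma><m i. w i \<gamma> \<gamma>) \<cdot>\<^sub>m block_unit i 0 0) (i, 0, 0) (i, 0, 0)"
      by (rule arg_cong)
    then show ?thesis using i by (simp add: coef_smult coef_block_unit)
  qed
  \<comment> \<open>The trace factors into an entry of \<open>w\<close> and an entry of a block
    marginal of \<rho>; this product form is what \<open>dens\<close> expresses.\<close>
  have trE: "mat_trace (\<rho> * E (ketbra (i, a, \<alpha>) (j, b, \<beta>))) =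
      (if i = j then w i \<beta> \<alpha> * (\<Sum>\<gamma><m i. coef \<rho> (i, b, \<gamma>) (i, a, \<gamma>)) else 0)"
    if "\<rho> \<in> ?C" "i < k" "j < k" "a < d i" "b < d j" for \<rho> i j a b \<alpha> \<beta>
  proof (cases "i = j")
    case True
    have "mat_trace (\<rho> * (t \<cdot>\<^sub>m block_unit i a b)) = t * mat_trace (\<rho> * block_unit i a b)" for t
      unfolding mult_smult_distrib[OF that(1) carriers(3)]
      by (rule mat_trace_smult[OF mult_carrier_mat[OF that(1) carriers(3)]])
    then show ?thesis using that True by (simp add: Eket trace_mult_block_unit)
  next
    case False
    then show ?thesis using that by (simp add: Eket mat_trace_def)
  qed
  have dualD: "\<Phi>' \<rho> \<in> ?C" "\<And>Y. Y \<in> ?C \<Longrightarrow> mat_trace (\<Phi>' \<rho> * Y) = mat_trace (\<rho> * \<Phi> Y)"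
    if "\<rho> \<in> ?C" for \<rho>
    using dual that by (auto simp: hs_dual_def)
  show thesis
  proof (rule that[of w])
    fix \<rho> assume \<rho>: "\<rho> \<in> ?C" "\<Phi>' \<rho> = \<rho>"
    show "\<rho> = dens (\<lambda>i a b. \<Sum>\<gamma><m i. coef \<rho> (i, a, \<gamma>) (i, b, \<gamma>)) w"
      unfolding dens_def
    proof (rule eq_oprI[OF \<rho>(1)])
      fix c c' assume J: "c \<in> J" "c' \<in> J"
      then obtain i a \<alpha> j b \<beta> where c: "c = (i, a, \<alpha>)" "c' = (j, b, \<beta>)" by (cases c, cases c') auto
      have "coef \<rho> c c' = mat_trace (\<rho> * ketbra c' c)"
        using J \<rho> by (simp add: trace_mult_ketbra)
      also have "\<dots> = mat_trace (\<rho> * E (ketbra c' c))"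
        using dualD(2)[OF \<rho>(1)] \<rho> by (intro Etr[symmetric]) auto
      also have "\<dots> = (if j = i then w j \<alpha> \<beta> * (\<Sum>\<gamma><m j. coef \<rho> (j, a, \<gamma>) (j, b, \<gamma>)) else 0)"
        using J \<rho> unfolding c by (intro trE) auto
      also have "\<dots> = (if i = j then (\<Sum>\<gamma><m i. coef \<rho> (i, a, \<gamma>) (i, b, \<gamma>)) * w i \<alpha> \<beta> else 0)"
        by (cases "i = j") (simp_all add: mult.commute)
      finally show "coef \<rho> c c' = (if fst c = fst c'
          then (\<Sum>\<gamma><m (fst c). coef \<rho> (fst c, fst (snd c), \<gamma>) (fst c, fst (snd c'), \<gamma>)) *
            w (fst c) (snd (snd c)) (snd (snd c')) else 0)"
        by (simp only: c fst_conv snd_conv)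
    qed
  next
    fix X
    let ?\<rho> = "dens X w"
    \<comment> \<open>Here the normalization of \<open>w i\<close> enters: tracing
      \<open>X i\<close> \<otimes> \<open>w i\<close> over the multiplicity factor returns
      \<open>X i\<close>.\<close>
    have ket: "mat_trace (?\<rho> * E (ketbra c c')) = mat_trace (?\<rho> * ketbra c c')"
      if J: "c \<in> J" "c' \<in> J" for c c'
    proof -
      obtain i a \<alpha> j b \<beta> where c: "c = (i, a, \<alpha>)" "c' = (j, b, \<beta>)" by (cases c, cases c') auto
      have "mat_trace (?\<rho> * E (ketbra c c')) = (if i = j then w i \<beta> \<alpha> *
          (\<Sum>\<gamma><m i. coef ?\<rho> (i, b, \<gamma>) (i, a, \<gamma>)) else 0)"
        using J unfolding c by (intro trE) auto
      also have "\<dots> = (if i = j then w i \<beta> \<alpha> * X i b a else 0)"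
        using J w_tr[of i] unfolding c by (auto simp: coef_dens sum_distrib_left[symmetric])
      also have "\<dots> = coef ?\<rho> c' c"
        using J unfolding c by (subst coef_dens) auto
      also have "\<dots> = mat_trace (?\<rho> * ketbra c c')"
        using J by (simp add: trace_mult_ketbra)
      finally show ?thesis .
    qed
    have tr_sum: "mat_trace (?\<rho> * mat n n (\<lambda>rs. \<Sum>s\<in>S. t s * B s $$ rs)) =
        (\<Sum>s\<in>S. t s * mat_trace (?\<rho> * B s))"
      if "\<And>s. s \<in> S \<Longrightarrow> B s \<in> ?C" for S :: "'s set" and t B
    proof -
      have "mat_trace (?\<rho> * mat n n (\<lambda>rs. \<Sum>s\<in>S. t s * B s $$ rs)) =
        (\<Sum>p<n. \<Sum>q<n. \<Sum>s\<in>S. t s * (?\<rho> $$ (p, q) * B s $$ (q, p)))"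
        by (subst mat_trace_mult[where n = n]) (auto simp: sum_distrib_left sum_distrib_right
            mult_ac)
      also have "\<dots> = (\<Sum>p<n. \<Sum>s\<in>S. \<Sum>q<n. t s * (?\<rho> $$ (p, q) * B s $$ (q, p)))"
        by (intro sum.cong refl sum.swap)
      also have "\<dots> = (\<Sum>s\<in>S. \<Sum>p<n. \<Sum>q<n. t s * (?\<rho> $$ (p, q) * B s $$ (q, p)))"
        by (rule sum.swap)
      also have "\<dots> = (\<Sum>s\<in>S. t s * mat_trace (?\<rho> * B s))"
        using that by (intro sum.cong refl) (simp add: mat_trace_mult[where n = n] sum_distrib_left)
      finally show ?thesis .
    qed
    have inv: "mat_trace (?\<rho> * E Y) = mat_trace (?\<rho> * Y)" if Y: "Y \<in> ?C" for Y
    proof -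
      let ?K = "\<lambda>s. ketbra (fst s) (snd s)"
      let ?t = "\<lambda>s. coef Y (fst s) (snd s)"
      have "mat_trace (?\<rho> * E Y) = mat_trace (?\<rho> * E (mat n n (\<lambda>rs. \<Sum>s\<in>J \<times> J. ?t s * ?K s $$ rs)))"
        using ketbra_expand[OF Y] by simp
      also have "\<dots> = mat_trace (?\<rho> * mat n n (\<lambda>rs. \<Sum>s\<in>J \<times> J. ?t s * E (?K s) $$ rs))"
        by (subst linear_map_sum[OF E]) auto
      also have "\<dots> = (\<Sum>s\<in>J \<times> J. ?t s * mat_trace (?\<rho> * E (?K s)))"
        by (rule tr_sum) (simp add: EC)
      also have "\<dots> = (\<Sum>s\<in>J \<times> J. ?t s * mat_trace (?\<rho> * ?K s))"
        by (intro sum.cong refl) (auto simp: ket)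
      also have "\<dots> = mat_trace (?\<rho> * mat n n (\<lambda>rs. \<Sum>s\<in>J \<times> J. ?t s * ?K s $$ rs))"
        by (rule tr_sum[symmetric]) simp
      also have "\<dots> = mat_trace (?\<rho> * Y)"
        using ketbra_expand[OF Y] by simp
      finally show ?thesis .
    qed
    \<comment> \<open>Since E (\<Phi> Y) = E Y, invariance of the trace under E gives tr(\<rho>
      \<Phi> Y) = tr(\<rho> Y), which determines the dual at \<rho>.\<close>
    have "coef (\<Phi>' ?\<rho>) c c' = coef ?\<rho> c c'" if J: "c \<in> J" "c' \<in> J" for c c'
    proof -
      have "coef (\<Phi>' ?\<rho>) c c' = mat_trace (?\<rho> * \<Phi> (ketbra c' c))"
        using J by (simp add: trace_mult_ketbra[symmetric] dualD)
      also have "\<dots> = mat_trace (?\<rho> * E (\<Phi> (ketbra c' c)))"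
        by (rule inv[symmetric]) (rule linear_mapD(1)[OF lin ketbra_carrier])
      also have "\<dots> = mat_trace (?\<rho> * ketbra c' c)"
        by (simp add: Eshift inv)
      also have "\<dots> = coef ?\<rho> c c'"
        using J by (simp add: trace_mult_ketbra)
      finally show ?thesis .
    qed
    then have "\<Phi>' ?\<rho> = opr (coef ?\<rho>)"
      by (intro eq_oprI dualD) auto
    then show "\<Phi>' ?\<rho> = ?\<rho>" by (simp add: opr_coef)
  qed (use w_psd w_tr in auto)
qed

text \<open>The marginal is a sum of compressions: the summand for \<gamma> is the form of \<rho> at
  the vector f placed at multiplicity label \<gamma> in block i.\<close>

lemma block_marginal_psd:
  assumes "psd n \<rho>" "i < k"
  shows "psd (d i) (mat (d i) (d i) (\<lambda>(a, b). \<Sum>\<gamma><m i. coef \<rho> (i, a, \<gamma>) (i, b, \<gamma>)))"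
  unfolding psd_iff_sesq
proof (intro conjI allI)
  fix f :: "nat \<Rightarrow> complex"
  let ?g = "\<lambda>\<gamma> c. if fst c = i \<and> snd (snd c) = \<gamma> then f (fst (snd c)) else 0"
  have collapse: "(\<Sum>c\<in>J. h c * (if fst c = i \<and> snd (snd c) = \<gamma> then f (fst (snd c)) else 0)) =
     (\<Sum>a<d i. h (i, a, \<gamma>) * f a)" if "\<gamma> < m i" for h \<gamma> and f :: "nat \<Rightarrow> complex"
  proof -
    have inner: "(\<Sum>a<d j. \<Sum>\<alpha><m j. h (j, a, \<alpha>) * (if j = i \<and> \<alpha> = \<gamma> then f a else 0)) =
       (if j = i then \<Sum>a<d i. h (i, a, \<gamma>) * f a else 0)" for j
    proof (cases "j = i")
      case True
      have "(\<Sum>\<alpha><m i. h (i, a, \<alpha>) * (if \<alpha> = \<gamma> then f a else 0)) = h (i, a, \<gamma>) * f a" for a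
      proof -
        have "(\<Sum>\<alpha><m i. h (i, a, \<alpha>) * (if \<alpha> = \<gamma> then f a else 0)) = (\<Sum>\<alpha><m i. if \<alpha>
            = \<gamma> then h (i, a, \<alpha>) * f a else 0)"
          by (intro sum.cong refl) auto
        then show ?thesis using \<open>\<gamma> < m i\<close> by simp
      qed
      then show ?thesis using True by simp
    qed simp
    show ?thesis
      unfolding sum_block_index fst_conv snd_conv inner using assms(2) by simp
  qed
  have "0 \<le> (\<Sum>\<gamma><m i. \<Sum>c\<in>J. \<Sum>c'\<in>J. cnj (?g \<gamma> c) * coef \<rho> c c' * ?g \<gamma> c')"
    by (intro sum_nonneg coef_psd assms)
  also have "\<dots> = (\<Sum>\<gamma><m i. \<Sum>a<d i. \<Sum>b<d i. cnj (f a) * coef \<rho> (i, a, \<gamma>) (i, b, \<gamma>) * f b)"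
  proof (intro sum.cong refl)
    fix \<gamma> assume \<gamma>: "\<gamma> \<in> {..<m i}"
    have "(\<Sum>c\<in>J. \<Sum>c'\<in>J. cnj (?g \<gamma> c) * coef \<rho> c c' * ?g \<gamma> c') =
      (\<Sum>c\<in>J. \<Sum>b<d i. cnj (?g \<gamma> c) * coef \<rho> c (i, b, \<gamma>) * f b)"
      using \<gamma> by (intro sum.cong refl collapse) auto
    also have "\<dots> = (\<Sum>b<d i. \<Sum>c\<in>J. coef \<rho> c (i, b, \<gamma>) * f b * cnj (?g \<gamma> c))"
      by (subst sum.swap) (simp only: mult_ac)
    also have "\<dots> = (\<Sum>b<d i. \<Sum>c\<in>J. coef \<rho> c (i, b, \<gamma>) * f b * (if fst c = i \<and> snd (snd c)
        = \<gamma> then cnj (f (fst (snd c))) else 0))"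
      by (intro sum.cong refl) auto
    also have "\<dots> = (\<Sum>b<d i. \<Sum>a<d i. coef \<rho> (i, a, \<gamma>) (i, b, \<gamma>) * f b * cnj (f a))"
      using \<gamma> by (intro sum.cong refl collapse) auto
    also have "\<dots> = (\<Sum>a<d i. \<Sum>b<d i. cnj (f a) * coef \<rho> (i, a, \<gamma>) (i, b, \<gamma>) * f b)"
      by (subst sum.swap) (simp only: mult_ac)
    finally show "(\<Sum>c\<in>J. \<Sum>c'\<in>J. cnj (?g \<gamma> c) * coef \<rho> c c' * ?g \<gamma> c') =
      (\<Sum>a<d i. \<Sum>b<d i. cnj (f a) * coef \<rho> (i, a, \<gamma>) (i, b, \<gamma>) * f b)" .
  qed
  also have "\<dots> = (\<Sum>a<d i. \<Sum>\<gamma><m i. \<Sum>b<d i. cnj (f a) * coef \<rho> (i, a, \<gamma>) (i, b, \<gamma>) * f b)"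
    by (rule sum.swap)
  also have "\<dots> = (\<Sum>a<d i. \<Sum>b<d i. \<Sum>\<gamma><m i. cnj (f a) * coef \<rho> (i, a, \<gamma>) (i, b, \<gamma>) * f b)"
    by (intro sum.cong refl sum.swap)
  also have "\<dots> = sesq (d i) (mat (d i) (d i) (\<lambda>(a, b). \<Sum>\<gamma><m i. coef \<rho> (i, a, \<gamma>) (i, b, \<gamma>))) f f"
    by (simp add: sesq_def sum_distrib_left sum_distrib_right)
  finally show "0 \<le> sesq (d i) (mat (d i) (d i) (\<lambda>(a, b). \<Sum>\<gamma><m i. coef \<rho> (i, a, \<gamma>) (i, b, \<gamma>))) f
      f" .
qed simp

end

subsection \<open>From block dimensions to a frame\<close>

text \<open>Triples are listed block by block and lexicographically inside a block, the order in
  which \<open>diag_block_mat\<close> and \<open>kron\<close> lay out rows. Block labels have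
  arbitrary type because the blocks of a state on AZ are labelled by pairs.\<close>

definition block_list :: "'k list \<Rightarrow> ('k \<Rightarrow> nat) \<Rightarrow> ('k \<Rightarrow> nat) \<Rightarrow> ('k \<times> nat \<times> nat) list" where
  "block_list ks d m = concat (map (\<lambda>i. map (Pair i) (List.product [0..<d i] [0..<m i])) ks)"

lemma set_block_list: "set (block_list ks d m) = (SIGMA i:set ks. {..<d i} \<times> {..<m i})"
  by (auto simp: block_list_def)

lemma length_block_list: "length (block_list ks d m) = (\<Sum>i\<leftarrow>ks. d i * m i)"
  by (simp add: block_list_def length_concat o_def)

lemma distinct_block_list: "distinct ks \<Longrightarrow> distinct (block_list ks d m)"
  by (induction ks) (auto simp: block_list_def distinct_map inj_on_def distinct_product)

text \<open>\<open>G\<close> is a function of row and column labels that vanishes across blocks, so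
  the block diagonal matrix is \<open>G\<close> read along the concatenated label lists. The
  induction follows the recursion of \<open>diag_block_mat\<close>.\<close>

lemma diag_block_mat_eq_mat:
  assumes "distinct is"
    and "\<And>i j x y. i \<in> set is \<Longrightarrow> j \<in> set is \<Longrightarrow> i \<noteq> j \<Longrightarrow> x \<in> set (L i) \<Longrightarrow> y \<in> set (L j) \<Longrightarrow> G x y = 0"
  shows "diag_block_mat (map (\<lambda>i. mat (length (L i)) (length (L i)) (\<lambda>(r, s). G (L i ! r) (L i !
      s))) is) =
    mat (length (concat (map L is))) (length (concat (map L is)))
      (\<lambda>(r, s). G (concat (map L is) ! r) (concat (map L is) ! s))"
  using assms
proof (induction "is")
  case Nil
  then show ?case by (intro eq_matI) auto
next
  case (Cons i "is")
  let ?M = "\<lambda>xs. mat (length xs) (length xs) (\<lambda>(r, s). G (xs ! r) (xs ! s))"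
  let ?R = "concat (map L is)"
  have IH: "diag_block_mat (map (\<lambda>i. ?M (L i)) is) = ?M ?R"
    using Cons.prems by (intro Cons.IH) auto
  have z1: "G (L i ! r) (?R ! s) = 0" if "r < length (L i)" "s < length ?R" for r s
  proof -
    have "?R ! s \<in> set ?R" using that by (intro nth_mem)
    then obtain j where "j \<in> set is" "?R ! s \<in> set (L j)" by auto
    then show ?thesis using that Cons.prems by (intro Cons.prems(2)[of i j]) auto
  qed
  have z2: "G (?R ! s) (L i ! r) = 0" if "r < length (L i)" "s < length ?R" for r s
  proof -
    have "?R ! s \<in> set ?R" using that by (intro nth_mem)
    then obtain j where "j \<in> set is" "?R ! s \<in> set (L j)" by auto
    then show ?thesis using that Cons.prems by (intro Cons.prems(2)[of j i]) auto
  qed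
  have "diag_block_mat (map (\<lambda>i. ?M (L i)) (i # is)) =
    four_block_mat (?M (L i)) (0\<^sub>m (length (L i)) (length ?R)) (0\<^sub>m (length ?R) (length (L i)))
        (?M ?R)"
    by (simp only: list.map diag_block_mat.simps IH Let_def dim_row_mat dim_col_mat)
  also have "\<dots> = ?M (L i @ ?R)"
  proof (rule eq_matI)
    fix r s assume "r < dim_row (?M (L i @ ?R))" "s < dim_col (?M (L i @ ?R))"
    then have rs: "r < length (L i) + length ?R" "s < length (L i) + length ?R" by simp_all
    have "\<not> r < length (L i) \<Longrightarrow> r - length (L i) < length ?R" "\<not> s < length (L i)
        \<Longrightarrow> s - length (L i) < length ?R"
      using rs by linarith+
    then show "four_block_mat (?M (L i)) (0\<^sub>m (length (L i)) (length ?R)) (0\<^sub>m (length ?R) (length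
        (L i))) (?M ?R) $$ (r, s)
       = ?M (L i @ ?R) $$ (r, s)"
      using rs z1 z2 by (cases "r < length (L i)"; cases "s < length (L i)")
          (simp_all add: nth_append)
  qed simp_all
  finally show ?case by simp
qed

text \<open>The columns of U, relabelled by triples, form the frame; conjugation by U is then the
  passage from coefficient functions to operators.\<close>

lemma block_dims_imp_block_frame:
  assumes "block_dims n F ds"
  obtains m u where "block_frame n (length ds) ((!) ds) m u"
    "F = range (block_frame.blk n (length ds) ((!) ds) m u)"
proof -
  from assms obtain ms U where len: "length ms = length ds"
    and pos: "\<forall>d \<in> set ds. 0 < d" "\<forall>m \<in> set ms. 0 < m"
    and n: "(\<Sum>i<length ds. ds ! i * ms ! i) = n" and U: "unitary_mat n U"
    and F: "F = {U * diag_block_mat (map2 (\<lambda>X m. kron X (1\<^sub>m m)) Xs ms) * mat_adjoint U | Xs.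
            list_all2 (\<lambda>X d. X \<in> carrier_mat d d) Xs ds}"
    unfolding block_dims_def by blast
  let ?k = "length ds" and ?d = "(!) ds" and ?m = "(!) ms"
  define L where "L = block_list [0..<?k] ?d ?m"
  have setL: "set L = block_index ?k ?d ?m"
    by (simp add: L_def set_block_list block_index_def atLeast0LessThan)
  have lenL: "length L = n"
    using n by (simp add: L_def length_block_list interv_sum_list_conv_sum_set_nat atLeast0LessThan)
  have disL: "distinct L" by (simp add: L_def distinct_block_list)
  have bij: "bij_betw ((!) L) {..<n} (block_index ?k ?d ?m)"
    using bij_betw_nth[OF disL] lenL setL by auto
  \<comment> \<open>\<open>ps\<close> is the inverse of the enumeration \<open>L\<close>; it sends a
    label to the number of its column of U.\<close>
  define ps where "ps = the_inv_into {..<n} ((!) L)"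
  have ps: "ps (L ! r) = r" if "r < n" for r
    unfolding ps_def by (rule the_inv_into_f_f) (use bij that in \<open>auto simp: bij_betw_def\<close>)
  define u where "u p c = U $$ (p, ps c)" for p c
  have u: "u p (L ! r) = U $$ (p, r)" if "r < n" for p r
    using that by (simp add: u_def ps)
  have UC: "U \<in> carrier_mat n n" "dag U \<in> carrier_mat n n" using U by (auto simp: unitary_mat_def)
  interpret block_frame n ?k ?d ?m u
  proof
    show "finite (block_index ?k ?d ?m)" by simp
  next
    fix c c' assume "c \<in> block_index ?k ?d ?m" "c' \<in> block_index ?k ?d ?m"
    then obtain r s where rs: "r < n" "s < n" "c = L ! r" "c' = L ! s"
      using setL lenL by (metis in_set_conv_nth)
    have "(\<Sum>p<n. cnj (u p c) * u p c') = (dag U * U) $$ (r, s)"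
      using rs UC by (subst mult_index[OF UC(2,1)]) (auto simp: u)
    also have "\<dots> = (if r = s then 1 else 0)"
      using U rs by (simp add: unitary_mat_def mat_adjoint_eq_dag)
    also have "\<dots> = (if c = c' then 1 else 0)"
      using rs disL lenL by (auto simp: nth_eq_iff_index_eq)
    finally show "(\<Sum>p<n. cnj (u p c) * u p c') = (if c = c' then 1 else 0)" .
  next
    fix p q assume pq: "p < n" "q < n"
    have "(\<Sum>c\<in>block_index ?k ?d ?m. u p c * cnj (u q c)) = (\<Sum>r<n. u p (L ! r) * cnj (u q (L ! r)))"
      by (rule sum.reindex_bij_betw[OF bij, symmetric])
    also have "\<dots> = (U * dag U) $$ (p, q)"
      using pq UC by (subst mult_index[OF UC]) (auto simp: u)
    also have "\<dots> = (if p = q then 1 else 0)"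
      using U pq by (simp add: unitary_mat_def mat_adjoint_eq_dag)
    finally show "(\<Sum>c\<in>block_index ?k ?d ?m. u p c * cnj (u q c)) = (if p = q then 1 else 0)" .
  next
    fix i assume "i < ?k"
    then show "0 < ds ! i" "0 < ms ! i" using pos len by auto
  qed
  have sandwich: "U * mat n n (\<lambda>(r, s). G (L ! r) (L ! s)) * dag U = opr G" for G
  proof (rule eq_matI)
    fix p q assume "p < dim_row (opr G)" "q < dim_col (opr G)"
    then have pq: "p < n" "q < n" by (simp_all add: opr_def)
    let ?D = "mat n n (\<lambda>(r, s). G (L ! r) (L ! s))"
    have D: "?D \<in> carrier_mat n n" by simp
    have UD: "U * ?D \<in> carrier_mat n n" using UC(1) D by (rule mult_carrier_mat)
    have "(U * ?D * dag U) $$ (p, q) = (\<Sum>s<n. (\<Sum>r<n. U $$ (p, r) * ?D $$ (r, s)) * dag U $$ (s, q))"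
      unfolding mult_index[OF UD UC(2) pq]
      by (intro sum.cong refl) (use pq in \<open>simp only: mult_index[OF UC(1) D] lessThan_iff\<close>)
    also have "\<dots> = (\<Sum>s<n. \<Sum>r<n. u p (L ! r) * G (L ! r) (L ! s) * cnj (u q (L ! s)))"
      using pq UC by (simp add: u sum_distrib_right)
    also have "\<dots> = (\<Sum>r<n. \<Sum>s<n. u p (L ! r) * G (L ! r) (L ! s) * cnj (u q (L ! s)))"
      by (rule sum.swap)
    also have "\<dots> = (\<Sum>c\<in>J. \<Sum>c'\<in>J. u p c * G c c' * cnj (u q c'))"
      by (simp add: sum.reindex_bij_betw[OF bij, symmetric])
    finally show "(U * ?D * dag U) $$ (p, q) = opr G $$ (p, q)"
      using pq by (simp add: opr_def)
  qed (use UC in \<open>auto simp: opr_def dag_def\<close>)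
  define G where "G Xs c c' = (if fst c = fst c' \<and> snd (snd c) = snd (snd c')
      then Xs ! fst c $$ (fst (snd c), fst (snd c')) else 0)"
    for Xs :: "complex mat list" and c c' :: "nat \<times> nat \<times> nat"
  have diag: "diag_block_mat (map2 (\<lambda>X m. kron X (1\<^sub>m m)) Xs ms)
      = mat n n (\<lambda>(r, s). G Xs (L ! r) (L ! s))"
    if Xs: "list_all2 (\<lambda>X d. X \<in> carrier_mat d d) Xs ds" for Xs
  proof -
    let ?B = "\<lambda>i. map (Pair i) (List.product [0..<?d i] [0..<?m i])"
    have lXs: "length Xs = ?k" using Xs by (rule list_all2_lengthD)
    have split: "map2 (\<lambda>X m. kron X (1\<^sub>m m)) Xs ms = map (\<lambda>i. kron (Xs ! i) (1\<^sub>m (?m i))) [0..<?k]"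
      using lXs len by (intro nth_equalityI) auto
    have blocks: "map (\<lambda>i. kron (Xs ! i) (1\<^sub>m (?m i))) [0..<?k]
        = map (\<lambda>i. mat (length (?B i)) (length (?B i)) (\<lambda>(r, s). G Xs (?B i ! r) (?B i ! s)))
            [0..<?k]"
    proof (intro map_cong refl)
      fix i assume "i \<in> set [0..<?k]"
      then have i: "i < ?k" by simp
      have X: "Xs ! i \<in> carrier_mat (?d i) (?d i)" using Xs i lXs by
          (simp add: list_all2_conv_all_nth)
      have nthB: "?B i ! r = (i, r div ?m i, r mod ?m i)" if "r < ?d i * ?m i" for r
      proof -
        have "0 < ?m i" using that by (cases "?m i") auto
        then show ?thesis using that by (simp add: product_nth less_mult_imp_div_less)
      qed
      show "kron (Xs ! i) (1\<^sub>m (?m i)) = mat (length (?B i)) (length (?B i)) (\<lambda>(r, s). G Xs (?B i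
          ! r) (?B i ! s))"
      proof (rule eq_matI)
        fix r s assume "r < dim_row (mat (length (?B i)) (length (?B i)) (\<lambda>(r, s). G Xs (?B i ! r)
            (?B i ! s)))"
          "s < dim_col (mat (length (?B i)) (length (?B i)) (\<lambda>(r, s). G Xs (?B i ! r) (?B i ! s)))"
        then have rs: "r < ?d i * ?m i" "s < ?d i * ?m i" by simp_all
        have "0 < ?m i" using rs by (cases "?m i") auto
        then show "kron (Xs ! i) (1\<^sub>m (?m i)) $$ (r, s) =
           mat (length (?B i)) (length (?B i)) (\<lambda>(r, s). G Xs (?B i ! r) (?B i ! s)) $$ (r, s)"
          using rs X by (simp add: kron_def nthB G_def del: nth_map)
      qed (use X in \<open>auto simp: kron_def\<close>)
    qed
    have cL: "concat (map ?B [0..<?k]) = L"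
      unfolding L_def block_list_def by (rule refl)
    have "diag_block_mat (map (\<lambda>i. mat (length (?B i)) (length (?B i)) (\<lambda>(r, s). G Xs (?B i ! r)
        (?B i ! s))) [0..<?k]) =
        mat (length (concat (map ?B [0..<?k]))) (length (concat (map ?B [0..<?k])))
        (\<lambda>(r, s). G Xs (concat (map ?B [0..<?k]) ! r) (concat (map ?B [0..<?k]) ! s))"
      by (rule diag_block_mat_eq_mat) (auto simp: G_def)
    then show ?thesis unfolding split blocks cL lenL .
  qed
  have "F = range blk"
  proof (intro equalityI subsetI)
    fix Y assume "Y \<in> F"
    then obtain Xs where Xs: "list_all2 (\<lambda>X d. X \<in> carrier_mat d d) Xs ds"
      "Y = U * diag_block_mat (map2 (\<lambda>X m. kron X (1\<^sub>m m)) Xs ms) * mat_adjoint U"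
      unfolding F mem_Collect_eq by (elim exE conjE) (rule that)
    have "Y = blk (\<lambda>i a b. Xs ! i $$ (a, b))"
      unfolding Xs(2) diag[OF Xs(1)] mat_adjoint_eq_dag sandwich unfolding blk_def G_def
          by (rule refl)
    then show "Y \<in> range blk" by blast
  next
    fix Y assume "Y \<in> range blk"
    then obtain X where Y: "Y = blk X" by blast
    let ?Xs = "map (\<lambda>i. mat (?d i) (?d i) (\<lambda>(a, b). X i a b)) [0..<?k]"
    have Xs: "list_all2 (\<lambda>X d. X \<in> carrier_mat d d) ?Xs ds"
      by (simp add: list_all2_conv_all_nth)
    have "Y = U * diag_block_mat (map2 (\<lambda>X m. kron X (1\<^sub>m m)) ?Xs ms) * mat_adjoint U"
      unfolding diag[OF Xs] mat_adjoint_eq_dag sandwich unfolding Y blk_def G_def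
      by (rule opr_cong) (auto simp: block_index_def)
    with Xs show "Y \<in> F" unfolding F mem_Collect_eq by (intro exI conjI)
  qed
  then show thesis
    using that block_frame_axioms by blast
qed

subsection \<open>Spectra and entropies\<close>

definition eta :: "real \<Rightarrow> real" where
  "eta x = - (x * log 2 x)"

lemma proots_upper_triangular:
  assumes "A \<in> carrier_mat n n" "upper_triangular A"
  shows "proots (char_poly A) = mset (diag_mat (A :: complex mat))"
proof -
  have "proots (\<Prod>a\<leftarrow>as. [:- a, 1:]) = mset as" for as :: "complex list"
  proof (induction as)
    case (Cons a as)
    have "(\<Prod>a\<leftarrow>as. [:- a, 1:]) \<noteq> 0" by (auto simp: prod_list_zero_iff)
    then have "proots ([:- a, 1:] * (\<Prod>a\<leftarrow>as. [:- a, 1:])) = {#a#} + mset as"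
      by (subst proots_mult) (auto simp: Cons.IH simp del: mult_pCons_left)
    then show ?case by (simp del: mult_pCons_left)
  qed simp
  then show ?thesis by (simp add: char_poly_upper_triangular[OF assms])
qed

lemma vn_entropy_upper_triangular:
  assumes A: "A \<in> carrier_mat n n" "upper_triangular A"
    and l: "\<And>r. r < n \<Longrightarrow> A $$ (r, r) = of_real (l r)"
  shows "vn_entropy A = (\<Sum>r<n. eta (l r))"
proof -
  have "diag_mat A = map (\<lambda>r. of_real (l r)) [0..<n]"
    using A l by (auto simp: diag_mat_def)
  then have "vn_entropy A = - (\<Sum>r\<leftarrow>[0..<n]. l r * log 2 (l r))"
    unfolding vn_entropy_def proots_upper_triangular[OF A]
    by (simp add: sum_mset_sum_list mset_map[symmetric] o_def del: mset_map)
  also have "\<dots> = (\<Sum>r<n. eta (l r))"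
    by (simp add: interv_sum_list_conv_sum_set_nat atLeast0LessThan eta_def sum_negf)
  finally show ?thesis .
qed

text \<open>\<open>P\<close> and \<open>Q\<close> are mutually inverse matrices whose inner index is the
  enumeration \<open>xs\<close> of an arbitrary index set.\<close>

lemma char_poly_change_basis:
  fixes A :: "complex mat" and T :: "'c \<Rightarrow> 'c \<Rightarrow> complex"
  assumes A: "A \<in> carrier_mat n n" and xs: "distinct xs" "length xs = n"
    and inv: "\<And>c d. c \<in> set xs \<Longrightarrow> d \<in> set xs \<Longrightarrow> (\<Sum>p<n. Q c p * P p d) = (if c = d then 1 else 0)"
    and eq: "\<And>p q. p < n \<Longrightarrow> q < n \<Longrightarrow> A $$ (p, q) = (\<Sum>c\<in>set xs. \<Sum>d\<in>set xs. P p c * T c d * Q d q)"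
  shows "char_poly A = char_poly (mat n n (\<lambda>(r, s). T (xs ! r) (xs ! s)))"
proof -
  let ?P = "mat n n (\<lambda>(p, r). P p (xs ! r))" and ?Q = "mat n n (\<lambda>(r, p). Q (xs ! r) p)"
    and ?T = "mat n n (\<lambda>(r, s). T (xs ! r) (xs ! s))"
  have bij: "bij_betw ((!) xs) {..<n} (set xs)"
    using bij_betw_nth[OF xs(1)] xs(2) by auto
  have QP: "?Q * ?P = 1\<^sub>m n"
  proof (rule eq_matI)
    fix r s assume "r < dim_row (1\<^sub>m n :: complex mat)" "s < dim_col (1\<^sub>m n :: complex mat)"
    then have rs: "r < n" "s < n" by simp_all
    have "(?Q * ?P) $$ (r, s) = (\<Sum>p<n. Q (xs ! r) p * P p (xs ! s))"
      using rs by (subst mult_index[of _ n n _ n]) auto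
    also have "\<dots> = (if r = s then 1 else 0)"
      using rs xs by (simp add: inv nth_eq_iff_index_eq)
    finally show "(?Q * ?P) $$ (r, s) = 1\<^sub>m n $$ (r, s)" using rs by simp
  qed auto
  \<comment> \<open>Both matrices are square, as there are n labels, so the one-sided inverse is
    two-sided.\<close>
  have PQ: "?P * ?Q = 1\<^sub>m n"
    by (rule mat_mult_left_right_inverse[OF _ _ QP]) auto
  have "A = ?P * ?T * ?Q"
  proof (rule eq_matI)
    fix p q assume "p < dim_row (?P * ?T * ?Q)" "q < dim_col (?P * ?T * ?Q)"
    then have pq: "p < n" "q < n" by simp_all
    have PT: "?P * ?T \<in> carrier_mat n n" by (rule mult_carrier_mat[of _ n n]) simp_all
    have "(?P * ?T * ?Q) $$ (p, q) = (\<Sum>s<n. (\<Sum>r<n. P p (xs ! r) * T (xs ! r) (xs ! s)) * Q (xs !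
        s) q)"
      using pq by (subst mult_index[OF PT]) (auto simp: mult_index[of ?P n n ?T n] simp del:
          index_mult_mat(1) intro!: sum.cong)
    also have "\<dots> = (\<Sum>s<n. \<Sum>r<n. P p (xs ! r) * T (xs ! r) (xs ! s) * Q (xs ! s) q)"
      by (simp add: sum_distrib_right)
    also have "\<dots> = (\<Sum>r<n. \<Sum>s<n. P p (xs ! r) * T (xs ! r) (xs ! s) * Q (xs ! s) q)"
      by (rule sum.swap)
    also have "\<dots> = (\<Sum>c\<in>set xs. \<Sum>d\<in>set xs. P p c * T c d * Q d q)"
      by (simp add: sum.reindex_bij_betw[OF bij, symmetric])
    also have "\<dots> = A $$ (p, q)" by (rule eq[OF pq, symmetric])
    finally show "A $$ (p, q) = (?P * ?T * ?Q) $$ (p, q)" by (rule sym)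
  qed (use A in auto)
  then have "similar_mat A ?T"
    using A PQ QP by (intro similar_matI[of A ?T ?P ?Q n]) auto
  then show ?thesis by (rule char_poly_similar)
qed

text \<open>X = P T Q with Q P = 1 and T upper triangular with real diagonal l. The entropy depends
  on the characteristic polynomial alone, so this records all of the spectrum that it sees. Index
  functions in place of matrices make it easy to combine such forms over blocks.\<close>

definition triangularizes ::
  "nat \<Rightarrow> (nat \<Rightarrow> nat \<Rightarrow> complex) \<Rightarrow> (nat \<Rightarrow> real) \<Rightarrow> (nat \<Rightarrow> nat \<Rightarrow> complex) \<Rightarrow>
    (nat \<Rightarrow> nat \<Rightarrow> complex) \<Rightarrow> (nat \<Rightarrow> nat \<Rightarrow> complex) \<Rightarrow> bool" where
  "triangularizes d X l P T Q \<longleftrightarrow>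
     (\<forall>a<d. \<forall>b<d. X a b = (\<Sum>c<d. \<Sum>e<d. P a c * T c e * Q e b)) \<and>
     (\<forall>c<d. \<forall>e<d. (\<Sum>a<d. Q c a * P a e) = (if c = e then 1 else 0)) \<and>
     (\<forall>c<d. \<forall>e<c. T c e = 0) \<and> (\<forall>c<d. T c c = of_real (l c))"

definition triangularizable :: "nat \<Rightarrow> (nat \<Rightarrow> nat \<Rightarrow> complex) \<Rightarrow> (nat \<Rightarrow> real) \<Rightarrow> bool" where
  "triangularizable d X l \<longleftrightarrow> (\<exists>P T Q. triangularizes d X l P T Q)"

lemma triangularizable_diagonal:
  assumes "\<And>a b. a < d \<Longrightarrow> b < d \<Longrightarrow> X a b = (if a = b then of_real (l a) else 0)"
  shows "triangularizable d X l"
  unfolding triangularizable_def triangularizes_def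
proof (intro exI conjI allI impI)
  let ?D = "\<lambda>a b. if a = b then 1 else (0::complex)"
  fix a b assume ab: "a < d" "b < d"
  then show "X a b = (\<Sum>c<d. \<Sum>e<d. ?D a c * X c e * ?D e b)"
    by (intro sum_delta2[symmetric]) auto
  have "(\<Sum>c<d. ?D a c * ?D c b) = (\<Sum>c<d. if a = c then ?D c b else 0)"
    by (intro sum.cong refl) auto
  then show "(\<Sum>c<d. ?D a c * ?D c b) = (if a = b then 1 else 0)"
    using ab by simp
qed (use assms in auto)

lemma triangularizable_trace:
  assumes "triangularizable d X l"
  shows "(\<Sum>a<d. X a a) = of_real (\<Sum>c<d. l c)"
proof -
  from assms obtain P T Q where
    X: "\<forall>a<d. \<forall>b<d. X a b = (\<Sum>c<d. \<Sum>e<d. P a c * T c e * Q e b)" and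
    inv: "\<forall>c<d. \<forall>e<d. (\<Sum>a<d. Q c a * P a e) = (if c = e then 1 else 0)" and
    T: "\<forall>c<d. T c c = of_real (l c)"
    unfolding triangularizable_def triangularizes_def by blast
  have "(\<Sum>a<d. X a a) = (\<Sum>a<d. \<Sum>c<d. \<Sum>e<d. T c e * (Q e a * P a c))"
    using X by (simp add: mult_ac)
  also have "\<dots> = (\<Sum>c<d. \<Sum>a<d. \<Sum>e<d. T c e * (Q e a * P a c))"
    by (rule sum.swap)
  also have "\<dots> = (\<Sum>c<d. \<Sum>e<d. \<Sum>a<d. T c e * (Q e a * P a c))"
    by (intro sum.cong refl sum.swap)
  also have "\<dots> = (\<Sum>c<d. \<Sum>e<d. if e = c then T c e else 0)"
    using inv by (intro sum.cong refl) (auto simp: sum_distrib_left[symmetric])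
  also have "\<dots> = of_real (\<Sum>c<d. l c)"
    using T by simp
  finally show ?thesis .
qed

lemma psd_eigenvalue_nonneg:
  assumes A: "psd n A" and ev: "eigenvalue A t"
  shows "0 \<le> t"
proof -
  have AC: "A \<in> carrier_mat n n" using A by (simp add: psd_def)
  from ev obtain v where v: "v \<in> carrier_vec n" "v \<noteq> 0\<^sub>v n" "A *\<^sub>v v = t \<cdot>\<^sub>v v"
    using AC by (auto simp: eigenvalue_def eigenvector_def)
  have "0 \<le> (A *\<^sub>v v) \<bullet>c v" using A v(1) unfolding psd_def by blast
  also have "\<dots> = t * (v \<bullet>c v)" using v by simp
  finally have t: "0 \<le> t * (v \<bullet>c v)" .
  have "0 < v \<bullet>c v" using v(1,2) conjugate_square_greater_0_vec by blast
  then have "Im (v \<bullet>c v) = 0" "Re (v \<bullet>c v) > 0" by (auto simp: less_complex_def)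
  with t show ?thesis
    by (auto simp: less_eq_complex_def zero_le_mult_iff)
qed

text \<open>The diagonal entries of a Schur form are roots of the characteristic polynomial, hence
  eigenvalues. Positivity makes them real and nonnegative, so nothing is lost by taking real
  parts.\<close>

lemma psd_triangularizable:
  assumes psd: "psd d (mat d d (\<lambda>(a, b). X a b))"
  obtains l where "triangularizable d X l" "\<And>c. c < d \<Longrightarrow> 0 \<le> l c"
proof -
  let ?A = "mat d d (\<lambda>(a, b). X a b)"
  have A: "?A \<in> carrier_mat d d" by simp
  obtain as where as: "char_poly ?A = (\<Prod>a\<leftarrow>as. [:- a, 1:])"
    using char_poly_factorized[OF A] by blast
  obtain T where T: "T \<in> carrier_mat d d" "upper_triangular T" "similar_mat ?A T"
    using schur_decomposition_exists[OF A as] by blast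
  then obtain P Q where wit: "similar_mat_wit ?A T P Q" by (auto simp: similar_mat_def)
  have dd: "d = dim_row ?A" by simp
  note PTQ = similar_mat_witD(2,3,6,7)[OF dd wit]
  have nonneg: "0 \<le> T $$ (c, c)" if c: "c < d" for c
  proof (rule psd_eigenvalue_nonneg[OF psd])
    have "proots (char_poly ?A) = mset (diag_mat T)"
      by (simp add: char_poly_similar[OF T(3)] proots_upper_triangular[OF T(1,2)])
    moreover have "T $$ (c, c) \<in> set (diag_mat T)"
      using c T by (auto simp: diag_mat_def)
    moreover have "char_poly ?A \<noteq> 0" unfolding as by (auto simp: prod_list_zero_iff)
    ultimately have "poly (char_poly ?A) (T $$ (c, c)) = 0"
      by (metis (mono_tags) mem_Collect_eq set_count_proots set_mset_mset)
    then show "eigenvalue ?A (T $$ (c, c))"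
      by (simp add: eigenvalue_root_char_poly[OF A])
  qed
  show thesis
  proof (rule that[of "\<lambda>c. Re (T $$ (c, c))"])
    show "triangularizable d X (\<lambda>c. Re (T $$ (c, c)))"
      unfolding triangularizable_def triangularizes_def
    proof (intro exI conjI allI impI)
      fix a b assume ab: "a < d" "b < d"
      have PT: "P * T \<in> carrier_mat d d" using PTQ T by simp
      have "X a b = (P * T * Q) $$ (a, b)"
        using ab by (simp add: PTQ(2)[symmetric])
      also have "\<dots> = (\<Sum>e<d. (\<Sum>c<d. P $$ (a, c) * T $$ (c, e)) * Q $$ (e, b))"
        unfolding mult_index[OF PT PTQ(4) ab]
        by (intro sum.cong refl) (use ab in \<open>simp only: mult_index[OF PTQ(3) T(1)] lessThan_iff\<close>)
      also have "\<dots> = (\<Sum>e<d. \<Sum>c<d. P $$ (a, c) * T $$ (c, e) * Q $$ (e, b))"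
        by (simp add: sum_distrib_right)
      also have "\<dots> = (\<Sum>c<d. \<Sum>e<d. P $$ (a, c) * T $$ (c, e) * Q $$ (e, b))"
        by (rule sum.swap)
      finally show "X a b = (\<Sum>c<d. \<Sum>e<d. P $$ (a, c) * T $$ (c, e) * Q $$ (e, b))" .
      have "(\<Sum>c<d. Q $$ (a, c) * P $$ (c, b)) = (Q * P) $$ (a, b)"
        by (rule mult_index[OF PTQ(4,3) ab, symmetric])
      then show "(\<Sum>c<d. Q $$ (a, c) * P $$ (c, b)) = (if a = b then 1 else 0)"
        using ab by (simp add: PTQ(1))
    next
      fix c e assume "c < d" "e < c"
      then show "T $$ (c, e) = 0" using T by auto
    next
      fix c assume "c < d"
      then show "T $$ (c, c) = of_real (Re (T $$ (c, c)))"
        using nonneg[of c] by (simp add: less_eq_complex_def complex_eq_iff)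
    qed
  next
    fix c assume "c < d"
    then show "0 \<le> Re (T $$ (c, c))" using nonneg[of c] by (simp add: less_eq_complex_def)
  qed
qed

section \<open>Entropy of a direct sum of tensor products\<close>

lemma eta_mult:
  assumes "0 \<le> x" "0 \<le> y"
  shows "eta (x * y) = eta x * y + x * eta y"
proof (cases "x = 0 \<or> y = 0")
  case False
  then show ?thesis using assms by (simp add: eta_def log_mult algebra_simps)
qed (auto simp: eta_def)

lemma sum_sigma_fiber:
  fixes g :: "'k \<times> nat \<times> nat \<Rightarrow> 'a::comm_monoid_add"
  assumes "finite K" "i \<in> K"
  shows "(\<Sum>c\<in>(SIGMA i:K. {..<d i} \<times> {..<m i}). if fst c = i then g c else 0) =
    (\<Sum>x\<in>{..<d i} \<times> {..<m i}. g (i, x))"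
proof -
  have "(\<Sum>c\<in>(SIGMA i:K. {..<d i} \<times> {..<m i}). if fst c = i then g c else 0) =
    (\<Sum>j\<in>K. \<Sum>x\<in>{..<d j} \<times> {..<m j}. if j = i then g (j, x) else 0)"
    using assms(1) by (subst sum.Sigma) (auto intro!: sum.cong)
  also have "\<dots> = (\<Sum>j\<in>K. if j = i then \<Sum>x\<in>{..<d j} \<times> {..<m j}. g (j, x) else 0)"
    by (intro sum.cong refl) auto
  finally show ?thesis using assms by simp
qed


lemma sum_sigma_fiber2:
  fixes g :: "'k \<times> nat \<times> nat \<Rightarrow> 'k \<times> nat \<times> nat \<Rightarrow> 'a::comm_monoid_add"
  assumes K: "finite K" "i \<in> K"
  shows "(\<Sum>c\<in>(SIGMA i:K. {..<d i} \<times> {..<m i}). \<Sum>e\<in>(SIGMA i:K. {..<d i} \<times> {..<m i}).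
      if fst c = i \<and> fst e = i then g c e else 0) =
    (\<Sum>x\<in>{..<d i} \<times> {..<m i}. \<Sum>y\<in>{..<d i} \<times> {..<m i}. g (i, x) (i, y))"
proof -
  let ?I = "SIGMA i:K. {..<d i} \<times> {..<m i}"
  have "(\<Sum>c\<in>?I. \<Sum>e\<in>?I. if fst c = i \<and> fst e = i then g c e else 0) =
    (\<Sum>c\<in>?I. if fst c = i then \<Sum>e\<in>?I. if fst e = i then g c e else 0 else 0)"
    by (intro sum.cong refl) simp
  also have "\<dots> = (\<Sum>x\<in>{..<d i} \<times> {..<m i}. \<Sum>y\<in>{..<d i} \<times> {..<m i}. g (i, x) (i, y))"
    by (simp only: sum_sigma_fiber[OF K])
  finally show ?thesis .
qed

lemma sum_prod_pairs:
  fixes f g :: "nat \<Rightarrow> nat \<Rightarrow> 'a::comm_ring_1"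
  shows "(\<Sum>x\<in>A \<times> B. \<Sum>y\<in>C \<times> D. f (fst x) (fst y) * g (snd x) (snd y)) =
    (\<Sum>a\<in>A. \<Sum>c\<in>C. f a c) * (\<Sum>b\<in>B. \<Sum>e\<in>D. g b e)"
proof -
  have "(\<Sum>x\<in>A \<times> B. \<Sum>y\<in>C \<times> D. f (fst x) (fst y) * g (snd x) (snd y)) =
    (\<Sum>x\<in>A \<times> B. (\<Sum>c\<in>C. f (fst x) c) * (\<Sum>e\<in>D. g (snd x) e))"
    by (intro sum.cong refl) (simp add: sum_product sum.cartesian_product case_prod_unfold)
  also have "\<dots> = (\<Sum>a\<in>A. \<Sum>b\<in>B. (\<Sum>c\<in>C. f a c) * (\<Sum>e\<in>D. g b e))"
    by (simp add: sum.cartesian_product case_prod_unfold)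
  finally show ?thesis by (simp add: sum_product)
qed

text \<open>If s precedes r inside a block, lexicographic order makes one of its two components
  strictly smaller. So in a tensor product of two upper triangular matrices the entry at (r, s) has
  a vanishing factor.\<close>

lemma block_list_upper_triangular:
  assumes ks: "distinct ks" and s: "s < r" "r < length (block_list ks d m)"
    and fst: "fst (block_list ks d m ! r) = fst (block_list ks d m ! s)"
  shows "fst (snd (block_list ks d m ! s)) < fst (snd (block_list ks d m ! r)) \<or>
    snd (snd (block_list ks d m ! s)) < snd (snd (block_list ks d m ! r))"
proof -
  let ?le = "\<lambda>x y. fst x = fst y \<longrightarrow> fst (snd x) < fst (snd y) \<or> snd (snd x) < snd (snd (y :: 'a \<times>
      nat \<times> nat))"
  have prod: "sorted_wrt (\<lambda>x y. fst x < fst y \<or> snd x < snd y) (List.product xs ys)"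
    if "sorted_wrt (<) xs" "sorted_wrt (<) ys" for xs ys :: "nat list"
    using that
    by (induction xs) (auto simp: sorted_wrt_append sorted_wrt_map)
  have "sorted_wrt ?le (block_list ks d m)"
    using ks
  proof (induction ks)
    case (Cons k ks)
    have "sorted_wrt ?le (map (Pair k) (List.product [0..<d k] [0..<m k]))"
      using prod[of "[0..<d k]" "[0..<m k]"] by (simp add: sorted_wrt_map)
    then show ?case
      using Cons by (auto simp: block_list_def sorted_wrt_append)
  qed (simp add: block_list_def)
  then show ?thesis
    using s fst unfolding sorted_wrt_iff_nth_less by metis
qed

text \<open>The eigenvalues are the products \<open>l i a * \<mu> i \<alpha>\<close>, and
  \<open>eta_mult\<close> with the normalization of \<open>\<mu> i\<close> splits their entropy. The
  basis \<open>B\<close> with its inverse \<open>B'\<close> is a parameter, since the lemma is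
  applied both to the marginal on A and to the state on AZ.\<close>

lemma block_entropy:
  fixes ks :: "'k list" and X w :: "'k \<Rightarrow> nat \<Rightarrow> nat \<Rightarrow> complex"
    and d m :: "'k \<Rightarrow> nat"
  defines "I \<equiv> SIGMA i:set ks. {..<d i} \<times> {..<m i}"
  assumes A: "A \<in> carrier_mat n n" and ks: "distinct ks" and n: "(\<Sum>i\<leftarrow>ks. d i * m i) = n"
    and inv: "\<And>c e. c \<in> I \<Longrightarrow> e \<in> I \<Longrightarrow> (\<Sum>p<n. B' c p * B p e) = (if c = e then 1 else 0)"
    and eq: "\<And>p q. p < n \<Longrightarrow> q < n \<Longrightarrow> A $$ (p, q) = (\<Sum>c\<in>I. \<Sum>e\<in>I. B p c *
       (if fst c = fst e then X (fst c) (fst (snd c)) (fst (snd e)) * w (fst c) (snd (snd c)) (snd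
           (snd e)) else 0) * B' e q)"
    and X: "\<And>i. i \<in> set ks \<Longrightarrow> triangularizable (d i) (X i) (l i)" "\<And>i a. i \<in> set ks \<Longrightarrow> a < d i
        \<Longrightarrow> 0 \<le> l i a"
    and w: "\<And>i. i \<in> set ks \<Longrightarrow> triangularizable (m i) (w i) (\<mu> i)" "\<And>i a. i \<in> set ks \<Longrightarrow> a < m i
        \<Longrightarrow> 0 \<le> \<mu> i a"
      "\<And>i. i \<in> set ks \<Longrightarrow> (\<Sum>a<m i. \<mu> i a) = 1"
  shows "vn_entropy A = (\<Sum>i\<in>set ks. (\<Sum>a<d i. eta (l i a)) + (\<Sum>a<d i. l i a) *
      (\<Sum>a<m i. eta (\<mu> i a)))"
proof -
  let ?L = "block_list ks d m"
  have L: "distinct ?L" "length ?L = n" "set ?L = I"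
    using ks n by (simp_all add: distinct_block_list length_block_list set_block_list I_def)
  have bij: "bij_betw ((!) ?L) {..<n} I"
    using bij_betw_nth[OF L(1)] L by auto
  have nthI: "?L ! r \<in> I" if "r < n" for r
    using that L by (metis nth_mem)
  let ?F = "\<lambda>c e. if fst c = fst e then X (fst c) (fst (snd c)) (fst (snd e)) * w (fst c) (snd
      (snd c)) (snd (snd e)) else 0"
  have cp1: "char_poly A = char_poly (mat n n (\<lambda>(r, s). ?F (?L ! r) (?L ! s)))"
    using inv eq by (intro char_poly_change_basis[OF A L(1,2), of B' B]) (simp_all add: L(3))
  obtain P T Q where "\<forall>i\<in>set ks. triangularizes (d i) (X i) (l i) (P i) (T i) (Q i)"
    using X(1) unfolding triangularizable_def by metis
  then have PTQ: "\<And>i a b. i \<in> set ks \<Longrightarrow> a < d i \<Longrightarrow> b < d i \<Longrightarrow> X i a b =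
      (\<Sum>c<d i. \<Sum>e<d i. P i a c * T i c e * Q i e b)"
     "\<And>i c e. i \<in> set ks \<Longrightarrow> c < d i \<Longrightarrow> e < d i \<Longrightarrow> (\<Sum>a<d i. Q i c a * P i a e) = (if c
         = e then 1 else 0)"
     "\<And>i c e. i \<in> set ks \<Longrightarrow> c < d i \<Longrightarrow> e < c \<Longrightarrow> T i c e = 0" "\<And>i c. i \<in> set ks \<Longrightarrow> c < d i \<Longrightarrow> T i c c
         = of_real (l i c)"
    unfolding triangularizes_def by blast+
  obtain R S R' where "\<forall>i\<in>set ks. triangularizes (m i) (w i) (\<mu> i) (R i) (S i) (R' i)"
    using w(1) unfolding triangularizable_def by metis
  then have RSR: "\<And>i a b. i \<in> set ks \<Longrightarrow> a < m i \<Longrightarrow> b < m i \<Longrightarrow> w i a b =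
      (\<Sum>c<m i. \<Sum>e<m i. R i a c * S i c e * R' i e b)"
     "\<And>i c e. i \<in> set ks \<Longrightarrow> c < m i \<Longrightarrow> e < m i \<Longrightarrow> (\<Sum>a<m i. R' i c a * R i a e) = (if c
         = e then 1 else 0)"
     "\<And>i c e. i \<in> set ks \<Longrightarrow> c < m i \<Longrightarrow> e < c \<Longrightarrow> S i c e = 0" "\<And>i c. i \<in> set ks \<Longrightarrow> c < m i \<Longrightarrow> S i c c
         = of_real (\<mu> i c)"
    unfolding triangularizes_def by blast+
  define diagb :: "('k \<Rightarrow> nat \<Rightarrow> nat \<Rightarrow> complex) \<Rightarrow> ('k \<Rightarrow> nat \<Rightarrow> nat \<Rightarrow> complex) \<Rightarrow> 'k \<times> nat \<times> nat \<Rightarrow> 'k \<times>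
      nat \<times> nat \<Rightarrow> complex"
    where "diagb f g c e = (if fst c = fst e then f (fst c) (fst (snd c)) (fst (snd e)) * g (fst
        c) (snd (snd c)) (snd (snd e)) else 0)" for f g c e
  \<comment> \<open>Second change of basis, by \<open>P i\<close> \<otimes> \<open>R i\<close>
    within each block; the one behind \<open>cp1\<close> only passes from the given basis to block
    form.\<close>
  have cp2: "char_poly (mat n n (\<lambda>(r, s). ?F (?L ! r) (?L ! s)))
      = char_poly (mat n n (\<lambda>(r, s). diagb T S (?L ! r) (?L ! s)))"
  proof (rule char_poly_change_basis[OF _ L(1,2), of _ "\<lambda>c p. diagb Q R' c (?L ! p)" "\<lambda>p c. diagb
      P R (?L ! p) c"])
    fix c e assume ce: "c \<in> set ?L" "e \<in> set ?L"
    then have "c \<in> I" "e \<in> I" unfolding L(3) .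
    then obtain i a \<alpha> j b \<beta> where c: "c = (i, a, \<alpha>)" "e = (j, b, \<beta>)" "i \<in> set ks" "a < d i" "\<alpha> < m
        i" "j \<in> set ks" "b < d j" "\<beta> < m j"
      by (cases c, cases e) (auto simp: I_def)
    have "(\<Sum>p<n. diagb Q R' c (?L ! p) * diagb P R (?L ! p) e) =
        (\<Sum>f\<in>I. diagb Q R' c f * diagb P R f e)"
      by (rule sum.reindex_bij_betw[OF bij])
    also have "\<dots> = (\<Sum>f\<in>I. if fst f = i then (if i = j then (Q i a (fst (snd f)) * P i (fst (snd
        f)) b) * (R' i \<alpha> (snd (snd f)) * R i (snd (snd f)) \<beta>) else 0) else 0)"
      by (intro sum.cong refl) (simp add: diagb_def c)
    also have "\<dots> = (\<Sum>x\<in>{..<d i} \<times> {..<m i}. if i = j then (Q i a (fst x) * P i (fst x) b) * (R' i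
        \<alpha> (snd x) * R i (snd x) \<beta>) else 0)"
      unfolding I_def by (subst sum_sigma_fiber) (use c in \<open>simp_all cong: if_cong\<close>)
    also have "\<dots> = (if i = j then (\<Sum>x<d i. Q i a x * P i x b) *
        (\<Sum>y<m i. R' i \<alpha> y * R i y \<beta>) else 0)"
      by (simp add: sum_product sum.cartesian_product case_prod_unfold)
    also have "\<dots> = (if c = e then 1 else 0)"
      using c by (cases "i = j") (simp_all add: PTQ RSR)
    finally show "(\<Sum>p<n. diagb Q R' c (?L ! p) * diagb P R (?L ! p) e) = (if c = e then 1 else 0)" .
  next
    fix p q assume pq: "p < n" "q < n"
    obtain i a \<alpha> where c: "?L ! p = (i, a, \<alpha>)" "i \<in> set ks" "a < d i" "\<alpha> < m i"
      using nthI[OF pq(1)] by (cases "?L ! p") (auto simp: I_def)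
    obtain j b \<beta> where e: "?L ! q = (j, b, \<beta>)" "j \<in> set ks" "b < d j" "\<beta> < m j"
      using nthI[OF pq(2)] by (cases "?L ! q") (auto simp: I_def)
    have "(\<Sum>f\<in>I. \<Sum>h\<in>I. diagb P R (i, a, \<alpha>) f * diagb T S f h * diagb Q R' h (j, b, \<beta>)) =
      (\<Sum>f\<in>I. \<Sum>h\<in>I. if fst f = i \<and> fst h = i then
         (if i = j then (P i a (fst (snd f)) * T i (fst (snd f)) (fst (snd h)) * Q i (fst (snd h))
             b) *
          (R i \<alpha> (snd (snd f)) * S i (snd (snd f)) (snd (snd h)) * R' i (snd (snd h)) \<beta>) else 0)
              else 0)"
      by (intro sum.cong refl) (auto simp: diagb_def)
    also have "\<dots> = (\<Sum>x\<in>{..<d i} \<times> {..<m i}. \<Sum>y\<in>{..<d i} \<times> {..<m i}.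
         (if i = j then (P i a (fst x) * T i (fst x) (fst y) * Q i (fst y) b) *
          (R i \<alpha> (snd x) * S i (snd x) (snd y) * R' i (snd y) \<beta>) else 0))"
      unfolding I_def by (subst sum_sigma_fiber2) (use c in \<open>simp_all cong: if_cong\<close>)
    also have "\<dots> = (if i = j then (\<Sum>x<d i. \<Sum>y<d i. P i a x * T i x y * Q i y b) *
        (\<Sum>x<m i. \<Sum>y<m i. R i \<alpha> x * S i x y * R' i y \<beta>) else 0)"
    proof (cases "i = j")
      case True
      show ?thesis
        unfolding if_P[OF True]
        by (rule sum_prod_pairs[of "\<lambda>x y. P i a x * T i x y * Q i y b" "\<lambda>x y. R i \<alpha> x * S i x y *
            R' i y \<beta>"])
    qed simp
    also have "\<dots> = ?F (i, a, \<alpha>) (j, b, \<beta>)"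
      using c e by (cases "i = j") (simp_all add: PTQ(1) RSR(1))
    finally show "mat n n (\<lambda>(r, s). ?F (?L ! r) (?L ! s)) $$ (p, q) =
      (\<Sum>c\<in>set ?L. \<Sum>e\<in>set ?L. diagb P R (?L ! p) c * diagb T S c e * diagb Q R' e (?L ! q))"
      unfolding L(3) c(1) e(1) using pq by (simp add: c(1) e(1))
  qed simp
  let ?M = "mat n n (\<lambda>(r, s). diagb T S (?L ! r) (?L ! s))"
  have ut: "upper_triangular ?M"
  proof (rule upper_triangularI)
    fix r s assume rs: "s < r" "r < dim_row ?M"
    obtain i a \<alpha> where c: "?L ! r = (i, a, \<alpha>)" "i \<in> set ks" "a < d i" "\<alpha> < m i"
      using nthI[of r] rs by (cases "?L ! r") (auto simp: I_def)
    have "diagb T S (?L ! r) (?L ! s) = 0"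
    proof (cases "fst (?L ! r) = fst (?L ! s)")
      case True
      then have "fst (snd (?L ! s)) < fst (snd (?L ! r)) \<or> snd (snd (?L ! s)) < snd (snd (?L ! r))"
        using rs L by (intro block_list_upper_triangular[OF ks]) auto
      then show ?thesis using c PTQ(3)[of i a] RSR(3)[of i \<alpha>] by (auto simp: diagb_def)
    qed (simp add: diagb_def)
    then show "?M $$ (r, s) = 0" using rs by simp
  qed
  have "vn_entropy A = vn_entropy ?M"
    by (simp add: vn_entropy_def cp1 cp2)
  also have "\<dots> = (\<Sum>r<n. eta (l (fst (?L ! r)) (fst (snd (?L ! r))) * \<mu> (fst (?L ! r)) (snd (snd
      (?L ! r)))))"
  proof (rule vn_entropy_upper_triangular[OF _ ut])
    fix r assume r: "r < n"
    obtain i a \<alpha> where c: "?L ! r = (i, a, \<alpha>)" "i \<in> set ks" "a < d i" "\<alpha> < m i"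
      using nthI[of r] r by (cases "?L ! r") (auto simp: I_def)
    show "?M $$ (r, r) = of_real (l (fst (?L ! r)) (fst (snd (?L ! r))) * \<mu> (fst (?L ! r)) (snd
        (snd (?L ! r))))"
      using r c by (simp add: diagb_def PTQ RSR)
  qed simp
  also have "\<dots> = (\<Sum>c\<in>I. eta (l (fst c) (fst (snd c)) * \<mu> (fst c) (snd (snd c))))"
    by (rule sum.reindex_bij_betw[OF bij])
  also have "\<dots> = (\<Sum>i\<in>set ks. \<Sum>a<d i. \<Sum>\<alpha><m i. eta (l i a * \<mu> i \<alpha>))"
    unfolding I_def by (subst sum.cartesian_product) (simp add: sum.Sigma case_prod_unfold)
  also have "\<dots> = (\<Sum>i\<in>set ks. (\<Sum>a<d i. eta (l i a)) + (\<Sum>a<d i. l i a) * (\<Sum>a<m i. eta (\<mu> i a)))"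
  proof (intro sum.cong refl)
    fix i assume i: "i \<in> set ks"
    have "(\<Sum>a<d i. \<Sum>\<alpha><m i. eta (l i a * \<mu> i \<alpha>)) = (\<Sum>a<d i. \<Sum>\<alpha><m i. eta (l i a) * \<mu> i \<alpha>
        + l i a * eta (\<mu> i \<alpha>))"
      using i X w by (intro sum.cong refl eta_mult) auto
    also have "\<dots> = (\<Sum>a<d i. eta (l i a)) + (\<Sum>a<d i. l i a) * (\<Sum>a<m i. eta (\<mu> i a))"
      using w(3)[OF i] by (simp add: sum.distrib sum_distrib_left[symmetric]
          sum_distrib_right[symmetric])
    finally show "(\<Sum>a<d i. \<Sum>\<alpha><m i. eta (l i a * \<mu> i \<alpha>)) = (\<Sum>a<d i. eta (l i a)) +
        (\<Sum>a<d i. l i a) * (\<Sum>a<m i. eta (\<mu> i a))" .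
  qed
  finally show ?thesis .
qed

subsection \<open>Mutual information\<close>

text \<open>Gibbs' inequality against the uniform distribution on S, termwise from ln y \<le> y - 1
  at y = 1 / (x i * card S).\<close>

lemma entropy_le_log_card:
  assumes S: "finite S" "S \<noteq> {}" and x: "\<And>i. i \<in> S \<Longrightarrow> 0 \<le> x i" "(\<Sum>i\<in>S. x i) = 1"
  shows "(\<Sum>i\<in>S. eta (x i)) \<le> log 2 (card S)"
proof -
  let ?D = "real (card S)"
  have D: "?D > 0" using S by (simp add: card_gt_0_iff)
  have "eta (x i) - x i * log 2 ?D \<le> (1 / ?D - x i) / ln 2" if "i \<in> S" for i
  proof (cases "x i = 0")
    case True
    then show ?thesis using D by (simp add: eta_def)
  next
    case False
    then have xi: "x i > 0" using x(1)[OF that] by simp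
    have "eta (x i) - x i * log 2 ?D = x i * ln (1 / (x i * ?D)) / ln 2"
      using xi D by (simp add: eta_def log_def ln_div ln_mult field_simps)
    also have "\<dots> \<le> x i * (1 / (x i * ?D) - 1) / ln 2"
      using xi D by (intro divide_right_mono mult_left_mono ln_le_minus_one) auto
    also have "\<dots> = (1 / ?D - x i) / ln 2"
      using xi by (simp add: field_simps)
    finally show ?thesis .
  qed
  then have "(\<Sum>i\<in>S. eta (x i) - x i * log 2 ?D) \<le> (\<Sum>i\<in>S. (1 / ?D - x i) / ln 2)"
    by (rule sum_mono)
  also have "\<dots> = 0"
    using x(2) D by (simp add: sum_divide_distrib[symmetric] sum_subtractf)
  finally show ?thesis
    using x(2) by (simp add: sum_subtractf sum_distrib_right[symmetric])
qed

text \<open>Each \<open>x i\<close> is at most the total, so replacing the total by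
  \<open>x i\<close> inside the logarithm increases every term. It bounds the contribution of one
  letter to H(Z) by the entropy of the blocks of that letter.\<close>

lemma eta_sum_le:
  assumes S: "finite S" and x: "\<And>i. i \<in> S \<Longrightarrow> 0 \<le> x i"
  shows "eta (\<Sum>i\<in>S. x i) \<le> (\<Sum>i\<in>S. eta (x i))"
proof -
  have "- (x i * log 2 (\<Sum>i\<in>S. x i)) \<le> eta (x i)" if "i \<in> S" for i
  proof (cases "x i = 0")
    case False
    then have "x i > 0" using x[OF that] by simp
    moreover have "x i \<le> (\<Sum>i\<in>S. x i)"
      using S x that by (intro member_le_sum) auto
    ultimately show ?thesis by (simp add: eta_def)
  qed (simp add: eta_def)
  then have "(\<Sum>i\<in>S. - (x i * log 2 (\<Sum>i\<in>S. x i))) \<le> (\<Sum>i\<in>S. eta (x i))"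
    by (rule sum_mono)
  then show ?thesis
    by (simp add: eta_def sum_negf sum_distrib_right)
qed

text \<open>Both numbers are the trace of the identity, computed in the frame and in the standard
  basis.\<close>

lemma (in frame) card_index: "card I = n"
proof -
  have "of_nat n = (\<Sum>p<n. \<Sum>c\<in>I. u p c * cnj (u p c))"
    by (simp add: complete)
  also have "\<dots> = (\<Sum>c\<in>I. \<Sum>p<n. cnj (u p c) * u p c)"
    by (subst sum.swap) (simp add: mult.commute)
  also have "\<dots> = of_nat (card I)"
    by (simp add: orthonormal)
  finally show ?thesis by (simp only: of_nat_eq_iff)
qed

context block_frame
begin

lemma sum_dims: "(\<Sum>i<k. d i * m i) = n"
  using card_index by (simp add: block_index_def)

lemma dens_sum:
  "mat n n (\<lambda>rs. \<Sum>z<M. dens (Y z) w $$ rs) = dens (\<lambda>i a b. \<Sum>z<M. Y z i a b) w"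
proof -
  have "mat n n (\<lambda>rs. \<Sum>z<M. dens (Y z) w $$ rs) = mat n n (\<lambda>rs. \<Sum>z<M. 1 * dens (Y z) w $$ rs)"
    by simp
  also have "\<dots> = dens (\<lambda>i a b. \<Sum>z<M. Y z i a b) w"
    unfolding dens_def opr_sum by (rule opr_cong) (simp add: sum_distrib_right)
  finally show ?thesis .
qed

lemma trace_dens:
  assumes "\<And>i. i < k \<Longrightarrow> (\<Sum>\<alpha><m i. w i \<alpha> \<alpha>) = 1"
  shows "mat_trace (dens X w) = (\<Sum>i<k. \<Sum>a<d i. X i a a)"
  unfolding dens_def trace_opr sum_block_index
  using assms by (intro sum.cong refl) (simp add: sum_distrib_left[symmetric])

text \<open>For diagonal X the form splits into the forms of \<open>w i\<close> at the slices of g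
  with fixed (i, a), weighted by \<open>x i a\<close>. The states of the extremal ensemble are of
  this kind.\<close>

lemma psd_dens:
  assumes w: "\<And>i. i < k \<Longrightarrow> psd (m i) (mat (m i) (m i) (\<lambda>(\<alpha>, \<beta>). w i \<alpha> \<beta>))"
    and "\<And>i a. i < k \<Longrightarrow> a < d i \<Longrightarrow> 0 \<le> x i a"
  shows "psd n (dens (\<lambda>i a b. if a = b then of_real (x i a) else 0) w)"
  unfolding dens_def
proof (rule psd_oprI)
  fix g :: "nat \<times> nat \<times> nat \<Rightarrow> complex"
  let ?t = "\<lambda>c c'. cnj (g c) * (if fst c = fst c' then (if fst (snd c)
      = fst (snd c') then of_real (x (fst c) (fst (snd c))) else 0)
       * w (fst c) (snd (snd c)) (snd (snd c')) else 0) * g c'"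
  have inner: "(\<Sum>c'\<in>J. ?t (i, a, \<alpha>) c') = (\<Sum>\<beta><m i. of_real (x i a) * (cnj (g (i, a, \<alpha>)) * w i \<alpha> \<beta>
      * g (i, a, \<beta>)))"
    if ia: "i < k" "a < d i" for i a \<alpha>
  proof -
    have "(\<Sum>c'\<in>J. ?t (i, a, \<alpha>) c') = (\<Sum>j<k. \<Sum>b<d j. \<Sum>\<beta><m j.
        if j = i \<and> b = a then of_real (x i a) * (cnj (g (i, a, \<alpha>)) * w i \<alpha> \<beta> * g (i, a, \<beta>)) else 0)"
      unfolding sum_block_index fst_conv snd_conv by (intro sum.cong refl) (simp add: mult_ac)
    also have "\<dots> = (\<Sum>j<k. if j = i then (\<Sum>b<d i. if b = a then
        (\<Sum>\<beta><m i. of_real (x i a) * (cnj (g (i, a, \<alpha>)) * w i \<alpha> \<beta> * g (i, a, \<beta>))) else 0) else 0)"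
    proof -
      have c: "(\<Sum>\<beta><m j. if j = i \<and> b = a then of_real (x i a) * (cnj (g (i, a, \<alpha>)) * w i \<alpha> \<beta> * g
          (i, a, \<beta>)) else 0) =
        (if j = i then if b = a then \<Sum>\<beta><m i. of_real (x i a) * (cnj (g (i, a, \<alpha>)) * w i \<alpha> \<beta> * g
            (i, a, \<beta>)) else 0 else 0)" for j b
        by auto
      show ?thesis unfolding c by (intro sum.cong refl) simp
    qed
    also have "\<dots> = (\<Sum>\<beta><m i. of_real (x i a) * (cnj (g (i, a, \<alpha>)) * w i \<alpha> \<beta> * g (i, a, \<beta>)))"
      using ia by simp
    finally show ?thesis .
  qed
  have "(\<Sum>c\<in>J. \<Sum>c'\<in>J. ?t c c') = (\<Sum>i<k. \<Sum>a<d i. \<Sum>\<alpha><m i. \<Sum>c'\<in>J. ?t (i, a, \<alpha>) c')"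
    by (rule sum_block_index)
  also have "\<dots> = (\<Sum>i<k. \<Sum>a<d i. \<Sum>\<alpha><m i. \<Sum>\<beta><m i. of_real (x i a) * (cnj (g (i, a, \<alpha>)) * w i \<alpha> \<beta> * g
      (i, a, \<beta>)))"
    by (intro sum.cong refl inner) auto
  also have "\<dots> = (\<Sum>i<k. \<Sum>a<d i. of_real (x i a) * sesq (m i) (mat (m i) (m i) (\<lambda>(\<alpha>, \<beta>). w i \<alpha> \<beta>))
      (\<lambda>\<alpha>. g (i, a, \<alpha>)) (\<lambda>\<alpha>. g (i, a, \<alpha>)))"
    by (simp add: sesq_def sum_distrib_left)
  also have "0 \<le> \<dots>"
  proof (intro sum_nonneg mult_nonneg_nonneg)
    fix i a assume "i \<in> {..<k}" "a \<in> {..<d i}"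
    then show "0 \<le> complex_of_real (x i a)" using assms(2)[of i a] by
        (simp add: less_eq_complex_def)
  next
    fix i a assume "i \<in> {..<k}"
    then show "0 \<le> sesq (m i) (mat (m i) (m i) (\<lambda>(\<alpha>, \<beta>). w i \<alpha> \<beta>)) (\<lambda>\<alpha>. g (i, a, \<alpha>)) (\<lambda>\<alpha>. g (i, a,
        \<alpha>))"
      using w[of i] by (simp add: psd_iff_sesq)
  qed
  finally show "0 \<le> (\<Sum>c\<in>J. \<Sum>c'\<in>J. ?t c c')" .
qed

text \<open>The entropies of the densities \<open>w\<close> enter \<open>H(A)\<close> and \<open>H(AZ)\<close> with the same weights and
  cancel.\<close>

lemma mutual_information_dens:
  assumes w: "\<And>i. i < k \<Longrightarrow> triangularizable (m i) (w i) (\<mu> i)" "\<And>i \<alpha>. i < k \<Longrightarrow> \<alpha> < m i \<Longrightarrow> 0 \<le> \<mu> i \<alpha>"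
      "\<And>i. i < k \<Longrightarrow> (\<Sum>\<alpha><m i. w i \<alpha> \<alpha>) = 1"
    and \<rho>: "\<rho> \<in> carrier_mat (n * M) (n * M)"
      "\<And>y z. y < M \<Longrightarrow> z < M \<Longrightarrow> mat_slice n M \<rho> y z = (if y = z then dens (Y z) w else 0\<^sub>m n n)"
    and Y: "\<And>z i. z < M \<Longrightarrow> i < k \<Longrightarrow> triangularizable (d i) (Y z i) (l z i)" "\<And>z i a. z < M \<Longrightarrow> i < k
        \<Longrightarrow> a < d i \<Longrightarrow> 0 \<le> l z i a"
    and S: "\<And>i. i < k \<Longrightarrow> triangularizable (d i) (\<lambda>a b. \<Sum>z<M. Y z i a b) (s i)" "\<And>i a. i < k
        \<Longrightarrow> a < d i \<Longrightarrow> 0 \<le> s i a"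
  shows "mutual_information n M \<rho> = (\<Sum>i<k. \<Sum>a<d i. eta (s i a)) +
    (\<Sum>z<M. eta (\<Sum>i<k. \<Sum>a<d i. l z i a) - (\<Sum>i<k. \<Sum>a<d i. eta (l z i a)))"
proof -
  let ?W = "\<lambda>i. \<Sum>\<alpha><m i. eta (\<mu> i \<alpha>)"
  have \<mu>1: "(\<Sum>\<alpha><m i. \<mu> i \<alpha>) = 1" if "i < k" for i
    using triangularizable_trace[OF w(1)[OF that]] w(3)[OF that] by (metis of_real_eq_1_iff)
  have entry: "\<rho> $$ (p * M + y, q * M + z) = (if y = z then dens (Y z) w $$ (p, q) else 0)"
    if "p < n" "q < n" "y < M" "z < M" for p q y z
  proof -
    have "\<rho> $$ (p * M + y, q * M + z) = mat_slice n M \<rho> y z $$ (p, q)"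
      using that by simp
    then show ?thesis using that \<rho>(2)[of y z] by simp
  qed
  \<comment> \<open>The weight of block i in the marginal on A is its total weight over all letters;
    this identity makes the entropies of \<open>w\<close> cancel.\<close>
  have s_sum: "(\<Sum>a<d i. s i a) = (\<Sum>z<M. \<Sum>a<d i. l z i a)" if i: "i < k" for i
  proof -
    have "complex_of_real (\<Sum>a<d i. s i a) = (\<Sum>a<d i. \<Sum>z<M. Y z i a a)"
      using triangularizable_trace[OF S(1)[OF i]] by simp
    also have "\<dots> = (\<Sum>z<M. \<Sum>a<d i. Y z i a a)"
      by (rule sum.swap)
    also have "\<dots> = (\<Sum>z<M. complex_of_real (\<Sum>a<d i. l z i a))"
      using i by (intro sum.cong refl triangularizable_trace Y(1)) auto
    also have "\<dots> = complex_of_real (\<Sum>z<M. \<Sum>a<d i. l z i a)"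
      by simp
    finally show ?thesis by (simp only: of_real_eq_iff)
  qed
  have HA: "vn_entropy (ptrace_snd n M \<rho>) = (\<Sum>i<k. (\<Sum>a<d i. eta (s i a)) + (\<Sum>a<d i. s i a) * ?W i)"
  proof -
    have "ptrace_snd n M \<rho> = mat n n (\<lambda>rs. \<Sum>z<M. dens (Y z) w $$ rs)"
      by (rule eq_matI) (simp_all add: ptrace_snd_def entry)
    then have eq: "ptrace_snd n M \<rho> = dens (\<lambda>i a b. \<Sum>z<M. Y z i a b) w"
      by (simp only: dens_sum)
    have I: "(SIGMA i:{0..<k}. {..<d i} \<times> {..<m i}) = J"
      by (simp add: block_index_def atLeast0LessThan)
    have "vn_entropy (ptrace_snd n M \<rho>) = (\<Sum>i\<in>set [0..<k]. (\<Sum>a<d i. eta (s i a)) +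
        (\<Sum>a<d i. s i a) * ?W i)"
    proof (rule block_entropy[where n = n and B = u and B' = "\<lambda>c p. cnj (u p c)" and w = w and X
        = "\<lambda>i a b. \<Sum>z<M. Y z i a b" and m = m])
      show "ptrace_snd n M \<rho> \<in> carrier_mat n n" by (simp add: ptrace_snd_def)
      show "(\<Sum>i\<leftarrow>[0..<k]. d i * m i) = n"
        by (simp add: interv_sum_list_conv_sum_set_nat atLeast0LessThan sum_dims)
    qed (use w S \<mu>1 in \<open>simp_all add: I orthonormal eq dens_def opr_def\<close>)
    then show ?thesis by (simp add: atLeast0LessThan)
  qed
  \<comment> \<open>Off-diagonal slices vanish, so the marginal on Z is diagonal with the traces of
    the conditional operators as entries.\<close>
  have HZ: "vn_entropy (ptrace_fst n M \<rho>) = (\<Sum>z<M. eta (\<Sum>i<k. \<Sum>a<d i. l z i a))"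
  proof (rule vn_entropy_upper_triangular)
    show "ptrace_fst n M \<rho> \<in> carrier_mat M M" by (simp add: ptrace_fst_def)
    have e: "ptrace_fst n M \<rho> $$ (y, z) = (if y = z then mat_trace (dens (Y z) w) else 0)"
        if "y < M" "z < M" for y z
      using that carrier_matD[OF carriers(2)[of "Y z" w]] by
          (simp add: ptrace_fst_def entry mat_trace_def)
    show "upper_triangular (ptrace_fst n M \<rho>)"
    proof (rule upper_triangularI)
      fix y z assume yz: "z < y" "y < dim_row (ptrace_fst n M \<rho>)"
      then have "y < M" "z < M" by (simp_all add: ptrace_fst_def)
      then show "ptrace_fst n M \<rho> $$ (y, z) = 0" using e[of y z] yz by simp
    qed
    fix z assume z: "z < M"
    have "mat_trace (dens (Y z) w) = (\<Sum>i<k. \<Sum>a<d i. Y z i a a)"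
      by (rule trace_dens) (rule w(3))
    also have "\<dots> = (\<Sum>i<k. complex_of_real (\<Sum>a<d i. l z i a))"
      using z by (intro sum.cong refl triangularizable_trace Y(1)) auto
    finally show "ptrace_fst n M \<rho> $$ (z, z) = of_real (\<Sum>i<k. \<Sum>a<d i. l z i a)"
      using e[OF z z] by simp
  qed
  have HAZ: "vn_entropy \<rho> = (\<Sum>z<M. \<Sum>i<k. (\<Sum>a<d i. eta (l z i a)) + (\<Sum>a<d i. l z i a) * ?W i)"
  proof -
    let ?ks = "List.product [0..<M] [0..<k]"
    let ?I = "SIGMA zi:set ?ks. {..<d (snd zi)} \<times> {..<m (snd zi)}"
    \<comment> \<open>The product basis: the frame vector (i, x) tensored with the z-th basis vector
      of the register has the label ((z, i), x). So the pair (z, i) becomes the block label in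
      \<open>block_entropy\<close>.\<close>
    define B where "B r c = (if r mod M = fst (fst c) then u (r div M) (snd (fst c), snd c) else 0)"
      for r and c :: "(nat \<times> nat) \<times> nat \<times> nat"
    have sumI: "(\<Sum>c\<in>?I. f c) = (\<Sum>z<M. \<Sum>c\<in>J. f ((z, fst c), snd c))" for f :: "_ \<Rightarrow> complex"
    proof -
      have "(\<Sum>c\<in>?I. f c) = (\<Sum>zc\<in>{..<M} \<times> J. f ((fst zc, fst (snd zc)), snd (snd zc)))"
        by (rule sum.reindex_bij_witness[where i = "\<lambda>zc. ((fst zc, fst (snd zc)), snd (snd zc))"
              and j = "\<lambda>c. (fst (fst c), (snd (fst c), snd c))"]) (auto simp: block_index_def)
      also have "\<dots> = (\<Sum>z<M. \<Sum>c\<in>J. f ((z, fst c), snd c))"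
        by (simp add: sum.cartesian_product case_prod_unfold)
      finally show ?thesis .
    qed
    have "vn_entropy \<rho> = (\<Sum>zi\<in>set ?ks. (\<Sum>a<d (snd zi). eta (l (fst zi) (snd zi) a)) +
        (\<Sum>a<d (snd zi). l (fst zi) (snd zi) a) * ?W (snd zi))"
    proof (rule block_entropy[where n = "n * M" and B = B and B' = "\<lambda>c p. cnj (B p c)" and w
        = "\<lambda>zi. w (snd zi)"
          and X = "\<lambda>zi. Y (fst zi) (snd zi)" and m = "\<lambda>zi. m (snd zi)" and d = "\<lambda>zi. d (snd zi)"
          and l = "\<lambda>zi. l (fst zi) (snd zi)" and \<mu> = "\<lambda>zi. \<mu> (snd zi)"])
      show "\<rho> \<in> carrier_mat (n * M) (n * M)" by fact
      show "distinct ?ks" by (simp add: distinct_product)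
      have "(\<Sum>zi\<leftarrow>?ks. d (snd zi) * m (snd zi)) = (\<Sum>zi\<in>set ?ks. d (snd zi) * m (snd zi))"
        by (rule sum_list_distinct_conv_sum_set) (simp add: distinct_product)
      also have "\<dots> = (\<Sum>z<M. \<Sum>i<k. d i * m i)"
        by (simp only: set_product set_upt atLeast0LessThan sum.cartesian_product case_prod_unfold)
      also have "\<dots> = n * M"
        by (simp add: sum_dims)
      finally show "(\<Sum>zi\<leftarrow>?ks. d (snd zi) * m (snd zi)) = n * M" .
    next
      fix c e assume "c \<in> ?I" "e \<in> ?I"
      then obtain y i x z j x' where c: "c = ((y, i), x)" "e
          = ((z, j), x')" "y < M" "z < M" "(i, x) \<in> J" "(j, x') \<in> J"
        by (cases c, cases e) (auto simp: block_index_def)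
      have "(\<Sum>r<n * M. cnj (B r c) * B r e) = (\<Sum>p<n. \<Sum>t<M. if t = y then (if y
          = z then cnj (u p (i, x)) * u p (j, x') else 0) else 0)"
        unfolding sum_mult_split by (intro sum.cong refl) (auto simp: B_def c)
      also have "\<dots> = (if c = e then 1 else 0)"
        using c by (cases "y = z") (simp_all add: orthonormal)
      finally show "(\<Sum>r<n * M. cnj (B r c) * B r e) = (if c = e then 1 else 0)" .
    next
      fix r r' assume rr: "r < n * M" "r' < n * M"
      then have M: "M > 0" by (cases M) auto
      define p y q z where "p = r div M" and "y = r mod M" and "q = r' div M" and "z = r' mod M"
      then have pq: "p < n" "y < M" "q < n" "z < M" "r = p * M + y" "r' = q * M + z"
        using rr M by (simp_all add: less_mult_imp_div_less)
      let ?F = "\<lambda>c e. if fst c = fst e then Y (fst (fst c)) (snd (fst c)) (fst (snd c)) (fst (snd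
          e)) *
            w (snd (fst c)) (snd (snd c)) (snd (snd e)) else 0"
      let ?f = "\<lambda>z c e. if fst c = fst e then Y z (fst c) (fst (snd c)) (fst (snd e)) * w (fst c)
          (snd (snd c)) (snd (snd e)) else 0"
      have "(\<Sum>c\<in>?I. \<Sum>e\<in>?I. B r c * ?F c e * cnj (B r' e)) =
         (\<Sum>t<M. \<Sum>c\<in>J. \<Sum>t'<M. \<Sum>e\<in>J. B r ((t, fst c), snd c) * ?F ((t, fst c), snd c) ((t', fst e),
             snd e) * cnj (B r' ((t', fst e), snd e)))"
        by (simp only: sumI)
      also have "\<dots> = (\<Sum>t<M. \<Sum>c\<in>J. \<Sum>t'<M. \<Sum>e\<in>J. if t = y then if t' = z then if y
          = z then u p c * ?f z c e * cnj (u q e) else 0 else 0 else 0)"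
      proof (intro sum.cong refl)
        fix t t' and c e :: "nat \<times> nat \<times> nat"
        show "B r ((t, fst c), snd c) * ?F ((t, fst c), snd c) ((t', fst e), snd e) * cnj (B r'
            ((t', fst e), snd e)) =
          (if t = y then if t' = z then if y = z then u p c * ?f z c e * cnj (u q e) else 0 else 0
              else 0)"
          unfolding B_def p_def[symmetric] y_def[symmetric] q_def[symmetric] z_def[symmetric]
              fst_conv snd_conv prod.collapse
          by (cases "t = y"; cases "t' = z"; cases "y = z") simp_all
      qed
      also have "\<dots> = (\<Sum>t<M. if t = y then (\<Sum>c\<in>J. \<Sum>t'<M. if t' = z then
          (if y = z then \<Sum>e\<in>J. u p c * ?f z c e * cnj (u q e) else 0) else 0) else 0)"
      proof -
        have push: "(\<Sum>e\<in>E. if Q then h e else 0) = (if Q then \<Sum>e\<in>E. h e else 0)"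
          for E :: "'e set" and Q and h :: "'e \<Rightarrow> complex"
          by simp
        show ?thesis by (simp only: push)
      qed
      also have "\<dots> = (if y = z then dens (Y z) w $$ (p, q) else 0)"
        using pq(1-4) by (simp add: dens_def opr_def)
      also have "\<dots> = \<rho> $$ (r, r')"
        using entry[OF pq(1,3,2,4)] by (simp add: pq(5,6))
      finally show "\<rho> $$ (r, r') = (\<Sum>c\<in>?I. \<Sum>e\<in>?I. B r c * ?F c e * cnj (B r' e))" by (rule sym)
    qed (use w Y \<mu>1 in auto)
    also have "\<dots> = (\<Sum>z<M. \<Sum>i<k. (\<Sum>a<d i. eta (l z i a)) + (\<Sum>a<d i. l z i a) * ?W i)"
      by (simp add: sum.cartesian_product case_prod_unfold atLeast0LessThan)
    finally show ?thesis .
  qed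
  have "(\<Sum>i<k. (\<Sum>a<d i. s i a) * ?W i) = (\<Sum>z<M. \<Sum>i<k. (\<Sum>a<d i. l z i a) * ?W i)"
    by (subst sum.swap) (simp add: s_sum sum_distrib_right)
  then show ?thesis
    unfolding mutual_information_def HA HZ HAZ by (simp add: sum.distrib sum_subtractf)
qed

end

section \<open>Classical-quantum states, the upper bound and its attainment\<close>

lemma mat_slice_cq:
  assumes R: "\<And>z. z < M \<Longrightarrow> R z \<in> carrier_mat n n" and yz: "y < M" "z < M"
  shows "mat_slice n M (mat (n * M) (n * M)
      (\<lambda>rs. \<Sum>t<M. (complex_of_real (p t) \<cdot>\<^sub>m kron (R t) (proj_basis M t)) $$ rs)) y z =
    (if y = z then of_real (p z) \<cdot>\<^sub>m R z else 0\<^sub>m n n)"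
proof (rule eq_matI)
  let ?Z = "if y = z then of_real (p z) \<cdot>\<^sub>m R z else 0\<^sub>m n n"
  have Z: "?Z \<in> carrier_mat n n" using R yz by auto
  fix i j assume "i < dim_row ?Z" "j < dim_col ?Z"
  then have ij: "i < n" "j < n" using Z by auto
  have M: "0 < M" using yz by simp
  have "(complex_of_real (p t) \<cdot>\<^sub>m kron (R t) (proj_basis M t)) $$ (i * M + y, j * M + z) =
      (if t = y then if y = z then of_real (p z) * R z $$ (i, j) else 0 else 0)" if t: "t < M" for t
    using R[OF t] ij yz M by (auto simp: kron_def proj_basis_def mult_add_less)
  then have "(\<Sum>t<M. (complex_of_real (p t) \<cdot>\<^sub>m kron (R t) (proj_basis M t)) $$ (i * M + y, j * M
      + z)) =
      (\<Sum>t<M. if t = y then if y = z then of_real (p z) * R z $$ (i, j) else 0 else 0)"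
    by (intro sum.cong refl) auto
  also have "\<dots> = ?Z $$ (i, j)"
    using R[OF yz(2)] yz ij by simp
  finally show "mat_slice n M (mat (n * M) (n * M)
      (\<lambda>rs. \<Sum>t<M. (complex_of_real (p t) \<cdot>\<^sub>m kron (R t) (proj_basis M t)) $$ rs)) y z $$ (i, j)
          = ?Z $$ (i, j)"
    using ij yz by (simp add: mult_add_less)
qed (use R yz in auto)

lemma psd_smult:
  assumes "psd n A" "0 \<le> c"
  shows "psd n (complex_of_real c \<cdot>\<^sub>m A)"
proof -
  have "sesq n (complex_of_real c \<cdot>\<^sub>m A) f f = of_real c * sesq n A f f" if "A \<in> carrier_mat n n"
      for f
    using that by (simp add: sesq_def sum_distrib_left mult_ac)
  then show ?thesis
    using assms by (auto simp: psd_iff_sesq less_eq_complex_def)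
qed

lemma psd_sum:
  assumes "\<And>z. z < M \<Longrightarrow> psd n (mat n n (\<lambda>(a, b). X z a b))"
  shows "psd n (mat n n (\<lambda>(a, b). \<Sum>z<M. X z a b))"
proof -
  have "sesq n (mat n n (\<lambda>(a, b). \<Sum>z<M. X z a b)) f f = (\<Sum>z<M. sesq n (mat n n (\<lambda>(a, b). X z a b))
      f f)" for f
  proof -
    have "sesq n (mat n n (\<lambda>(a, b). \<Sum>z<M. X z a b)) f f = (\<Sum>i<n. \<Sum>j<n. \<Sum>z<M. cnj (f i) * X z i j *
        f j)"
      by (simp add: sesq_def sum_distrib_left sum_distrib_right)
    also have "\<dots> = (\<Sum>i<n. \<Sum>z<M. \<Sum>j<n. cnj (f i) * X z i j * f j)"
      by (intro sum.cong refl sum.swap)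
    also have "\<dots> = (\<Sum>z<M. \<Sum>i<n. \<Sum>j<n. cnj (f i) * X z i j * f j)"
      by (rule sum.swap)
    finally show ?thesis by (simp add: sesq_def)
  qed
  then show ?thesis
    using assms by (auto simp: psd_iff_sesq intro!: sum_nonneg)
qed

lemma psd_triangularizable_family:
  assumes "\<And>i. i \<in> K \<Longrightarrow> psd (d i) (mat (d i) (d i) (\<lambda>(a, b). X i a b))"
  shows "\<exists>l. \<forall>i\<in>K. triangularizable (d i) (X i) (l i) \<and> (\<forall>a<d i. 0 \<le> l i a)"
proof (rule bchoice, rule ballI)
  fix i assume "i \<in> K"
  then obtain l where "triangularizable (d i) (X i) l" "\<And>a. a < d i \<Longrightarrow> 0 \<le> l a"
    using psd_triangularizable[OF assms] by blast
  then show "\<exists>l. triangularizable (d i) (X i) l \<and> (\<forall>a<d i. 0 \<le> l a)" by blast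
qed

context block_frame
begin

lemma mutual_information_le:
  assumes w: "\<And>i. i < k \<Longrightarrow> psd (m i) (mat (m i) (m i) (\<lambda>(\<alpha>, \<beta>). w i \<alpha> \<beta>))"
      "\<And>i. i < k \<Longrightarrow> (\<Sum>\<alpha><m i. w i \<alpha> \<alpha>) = 1"
    and fixed: "\<And>\<rho>. \<rho> \<in> carrier_mat n n \<Longrightarrow> \<Phi>' \<rho> = \<rho> \<Longrightarrow>
       \<rho> = dens (\<lambda>i a b. \<Sum>\<gamma><m i. coef \<rho> (i, a, \<gamma>) (i, b, \<gamma>)) w"
    and cq: "cq_state n M \<rho>" and inv: "tensor_id n M \<Phi>' \<rho> = \<rho>"
    and car: "\<And>X. X \<in> carrier_mat n n \<Longrightarrow> \<Phi>' X \<in> carrier_mat n n"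
  shows "mutual_information n M \<rho> \<le> log 2 (real (\<Sum>i<k. d i))"
proof -
  obtain p R where p: "\<And>z. z < M \<Longrightarrow> 0 \<le> p z" "(\<Sum>z<M. p z) = 1"
    and R: "\<And>z. z < M \<Longrightarrow> density n (R z)"
    and \<rho>: "\<rho> = mat (n * M) (n * M) (\<lambda>rs. \<Sum>z<M. (complex_of_real (p z) \<cdot>\<^sub>m kron (R z) (proj_basis
        M z)) $$ rs)"
    using cq unfolding cq_state_def by blast
  have RC: "R z \<in> carrier_mat n n" if "z < M" for z
    using R[OF that] by (simp add: density_def psd_def)
  \<comment> \<open>The conditional states are kept unnormalized, so that letters of probability 0
    need no separate treatment.\<close>
  define A where "A z = complex_of_real (p z) \<cdot>\<^sub>m R z" for z
  have AC: "A z \<in> carrier_mat n n" if "z < M" for z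
    using RC[OF that] by (simp add: A_def)
  have A_psd: "psd n (A z)" if "z < M" for z
    using R[OF that] p(1)[OF that] unfolding A_def density_def by (intro psd_smult) auto
  have A_tr: "mat_trace (A z) = of_real (p z)" if "z < M" for z
    using R[OF that] mat_trace_smult[OF RC[OF that]] by (simp add: A_def density_def)
  have slice: "mat_slice n M \<rho> y z = (if y = z then A z else 0\<^sub>m n n)" if "y < M" "z < M" for y z
    unfolding \<rho> A_def by (rule mat_slice_cq[OF RC that])
  \<comment> \<open>Invariance of the joint state, read off at the diagonal slice of the letter
    z.\<close>
  have A_fix: "\<Phi>' (A z) = A z" if "z < M" for z
  proof -
    have "mat_slice n M (tensor_id n M \<Phi>' \<rho>) z z = \<Phi>' (mat_slice n M \<rho> z z)"
      using that by (intro mat_slice_tensor_id) (simp_all add: slice car AC)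
    then show ?thesis using that by (simp add: inv slice)
  qed
  define Y where "Y z i a b = (\<Sum>\<gamma><m i. coef (A z) (i, a, \<gamma>) (i, b, \<gamma>))" for z i a b
  have A_dens: "A z = dens (Y z) w" if "z < M" for z
    unfolding Y_def by (rule fixed[OF AC[OF that] A_fix[OF that]])
  have Y_psd: "psd (d i) (mat (d i) (d i) (\<lambda>(a, b). Y z i a b))" if "z < M" "i < k" for z i
    unfolding Y_def by (rule block_marginal_psd[OF A_psd[OF that(1)] that(2)])
  obtain \<mu> where \<mu>: "\<And>i. i < k \<Longrightarrow> triangularizable (m i) (w i) (\<mu> i)" "\<And>i \<alpha>. i < k \<Longrightarrow> \<alpha> < m i
      \<Longrightarrow> 0 \<le> \<mu> i \<alpha>"
  proof -
    have "\<exists>\<mu>. \<forall>i\<in>{..<k}. triangularizable (m i) (w i) (\<mu> i) \<and> (\<forall>\<alpha><m i. 0 \<le> \<mu> i \<alpha>)"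
      by (rule psd_triangularizable_family) (simp add: w(1))
    then show ?thesis using that by auto
  qed
  have "\<exists>l. \<forall>zi\<in>{..<M} \<times> {..<k}. triangularizable (d (snd zi)) (Y (fst zi) (snd zi)) (l zi) \<and>
      (\<forall>a<d (snd zi). 0 \<le> l zi a)"
    by (rule psd_triangularizable_family) (use Y_psd in auto)
  then obtain l' where l': "\<forall>zi\<in>{..<M} \<times> {..<k}. triangularizable (d (snd zi)) (Y (fst zi) (snd
      zi)) (l' zi) \<and> (\<forall>a<d (snd zi). 0 \<le> l' zi a)"
    by blast
  define l where "l z i = l' (z, i)" for z i
  have l: "triangularizable (d i) (Y z i) (l z i)" "\<And>a. a < d i \<Longrightarrow> 0 \<le> l z i a" if "z < M" "i < k"
      for z i
    using l'[rule_format, of "(z, i)"] that by (simp_all add: l_def)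
  have "psd (d i) (mat (d i) (d i) (\<lambda>(a, b). \<Sum>z<M. Y z i a b))" if "i < k" for i
    using that by (intro psd_sum Y_psd)
  then have "\<exists>s. \<forall>i\<in>{..<k}. triangularizable (d i) (\<lambda>a b. \<Sum>z<M. Y z i a b) (s i) \<and> (\<forall>a<d i. 0 \<le> s
      i a)"
    by (intro psd_triangularizable_family) simp
  then obtain s where s: "\<And>i. i < k \<Longrightarrow> triangularizable (d i) (\<lambda>a b. \<Sum>z<M. Y z i a b) (s i)"
      "\<And>i a. i < k \<Longrightarrow> a < d i \<Longrightarrow> 0 \<le> s i a"
    by auto
  have MI: "mutual_information n M \<rho> = (\<Sum>i<k. \<Sum>a<d i. eta (s i a)) +
    (\<Sum>z<M. eta (\<Sum>i<k. \<Sum>a<d i. l z i a) - (\<Sum>i<k. \<Sum>a<d i. eta (l z i a)))"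
    by (rule mutual_information_dens[where \<mu> = \<mu> and w = w and Y = Y])
       (use \<mu> w(2) l s in \<open>simp_all add: slice A_dens, simp add: \<rho>\<close>)
  let ?S = "SIGMA i:{..<k}. {..<d i}"
  have pairs: "(\<Sum>i<k. \<Sum>a<d i. f i a) = (\<Sum>x\<in>?S. f (fst x) (snd x))" for f :: "nat \<Rightarrow> nat \<Rightarrow> real"
    by (simp add: sum.Sigma case_prod_unfold)
  \<comment> \<open>Subadditivity makes the summand of every letter in \<open>MI\<close>
    nonpositive; the entropy of the summed blocks is what remains to be bounded.\<close>
  have z: "eta (\<Sum>i<k. \<Sum>a<d i. l z i a) \<le> (\<Sum>i<k. \<Sum>a<d i. eta (l z i a))" if "z < M" for z
    unfolding pairs using l(2)[OF that] by (intro eta_sum_le) auto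
  have l_sum: "(\<Sum>i<k. \<Sum>a<d i. l z i a) = p z" if "z < M" for z
  proof -
    have "complex_of_real (\<Sum>i<k. \<Sum>a<d i. l z i a) = (\<Sum>i<k. \<Sum>a<d i. Y z i a a)"
      using that by (simp add: triangularizable_trace[OF l(1)])
    also have "\<dots> = mat_trace (A z)"
      unfolding A_dens[OF that] by (rule trace_dens[symmetric]) (rule w(2))
    also note A_tr[OF that]
    finally show ?thesis by (simp only: of_real_eq_iff)
  qed
  have "complex_of_real (\<Sum>i<k. \<Sum>a<d i. s i a) = (\<Sum>i<k. \<Sum>a<d i. \<Sum>z<M. Y z i a a)"
    by (simp add: triangularizable_trace[OF s(1)])
  also have "\<dots> = (\<Sum>i<k. \<Sum>z<M. \<Sum>a<d i. Y z i a a)"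
    by (intro sum.cong refl sum.swap)
  also have "\<dots> = (\<Sum>z<M. \<Sum>i<k. \<Sum>a<d i. Y z i a a)"
    by (rule sum.swap)
  also have "\<dots> = complex_of_real (\<Sum>z<M. \<Sum>i<k. \<Sum>a<d i. l z i a)"
    by (simp add: triangularizable_trace[OF l(1)])
  also have "\<dots> = 1"
    using p(2) by (simp add: l_sum)
  finally have s_sum: "(\<Sum>i<k. \<Sum>a<d i. s i a) = 1"
    by (simp only: of_real_eq_1_iff)
  \<comment> \<open>A total weight of 1 excludes an empty set of pairs, as
    \<open>entropy_le_log_card\<close> requires.\<close>
  then have "?S \<noteq> {}" unfolding pairs by auto
  then have "(\<Sum>i<k. \<Sum>a<d i. eta (s i a)) \<le> log 2 (card ?S)"
    unfolding pairs using s(2) s_sum unfolding pairs by (intro entropy_le_log_card) auto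
  moreover have "(\<Sum>z<M. eta (\<Sum>i<k. \<Sum>a<d i. l z i a) - (\<Sum>i<k. \<Sum>a<d i. eta (l z i a))) \<le> 0"
    using z by (intro sum_nonpos) auto
  ultimately show ?thesis unfolding MI by simp
qed

lemma mutual_information_attained:
  assumes w: "\<And>i. i < k \<Longrightarrow> psd (m i) (mat (m i) (m i) (\<lambda>(\<alpha>, \<beta>). w i \<alpha> \<beta>))"
      "\<And>i. i < k \<Longrightarrow> (\<Sum>\<alpha><m i. w i \<alpha> \<alpha>) = 1"
    and fixed: "\<And>X. \<Phi>' (dens X w) = dens X w" and k: "0 < k"
  shows "\<exists>M \<rho>. cq_state n M \<rho> \<and> tensor_id n M \<Phi>' \<rho> = \<rho> \<and> mutual_information n M \<rho> = log 2 (real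
      (\<Sum>i<k. d i))"
proof -
  let ?S = "SIGMA i:{..<k}. {..<d i}"
  \<comment> \<open>The register gets one letter for each pair (i, a), and \<open>h\<close>
    enumerates these pairs.\<close>
  define M where "M = (\<Sum>i<k. d i)"
  have card: "card ?S = M" by (simp add: M_def)
  have M0: "0 < M" using d_pos[of 0] k by (auto simp: M_def intro!: sum_pos2[of _ 0])
  obtain h where h: "bij_betw h {..<M} ?S"
    using ex_bij_betw_nat_finite[of ?S] by (auto simp: card atLeast0LessThan)
  have hS: "h z \<in> ?S" if "z < M" for z
    using h that by (auto simp: bij_betw_def)
  have pairs: "(\<Sum>i<k. \<Sum>a<d i. f i a) = (\<Sum>x\<in>?S. f (fst x) (snd x))"
      for f :: "nat \<Rightarrow> nat \<Rightarrow> 'a::comm_monoid_add"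
    by (simp add: sum.Sigma case_prod_unfold)
  have single: "(\<Sum>i<k. \<Sum>a<d i. if h z = (i, a) then c else 0) = c" if "z < M"
      for z and c :: "'a::comm_monoid_add"
  proof -
    have "(\<Sum>i<k. \<Sum>a<d i. if h z = (i, a) then c else 0) = (\<Sum>x\<in>?S. if x = h z then c else 0)"
      unfolding pairs by (intro sum.cong refl) auto
    then show ?thesis using hS[OF that] by simp
  qed
  have count: "(\<Sum>z<M. if h z = x then c else 0) = c" if "x \<in> ?S"
      for x and c :: "'a::comm_monoid_add"
  proof -
    have "(\<Sum>z<M. if h z = x then c else 0) = (\<Sum>y\<in>?S. if y = x then c else 0)"
      by (rule sum.reindex_bij_betw[OF h])
    then show ?thesis using that by simp
  qed
  let ?x = "\<lambda>t z i a. if h z = (i, a) then t else (0::real)"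
  \<comment> \<open>If the letter z stands for (i, a), this is t |a><a| \<otimes> \<open>w i\<close>
    in block i. The weight t is a parameter, so that the conditional state (t = 1) and the slice of
    the joint state (t = p) have the same form.\<close>
  define D where "D t z = dens (\<lambda>i a b. if a = b then of_real (?x t z i a) else 0) w" for t z
  have D_smult: "complex_of_real t \<cdot>\<^sub>m D 1 z = D t z" for t z
    unfolding D_def dens_def smult_opr by (rule opr_cong) simp
  have D_density: "density n (D 1 z)" if "z < M" for z
    unfolding density_def
  proof
    show "psd n (D 1 z)" unfolding D_def by (rule psd_dens[OF w(1)]) auto
    have "mat_trace (D 1 z) = (\<Sum>i<k. \<Sum>a<d i. if h z = (i, a) then 1 else 0)"
      unfolding D_def by (subst trace_dens[where w = w, OF w(2)]) (auto intro!: sum.cong)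
    then show "mat_trace (D 1 z) = 1" using single[OF that] by simp
  qed
  have DC: "D t z \<in> carrier_mat n n" for t z by (simp add: D_def)
  define p where "p = 1 / real M"
  define \<rho> where "\<rho> = mat (n * M) (n * M) (\<lambda>rs. \<Sum>z<M. (complex_of_real p \<cdot>\<^sub>m kron (D 1 z)
      (proj_basis M z)) $$ rs)"
  have slice: "mat_slice n M \<rho> y z = (if y = z then D p z else 0\<^sub>m n n)" if "y < M" "z < M" for y z
    unfolding \<rho>_def using mat_slice_cq[of M "D 1" n y z "\<lambda>_. p"] DC that by (simp add: D_smult)
  have cq: "cq_state n M \<rho>"
    unfolding cq_state_def
  proof (intro exI conjI)
    show "\<rho> = mat (n * M) (n * M) (\<lambda>rs. \<Sum>z<M. (complex_of_real ((\<lambda>_. p) z) \<cdot>\<^sub>m kron (D 1 z)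
        (proj_basis M z)) $$ rs)"
      by (simp add: \<rho>_def)
  qed (use M0 D_density in \<open>auto simp: p_def\<close>)
  \<comment> \<open>The off-diagonal slices are 0. The map is known here only to fix the operators
    \<open>dens X w\<close>, so its value at 0 is obtained from X = 0.\<close>
  have zero: "\<Phi>' (0\<^sub>m n n) = 0\<^sub>m n n"
  proof -
    have "dens (\<lambda>_ _ _. 0) w = 0\<^sub>m n n" unfolding dens_def zero_opr by (rule opr_cong) simp
    then show ?thesis using fixed[of "\<lambda>_ _ _. 0"] by simp
  qed
  have inv: "tensor_id n M \<Phi>' \<rho> = \<rho>"
  proof (rule eq_matI)
    fix r s assume "r < dim_row \<rho>" "s < dim_col \<rho>"
    then have rs: "r < n * M" "s < n * M" by (simp_all add: \<rho>_def)
    let ?y = "r mod M" and ?z = "s mod M"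
    have m: "?y < M" "?z < M" "r div M < n" "s div M < n"
      using rs M0 by (simp_all add: less_mult_imp_div_less)
    have "\<Phi>' (mat_slice n M \<rho> ?y ?z) = mat_slice n M \<rho> ?y ?z"
      using m by (simp add: slice zero D_def fixed)
    then have "tensor_id n M \<Phi>' \<rho> $$ (r, s) = mat_slice n M \<rho> ?y ?z $$ (r div M, s div M)"
      using rs by (simp add: tensor_id_def)
    also have "\<dots> = \<rho> $$ (r, s)"
      using m by simp
    finally show "tensor_id n M \<Phi>' \<rho> $$ (r, s) = \<rho> $$ (r, s)" .
  qed (simp_all add: tensor_id_def \<rho>_def)
  obtain \<mu> where \<mu>: "\<And>i. i < k \<Longrightarrow> triangularizable (m i) (w i) (\<mu> i)" "\<And>i \<alpha>. i < k \<Longrightarrow> \<alpha> < m i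
      \<Longrightarrow> 0 \<le> \<mu> i \<alpha>"
  proof -
    have "\<exists>\<mu>. \<forall>i\<in>{..<k}. triangularizable (m i) (w i) (\<mu> i) \<and> (\<forall>\<alpha><m i. 0 \<le> \<mu> i \<alpha>)"
      by (rule psd_triangularizable_family) (simp add: w(1))
    then show ?thesis using that by auto
  qed
  have p0: "0 \<le> p" by (simp add: p_def)
  have "mutual_information n M \<rho> = (\<Sum>i<k. \<Sum>a<d i. eta p) +
    (\<Sum>z<M. eta (\<Sum>i<k. \<Sum>a<d i. ?x p z i a) - (\<Sum>i<k. \<Sum>a<d i. eta (?x p z i a)))"
  proof (rule mutual_information_dens[OF \<mu> w(2)])
    show "\<rho> \<in> carrier_mat (n * M) (n * M)" by (simp add: \<rho>_def)
    show "mat_slice n M \<rho> y z = (if y = z then dens (\<lambda>i a b. if a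
        = b then of_real (?x p z i a) else 0) w else 0\<^sub>m n n)"
      if "y < M" "z < M" for y z
      using slice[OF that] by (simp add: D_def)
    show "triangularizable (d i) (\<lambda>a b. if a = b then of_real (?x p z i a) else 0) (?x p z i)"
        for z i
      by (rule triangularizable_diagonal) simp
    \<comment> \<open>Each pair (i, a) belongs to exactly one letter, so the summed blocks are p
      times the identity.\<close>
    show "triangularizable (d i) (\<lambda>a b. \<Sum>z<M. if a = b then complex_of_real (?x p z i a) else 0)
        (\<lambda>a. p)" if "i < k" for i
    proof (rule triangularizable_diagonal)
      fix a b assume ab: "a < d i" "b < d i"
      have "(\<Sum>z<M. complex_of_real (?x p z i a)) = of_real (\<Sum>z<M. ?x p z i a)"
        by simp
      also have "(\<Sum>z<M. ?x p z i a) = p"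
        using that ab by (intro count) auto
      finally show "(\<Sum>z<M. if a = b then complex_of_real (?x p z i a) else 0) = (if a
          = b then of_real p else 0)"
        by (cases "a = b") simp_all
    qed
  qed (use p0 in auto)
  also have "(\<Sum>i<k. \<Sum>a<d i. eta p) = real M * eta p"
    by (simp add: M_def sum_distrib_right)
  \<comment> \<open>Each letter has a single nonzero block eigenvalue, which turns subadditivity
    into equality.\<close>
  also have "(\<Sum>z<M. eta (\<Sum>i<k. \<Sum>a<d i. ?x p z i a) - (\<Sum>i<k. \<Sum>a<d i. eta (?x p z i a))) = 0"
  proof (intro sum.neutral ballI)
    fix z assume "z \<in> {..<M}"
    then have z: "z < M" by simp
    have "(\<Sum>i<k. \<Sum>a<d i. eta (?x p z i a)) = (\<Sum>i<k. \<Sum>a<d i. if h z = (i, a) then eta p else 0)"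
      by (intro sum.cong refl) (simp add: eta_def)
    then show "eta (\<Sum>i<k. \<Sum>a<d i. ?x p z i a) - (\<Sum>i<k. \<Sum>a<d i. eta (?x p z i a)) = 0"
      using single[OF z, of p] single[OF z, of "eta p"] by simp
  qed
  also have "real M * eta p + 0 = log 2 (real (\<Sum>i<k. d i))"
    using M0 unfolding M_def[symmetric] by (simp add: eta_def p_def log_divide)
  finally have "mutual_information n M \<rho> = log 2 (real (\<Sum>i<k. d i))" .
  with cq inv show ?thesis by blast
qed

end

theorem proposition4p5:
  fixes n :: nat and \<Phi> \<Phi>' :: "complex mat \<Rightarrow> complex mat" and ds :: "nat list"
  assumes "n > 0"
    and "completely_positive n \<Phi>"
    and "unital n \<Phi>"
    and "hs_dual n \<Phi> \<Phi>'"
    and "\<exists>\<sigma> \<in> Fix n \<Phi>'. vec_space.rank n \<sigma> = n"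
    and "block_dims n (Fix n \<Phi>) ds"
  shows "(\<forall>m \<rho>. cq_state n m \<rho> \<and> tensor_id n m \<Phi>' \<rho> = \<rho>
            \<longrightarrow> mutual_information n m \<rho> \<le> log 2 (real (\<Sum>d\<leftarrow>ds. d)))
       \<and> (\<exists>m \<rho>. cq_state n m \<rho> \<and> tensor_id n m \<Phi>' \<rho> = \<rho>
            \<and> mutual_information n m \<rho> = log 2 (real (\<Sum>d\<leftarrow>ds. d)))"
proof -
  obtain mu u where frame: "block_frame n (length ds) ((!) ds) mu u"
    and Fix: "Fix n \<Phi> = range (block_frame.blk n (length ds) ((!) ds) mu u)"
    using block_dims_imp_block_frame[OF assms(6)] .
  interpret block_frame n "length ds" "(!) ds" mu u by (rule frame)
  obtain w where w: "\<And>i. i < length ds \<Longrightarrow> psd (mu i) (mat (mu i) (mu i) (\<lambda>(\<alpha>, \<beta>). w i \<alpha> \<beta>))"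
      "\<And>i. i < length ds \<Longrightarrow> (\<Sum>\<alpha><mu i. w i \<alpha> \<alpha>) = 1"
    and fix1: "\<And>\<rho>. \<rho> \<in> carrier_mat n n \<Longrightarrow> \<Phi>' \<rho> = \<rho> \<Longrightarrow>
       \<rho> = dens (\<lambda>i a b. \<Sum>\<gamma><mu i. coef \<rho> (i, a, \<gamma>) (i, b, \<gamma>)) w"
    and fix2: "\<And>X. \<Phi>' (dens X w) = dens X w"
    by (rule dual_fixed_points[OF assms(2,3,4) Fix]) (rule that; blast)
  have total: "(\<Sum>d\<leftarrow>ds. d) = (\<Sum>i<length ds. ds ! i)"
    by (simp add: sum_list_sum_nth atLeast0LessThan)
  \<comment> \<open>The block sizes add up to n > 0, so there is a block; without one the extremal
    ensemble would have no letters.\<close>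
  have "0 < length ds"
    using sum_dims assms(1) by (cases "length ds") auto
  moreover have "\<Phi>' X \<in> carrier_mat n n" if "X \<in> carrier_mat n n" for X
    using assms(4) that by (simp add: hs_dual_def)
  ultimately show ?thesis
    unfolding total
    using mutual_information_le[of w \<Phi>'] mutual_information_attained[of w \<Phi>'] w fix1 fix2 by blast
qed

end
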